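(* For integers $d\geq2$, $p\geq1$, $n\geq2$, let $q_{d,p,n}$ and $t_{d,p,n}$ be the extremal exponents defined in the context. The following hold. (a) For all integers $d\geq2$ and $p\geq1$, \[ t_{d,p,2}=\log_2(2^p+2d), \qquad q_{d,p,2}=\frac{2^d p}{\log_2(2^p+2d)}. \] (b) There is an absolute constant $c>0$ (independent of $d,p,n$) such that for each fixed $d\geq2$ and $p\geq1$, as $n\to\infty$, \[ d+p -\bigl(1+o_{d,p}^{n\to\infty}(1)\bigr) \frac{(d+p)\log_2(d+p)-p\log_2p-2d}{2\log_2n} \;\leq\; t_{d,p,n} \;\leq\; d+p-\frac{c}{\log_2n}, \] (i.e. for all $n$ sufficiently large in terms of $d$ and $p$), where $o_{d,p}^{n\to\infty}(1)$ denotes a quantity depending only on $d,p,n$ that tends to $0$ as $n\to\infty$ for each fixed $d,p$. (c) For each fixed $n\geq2$ and $p\geq1$, \[ t_{d,p,n} = \frac{(n-1)\log_2(2d)-\log_2((n-1)!)}{\operatorname{H}(\operatorname{B}(n-1,1/2))} + o_{n,p}^{d\to\infty}(1) \] as $d\to\infty$, where \[ \operatorname{H}\bigl(\operatorname{B}(n-1,1/2)\bigr) = -\sum_{j=0}^{n-1}\frac{\binom{n-1}{j}}{2^{n-1}} \log_2\frac{\binom{n-1}{j}}{2^{n-1}} \] is the Shannon entropy of the symmetric binomial random variable with $n-1$ trials, and $o_{n,p}^{d\to\infty}(1)$ denotes a quantity depending only on $n,p,d$ that tends to $0$ as $d\to\infty$ for each fixed $n,p$.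
   Context: Equip $\mathbb{Z}^m$ with counting measure. For an integer $d\geq1$ and a finitely supported $f\colon\mathbb{Z}^m\to[0,\infty)$ put \[ R_d f(h_1,\ldots,h_d) := \sum_{x\in\mathbb{Z}^m} \prod_{(\omega_1,\ldots,\omega_d)\in\{0,1\}^d} f\bigl(x+\omega_1h_1+\cdots+\omega_dh_d\bigr),\qquad h_1,\ldots,h_d\in\mathbb{Z}^m, \] \[ [f]_{\mathrm{U}^{d,p}(\mathbb{Z}^m)} := \Bigl(\sum_{h_1,\ldots,h_d\in\mathbb{Z}^m}\bigl(R_df(h_1,\ldots,h_d)\bigr)^p\Bigr)^{1/(2^dp)},\qquad \|f\|_{\ell^q(\mathbb{Z}^m)}:=\Bigl(\sum_{x\in\mathbb{Z}^m} f(x)^q\Bigr)^{1/q}. \] For a finite set $A\subseteq\mathbb{Z}^m$ with indicator function $\mathbf{1}_A$ put \[ \mathcal{P}_{d,p}(A) := [\mathbf{1}_A]_{\mathrm{U}^{d,p}(\mathbb{Z}^m)}^{2^d p} = \sum_{h_1,\ldots,h_d\in\mathbb{Z}^m}\bigl(R_d\mathbf{1}_A(h_1,\ldots,h_d)\bigr)^p. \] For integers $d\geq2$, $p\geq1$, $n\geq2$: $q_{d,p,n}$ is the supremum of numbers $q>0$ such that $[f]_{\mathrm{U}^{d,p}(\mathbb{Z}^m)}\leq\|f\|_{\ell^q(\mathbb{Z}^m)}$ for every dimension $m$ and every nonnegative $f$ on $\mathbb{Z}^m$ supported in $\{0,1,\ldots,n-1\}^m$; and $t_{d,p,n}$ is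 the infimum of numbers $t>0$ such that $\mathcal{P}_{d,p}(A)\leq|A|^t$ for every $m$ and every $A\subseteq\{0,1,\ldots,n-1\}^m$. *)

theory Defs
  imports "HOL-Analysis.Analysis"
begin

text \<open>
  The dimension \<open>m\<close> is quantified inside the definitions of the extremal exponents, so it cannot
  be a type: a point of \<open>\<int>\<^sup>m\<close> is an integer sequence that vanishes from index \<open>m\<close> on.
\<close>

definition lattice :: "nat \<Rightarrow> (nat \<Rightarrow> int) set" where
  "lattice m = {x. \<forall>i\<ge>m. x i = 0}"

definition cube :: "nat \<Rightarrow> nat \<Rightarrow> (nat \<Rightarrow> int) set" where
  "cube m n = {x \<in> lattice m. \<forall>i<m. 0 \<le> x i \<and> x i < int n}"

text \<open>
  The definitions below are meant for nonnegative \<open>f\<close> with finite support in \<open>lattice m\<close>, for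
  which each infinite sum has only finitely many nonzero terms (for \<open>d \<ge> 1\<close> and \<open>q > 0\<close>).
  The directions are indexed by \<open>{..<d}\<close> instead of \<open>{1..d}\<close>.
\<close>

definition cube_corr ::
  "nat \<Rightarrow> nat \<Rightarrow> ((nat \<Rightarrow> int) \<Rightarrow> real) \<Rightarrow> (nat \<Rightarrow> nat \<Rightarrow> int) \<Rightarrow> real" where
  "cube_corr m d f h =
     (\<Sum>\<^sub>\<infinity>x\<in>lattice m. \<Prod>\<omega>\<in>{..<d} \<rightarrow>\<^sub>E {0, 1}. f (\<lambda>i. x i + (\<Sum>j<d. \<omega> j * h j i)))"

definition gowers_norm ::
  "nat \<Rightarrow> nat \<Rightarrow> nat \<Rightarrow> ((nat \<Rightarrow> int) \<Rightarrow> real) \<Rightarrow> real" where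
  "gowers_norm m d p f =
     (\<Sum>\<^sub>\<infinity>h\<in>{..<d} \<rightarrow>\<^sub>E lattice m. cube_corr m d f h ^ p) powr (1 / (2 ^ d * real p))"

definition lq_norm :: "nat \<Rightarrow> real \<Rightarrow> ((nat \<Rightarrow> int) \<Rightarrow> real) \<Rightarrow> real" where
  "lq_norm m q f = (\<Sum>\<^sub>\<infinity>x\<in>lattice m. f x powr q) powr (1 / q)"

definition cube_energy :: "nat \<Rightarrow> nat \<Rightarrow> nat \<Rightarrow> (nat \<Rightarrow> int) set \<Rightarrow> real" where
  "cube_energy m d p A = gowers_norm m d p (indicator A) ^ (2 ^ d * p)"

lemma cube_energy_eq:
  assumes "p \<ge> 1"
  shows "cube_energy m d p A =
    (\<Sum>\<^sub>\<infinity>h\<in>{..<d} \<rightarrow>\<^sub>E lattice m. cube_corr m d (indicator A) h ^ p)"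
proof -
  have "cube_corr m d (indicator A) h \<ge> 0" for h
    unfolding cube_corr_def by (intro infsum_nonneg prod_nonneg) auto
  then have S: "(\<Sum>\<^sub>\<infinity>h\<in>{..<d} \<rightarrow>\<^sub>E lattice m. cube_corr m d (indicator A) h ^ p) \<ge> 0"
    by (intro infsum_nonneg) auto
  have k: "2 ^ d * p > 0"
    using assms by simp
  have pw: "(s powr (1 / real k)) ^ k = s" if "s \<ge> 0" "k > 0" for s :: real and k :: nat
    using that by (simp add: powr_powr flip: powr_realpow')
  show ?thesis
    using pw[OF S k] by (simp add: cube_energy_def gowers_norm_def)
qed

definition q_exp :: "nat \<Rightarrow> nat \<Rightarrow> nat \<Rightarrow> real" where
  "q_exp d p n = Sup {q. q > 0 \<and>
     (\<forall>m\<ge>1. \<forall>f. (\<forall>x\<in>lattice m. f x \<ge> 0) \<and> (\<forall>x\<in>lattice m - cube m n. f x = 0) \<longrightarrow>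
        gowers_norm m d p f \<le> lq_norm m q f)}"

definition t_exp :: "nat \<Rightarrow> nat \<Rightarrow> nat \<Rightarrow> real" where
  "t_exp d p n = Inf {t. t > 0 \<and>
     (\<forall>m\<ge>1. \<forall>A\<subseteq>cube m n. cube_energy m d p A \<le> real (card A) powr t)}"

text \<open>Shannon entropy, in bits, of the symmetric binomial distribution with \<open>N\<close> trials.\<close>

definition binomial_entropy :: "nat \<Rightarrow> real" where
  "binomial_entropy N =
     - (\<Sum>j=0..N. real (N choose j) / 2 ^ N * log 2 (real (N choose j) / 2 ^ N))"

end

theory Submission
  imports Defs "HOL-Library.Function_Algebras" "HOL-Real_Asymp.Real_Asymp"
begin

text \<open>
  Everything reduces to the one-dimensional inequality \<open>interval_ineq\<close>, which bounds the form of a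
  function \<open>g\<close> on \<open>{0..n-1}\<close> by \<open>(\<Sum>y. g y powr q) powr t\<close> with \<open>q = 2 ^ d * p / t\<close>. By the
  Gowers--Cauchy--Schwarz inequality it extends to families of functions, and then one coordinate at
  a time to every dimension. Conversely, the tensor power of \<open>g\<close> in dimension \<open>m\<close> has only
  polynomially many level sets, so the inequality for sets gives it back as \<open>m \<rightarrow> \<infinity>\<close>.

  For \<open>n = 2\<close> it is the two-point inequality
  \<open>(2 * cosh (s * w)) ^ p + 2 * d \<le> (2 * cosh w) powr (s * p)\<close>.

  For large \<open>n\<close>, the upper bound follows from that for the additive energy, the case \<open>d = 2\<close>,
  \<open>p = 1\<close>. There Young's inequality on the integers gains a constant factor unless almost all the
  mass sits at one point, a case that is checked directly. The lower bound comes from Gaussians of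
  width \<open>n / ln n\<close>.

  For large \<open>d\<close> and \<open>N = n - 1\<close>, only cubes with \<open>N\<close> directions \<open>\<plusminus>1\<close> and all others zero matter.
  The product of a probability weight over the vertices of a cube with \<open>k\<close> nonzero directions is
  bounded by AM-GM and the LYM inequality in terms of the entropy \<open>H\<^sub>k\<close> of the binomial
  distribution, and \<open>k * H\<^sub>N < N * H\<^sub>k\<close> makes the cubes with \<open>k < N\<close> negligible.
\<close>

section \<open>The Gowers--Cauchy--Schwarz inequality for parallel cubes\<close>

text \<open>The \<open>p\<close>-th power in the energy expands into \<open>p\<close> translates of
  one cube with common directions, so the natural multilinear object has \<open>p * 2 ^ d\<close>
  arguments. Families of functions are unavoidable: once a coordinate is fixed, different vertices
  see different fibres of the same function. The exponent \<open>2 ^ d * p / t\<close> is forced by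
  homogeneity and by the fact that powers of an indicator are that indicator.

  For large \<open>n\<close>, the shape \<open>c / log 2 n\<close> comes from
  \<open>n powr (c / log 2 n) = 2 powr c\<close>: lowering the exponent by this amount costs a
  constant factor, so any constant gain in Young's inequality pays for it. The obstacle is a point
  mass, which gives equality there. For the same reason, the coefficient in the lower bound is a
  comparison of constants between two Gaussian limits.

  For large \<open>d\<close> the exponent is wanted up to \<open>o(1)\<close>, so the cubes with
  \<open>N\<close> nonzero directions need the exact count \<open>(d choose N) * 2 ^ N\<close>, with
  a single base point each; every other class of cubes needs only the right power of
  \<open>d\<close>.\<close>

lemma generalized_holder:
  fixes r :: "'g \<Rightarrow> real" and a :: "'v \<Rightarrow> 'g \<Rightarrow> real"
  assumes V: "finite V" "V \<noteq> {}" and G: "finite G"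
    and r: "\<And>g. g \<in> G \<Longrightarrow> 0 \<le> r g" and a: "\<And>v g. v \<in> V \<Longrightarrow> g \<in> G \<Longrightarrow> 0 \<le> a v g"
    and le: "\<And>g. g \<in> G \<Longrightarrow> r g ^ card V \<le> (\<Prod>v\<in>V. a v g)"
  shows "(\<Sum>g\<in>G. r g) ^ card V \<le> (\<Prod>v\<in>V. \<Sum>g\<in>G. a v g)"
proof -
  define A where "A v = (\<Sum>g\<in>G. a v g)" for v
  define N where "N = card V"
  have N: "N > 0"
    using V by (simp add: N_def card_gt_0_iff)
  have A0: "A v \<ge> 0" if "v \<in> V" for v
    unfolding A_def using a that by (auto intro: sum_nonneg)
  show ?thesis
  proof (cases "\<exists>v\<in>V. A v = 0")
    case True
    then obtain v where v: "v \<in> V" "A v = 0" by blast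
    have "r g = 0" if g: "g \<in> G" for g
    proof -
      have "a v g = 0"
        using v g a G unfolding A_def by (metis sum_nonneg_eq_0_iff)
      then have "(\<Prod>v\<in>V. a v g) = 0"
        using v V by auto
      then have "r g ^ N \<le> 0" using le[OF g] by (simp add: N_def)
      then show ?thesis using r[OF g] N
        by (metis less_le_not_le order_less_le zero_less_power)
    qed
    then have "(\<Sum>g\<in>G. r g) = 0" by simp
    moreover have "(\<Prod>v\<in>V. A v) \<ge> 0" using A0 by (intro prod_nonneg) auto
    ultimately show ?thesis using N by (simp add: N_def A_def power_0_left)
  next
    case False
    then have A1: "A v > 0" if "v \<in> V" for v
      using A0 that by (simp add: order_less_le)
    \<comment> \<open>For fixed \<open>v\<close> the ratios \<open>a v g / A v\<close> have sum 1
      over \<open>g\<close>, so AM-GM for each \<open>g\<close> adds up to exactly this geometric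
      mean.\<close>
    define P where "P = root N (\<Prod>v\<in>V. A v)"
    have P: "P > 0"
      unfolding P_def using N A1 by (simp add: prod_pos)
    have "r g \<le> P * ((\<Sum>v\<in>V. a v g / A v) / N)" if g: "g \<in> G" for g
    proof -
      have "r g = root N (r g ^ N)"
        using r[OF g] N by (simp add: real_root_power_cancel)
      also have "\<dots> \<le> root N (\<Prod>v\<in>V. a v g)"
        using le[OF g] N by (simp add: N_def)
      also have "(\<Prod>v\<in>V. a v g) = (\<Prod>v\<in>V. A v * (a v g / A v))"
        using A1 by (intro prod.cong) (auto simp: less_imp_neq[symmetric])
      also have "\<dots> = (\<Prod>v\<in>V. A v) * (\<Prod>v\<in>V. a v g / A v)"
        by (rule prod.distrib)
      also have "root N \<dots> = P * root N (\<Prod>v\<in>V. a v g / A v)"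
        by (simp add: P_def real_root_mult)
      also have "\<dots> \<le> P * ((\<Sum>v\<in>V. a v g / A v) / N)"
      proof (rule mult_left_mono)
        have nn: "0 \<le> a v g / A v" if "v \<in> V" for v using a g A0 that by simp
        have "root N (\<Prod>v\<in>V. a v g / A v) = (\<Prod>v\<in>V. a v g / A v) powr (1 / N)"
          using N nn by (simp add: root_powr_inverse prod_nonneg)
        also have "\<dots> \<le> (\<Sum>v\<in>V. a v g / A v / N)"
          unfolding N_def by (rule arith_geom_mean[OF V]) (rule nn)
        finally show "root N (\<Prod>v\<in>V. a v g / A v) \<le> (\<Sum>v\<in>V. a v g / A v) / N"
          by (simp add: sum_divide_distrib)
      qed (use P in simp)
      finally show ?thesis .
    qed
    then have "(\<Sum>g\<in>G. r g) \<le> (\<Sum>g\<in>G. P * ((\<Sum>v\<in>V. a v g / A v) / N))"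
      by (rule sum_mono)
    also have "\<dots> = P * ((\<Sum>v\<in>V. \<Sum>g\<in>G. a v g / A v) / N)"
      by (simp add: sum_distrib_left sum_divide_distrib sum.swap[of _ V])
    also have "(\<Sum>v\<in>V. \<Sum>g\<in>G. a v g / A v) = (\<Sum>v\<in>V. 1)"
      using A1 by (intro sum.cong) (auto simp: A_def less_le simp flip: sum_divide_distrib)
    also have "P * ((\<Sum>v\<in>V. 1) / N) = P"
      using N by (simp add: N_def)
    finally have "(\<Sum>g\<in>G. r g) ^ N \<le> P ^ N"
      using r by (intro power_mono sum_nonneg) auto
    also have "P ^ N = (\<Prod>v\<in>V. A v)"
      unfolding P_def using N A0 by (simp add: prod_nonneg)
    finally show ?thesis by (simp add: N_def A_def)
  qed
qed

lemma sum_PiE_lessThan_Suc: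
  fixes f :: "(nat \<Rightarrow> 'a) \<Rightarrow> 'b::comm_monoid_add"
  shows "(\<Sum>h\<in>{..<Suc d} \<rightarrow>\<^sub>E D. f h) = (\<Sum>g\<in>D. \<Sum>h\<in>{..<d} \<rightarrow>\<^sub>E D. f (h(d := g)))"
proof -
  have inj: "inj_on (\<lambda>(y, g). g(d := y)) (D \<times> ({..<d} \<rightarrow>\<^sub>E D))"
    by (rule inj_combinator) simp
  show ?thesis
    unfolding lessThan_Suc PiE_insert_eq sum.reindex[OF inj] sum.cartesian_product
    by (simp add: case_prod_unfold)
qed

lemma prod_Pow_lessThan_Suc:
  fixes f :: "nat set \<Rightarrow> 'b::comm_monoid_mult"
  shows "(\<Prod>S\<in>Pow {..<Suc d}. f S) = (\<Prod>S\<in>Pow {..<d}. f S * f (insert d S))"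
proof -
  have "inj_on (insert d) (Pow {..<d})"
    by (intro inj_onI) (metis Diff_insert_absorb PowD lessThan_iff less_irrefl subsetD)
  moreover have "Pow {..<d} \<inter> insert d ` Pow {..<d} = {}" by auto
  ultimately show ?thesis
    by (simp add: lessThan_Suc Pow_insert prod.union_disjoint prod.reindex prod.distrib)
qed

text \<open>
  The number \<open>p\<close> counts translates of one cube with common directions \<open>h\<close>; the vertices are
  indexed by the translate \<open>k < p\<close> and the set \<open>S\<close> of directions that are used. The functions
  \<open>F k S\<close> are meant to vanish off \<open>X\<close>, and \<open>D\<close> to contain all differences of elements of \<open>X\<close>.
\<close>

definition cube_form ::
  "'g::ab_group_add set \<Rightarrow> 'g set \<Rightarrow> nat \<Rightarrow> nat \<Rightarrow> (nat \<Rightarrow> nat set \<Rightarrow> 'g \<Rightarrow> real) \<Rightarrow> real" where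
  "cube_form X D p d F =
     (\<Sum>h\<in>{..<d} \<rightarrow>\<^sub>E D. \<Prod>k<p. \<Sum>x\<in>X. \<Prod>S\<in>Pow {..<d}. F k S (x + (\<Sum>j\<in>S. h j)))"

lemma cube_form_0: "cube_form X D p 0 F = (\<Prod>k<p. \<Sum>x\<in>X. F k {} x)"
  by (simp add: cube_form_def)

text \<open>Fixing the last direction \<open>g\<close> pairs the vertices \<open>S\<close> and
  \<open>insert d S\<close>, which leaves forms with one direction fewer, applied to multiplicative
  derivatives. The inductions behind the Cauchy--Schwarz inequalities run through this
  identity.\<close>

lemma cube_form_Suc:
  "cube_form X D p (Suc d) F =
     (\<Sum>g\<in>D. cube_form X D p d (\<lambda>k S x. F k S x * F k (insert d S) (x + g)))"
proof -
  have "(\<Sum>j\<in>S. (h(d := g)) j) = (\<Sum>j\<in>S. h j)"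
    "(\<Sum>j\<in>insert d S. (h(d := g)) j) = g + (\<Sum>j\<in>S. h j)" if "S \<in> Pow {..<d}" for S h and g :: 'a
  proof -
    have "d \<notin> S" "finite S" using that by (auto intro: finite_subset)
    then show "(\<Sum>j\<in>S. (h(d := g)) j) = (\<Sum>j\<in>S. h j)"
      "(\<Sum>j\<in>insert d S. (h(d := g)) j) = g + (\<Sum>j\<in>S. h j)"
      by (auto intro!: sum.cong)
  qed
  then show ?thesis
    unfolding cube_form_def sum_PiE_lessThan_Suc prod_Pow_lessThan_Suc
    by (auto intro!: sum.cong prod.cong simp: add_ac)
qed

lemma cube_form_nonneg:
  assumes "\<And>k S x. 0 \<le> F k S x"
  shows "0 \<le> cube_form X D p d F"
  unfolding cube_form_def using assms by (intro sum_nonneg prod_nonneg ballI) auto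


lemma cube_form_cong:
  assumes "\<And>k S x. k < p \<Longrightarrow> S \<subseteq> {..<d} \<Longrightarrow> F k S x = G k S x"
  shows "cube_form X D p d F = cube_form X D p d G"
  unfolding cube_form_def using assms
  by (intro sum.cong prod.cong) auto

text \<open>The \<open>p\<close>-tuples are grouped into translation classes; \<open>u k - u 0\<close> is a complete invariant.\<close>

lemma translate_form_eq:
  fixes X D :: "'g::ab_group_add set" and a b :: "nat \<Rightarrow> 'g \<Rightarrow> real"
  assumes p: "p \<ge> 1" and X: "finite X" and D: "finite D"
    and XD: "\<And>x y. x \<in> X \<Longrightarrow> y \<in> X \<Longrightarrow> y - x \<in> D"
    and b0: "\<And>k x. x \<notin> X \<Longrightarrow> b k x = 0"
  defines "U \<equiv> {..<p} \<rightarrow>\<^sub>E X"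
    and "\<rho> \<equiv> \<lambda>u. \<lambda>k\<in>{..<p}. u k - u 0"
  shows "(\<Sum>g\<in>D. \<Prod>k<p. \<Sum>x\<in>X. a k x * b k (x + g)) =
    (\<Sum>r\<in>\<rho> ` U. (\<Sum>u\<in>{u\<in>U. \<rho> u = r}. \<Prod>k<p. a k (u k)) * (\<Sum>u\<in>{u\<in>U. \<rho> u = r}. \<Prod>k<p. b k (u k)))"
proof -
  have U: "finite U" unfolding U_def by (intro finite_PiE) (auto simp: X)
  define A where "A u = (\<Prod>k<p. a k (u k))" for u
  define B where "B u = (\<Prod>k<p. b k (u k))" for u
  \<comment> \<open>As \<open>g\<close> varies, the translate of \<open>u\<close> by
    \<open>g\<close> meets every tuple in the class of \<open>u\<close> exactly once, with
    \<open>g = v 0 - u 0\<close>; translates that leave \<open>X\<close> are killed by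
    \<open>b\<close>.\<close>
  have shift: "(\<Sum>g\<in>D. \<Prod>k<p. b k (u k + g)) = (\<Sum>v\<in>{v\<in>U. \<rho> v = \<rho> u}. B v)" if u: "u \<in> U" for u
  proof -
    define T where "T = {g\<in>D. \<forall>k<p. u k + g \<in> X}"
    have "(\<Sum>g\<in>D. \<Prod>k<p. b k (u k + g)) = (\<Sum>g\<in>T. \<Prod>k<p. b k (u k + g))"
      unfolding T_def using D b0 by (intro sum.mono_neutral_right) auto
    also have "\<dots> = (\<Sum>v\<in>{v\<in>U. \<rho> v = \<rho> u}. B v)"
    proof (rule sum.reindex_bij_witness[where i = "\<lambda>v. v 0 - u 0" and j = "\<lambda>g. \<lambda>k\<in>{..<p}. u k + g"])
      fix g assume g: "g \<in> T"
      show "(\<lambda>k\<in>{..<p}. u k + g) 0 - u 0 = g" using p by simp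
      show "(\<lambda>k\<in>{..<p}. u k + g) \<in> {v \<in> U. \<rho> v = \<rho> u}"
        using g p by (auto simp: T_def U_def \<rho>_def fun_eq_iff)
      show "B (\<lambda>k\<in>{..<p}. u k + g) = (\<Prod>k<p. b k (u k + g))"
        by (simp add: B_def)
    next
      fix v assume v: "v \<in> {v \<in> U. \<rho> v = \<rho> u}"
      have *: "u k + (v 0 - u 0) = v k" if "k < p" for k
      proof -
        have "\<rho> v k = \<rho> u k" using v by simp
        then have "v k - v 0 = u k - u 0" using that by (simp add: \<rho>_def)
        then have "v k - v 0 + v 0 = u k - u 0 + v 0" by (rule arg_cong)
        then show ?thesis by (simp add: add_diff_eq diff_add_eq)
      qed
      have vX: "v k \<in> X" "u k \<in> X" if "k < p" for k
        using v u that by (auto simp: U_def)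
      have "(\<lambda>k\<in>{..<p}. u k + (v 0 - u 0)) = restrict v {..<p}"
        by (rule restrict_cong) (use * in auto)
      also have "\<dots> = v"
        using v by (auto simp: U_def intro: PiE_restrict)
      finally show "(\<lambda>k\<in>{..<p}. u k + (v 0 - u 0)) = v" .
      show "v 0 - u 0 \<in> T"
        unfolding T_def mem_Collect_eq
      proof (intro conjI allI impI)
        show "v 0 - u 0 \<in> D" using p vX[of 0] by (intro XD) auto
        show "u k + (v 0 - u 0) \<in> X" if "k < p" for k
          unfolding *[OF that] by (rule vX[OF that])
      qed
    qed
    finally show ?thesis .
  qed
  have "(\<Sum>g\<in>D. \<Prod>k<p. \<Sum>x\<in>X. a k x * b k (x + g))
      = (\<Sum>g\<in>D. \<Sum>u\<in>U. \<Prod>k<p. a k (u k) * b k (u k + g))"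
    unfolding U_def using X by (intro sum.cong refl prod_sum_PiE) auto
  also have "\<dots> = (\<Sum>u\<in>U. \<Sum>g\<in>D. A u * (\<Prod>k<p. b k (u k + g)))"
    by (subst sum.swap) (simp add: A_def prod.distrib)
  also have "\<dots> = (\<Sum>u\<in>U. A u * (\<Sum>v\<in>{v\<in>U. \<rho> v = \<rho> u}. B v))"
    by (intro sum.cong refl) (simp add: shift flip: sum_distrib_left)
  also have "\<dots> = (\<Sum>r\<in>\<rho> ` U. \<Sum>u\<in>{u\<in>U. \<rho> u = r}. A u * (\<Sum>v\<in>{v\<in>U. \<rho> v = \<rho> u}. B v))"
    by (rule sum.group[symmetric]) (use U in auto)
  also have "\<dots> = (\<Sum>r\<in>\<rho> ` U. (\<Sum>u\<in>{u\<in>U. \<rho> u = r}. A u) * (\<Sum>v\<in>{v\<in>U. \<rho> v = r}. B v))"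
    by (intro sum.cong refl) (simp add: sum_distrib_right)
  finally show ?thesis by (simp add: A_def B_def)
qed

lemma sum_squared_le_of_squares_le:
  fixes r P Q :: "'a \<Rightarrow> real"
  assumes "\<And>i. i \<in> I \<Longrightarrow> (r i)\<^sup>2 \<le> P i * Q i"
    and "\<And>i. i \<in> I \<Longrightarrow> 0 \<le> P i" "\<And>i. i \<in> I \<Longrightarrow> 0 \<le> Q i"
  shows "(\<Sum>i\<in>I. r i)\<^sup>2 \<le> (\<Sum>i\<in>I. P i) * (\<Sum>i\<in>I. Q i)"
proof -
  have "\<bar>\<Sum>i\<in>I. r i\<bar> \<le> (\<Sum>i\<in>I. \<bar>r i\<bar>)" by (rule sum_abs)
  also have "\<dots> \<le> (\<Sum>i\<in>I. sqrt (P i) * sqrt (Q i))"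
    using assms by (intro sum_mono) (metis real_sqrt_abs real_sqrt_le_mono real_sqrt_mult)
  finally have "(\<Sum>i\<in>I. r i)\<^sup>2 \<le> (\<Sum>i\<in>I. sqrt (P i) * sqrt (Q i))\<^sup>2"
    by (intro abs_le_square_iff[THEN iffD1]) (rule order_trans[OF _ abs_ge_self])
  also have "\<dots> \<le> (\<Sum>i\<in>I. (sqrt (P i))\<^sup>2) * (\<Sum>i\<in>I. (sqrt (Q i))\<^sup>2)"
    by (rule Cauchy_Schwarz_ineq_sum)
  also have "\<dots> = (\<Sum>i\<in>I. P i) * (\<Sum>i\<in>I. Q i)"
    using assms by simp
  finally show ?thesis .
qed

context
  fixes X D :: "'g::ab_group_add set" and p :: nat
  assumes p: "p \<ge> 1" and X: "finite X" and D: "finite D"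
    and XD: "\<And>x y. x \<in> X \<Longrightarrow> y \<in> X \<Longrightarrow> y - x \<in> D"
begin

text \<open>For \<open>d = 0\<close> the bilinear form is diagonal over the translation classes,
  hence an inner product of class sums. For larger \<open>d\<close> the sums over the new direction
  and over \<open>g\<close> are exchanged; the case with fewer directions applies for each fixed new
  direction, and one more Cauchy--Schwarz recombines them.\<close>

lemma cube_form_Cauchy_Schwarz:
  assumes "\<And>k S x. 0 \<le> F k S x" "\<And>k S x. x \<notin> X \<Longrightarrow> F k S x = 0"
    and "\<And>k S x. 0 \<le> G k S x" "\<And>k S x. x \<notin> X \<Longrightarrow> G k S x = 0"
  shows "(\<Sum>g\<in>D. cube_form X D p d (\<lambda>k S x. F k S x * G k S (x + g)))\<^sup>2
    \<le> (\<Sum>g\<in>D. cube_form X D p d (\<lambda>k S x. F k S x * F k S (x + g)))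
      * (\<Sum>g\<in>D. cube_form X D p d (\<lambda>k S x. G k S x * G k S (x + g)))"
  using assms
proof (induction d arbitrary: F G)
  case 0
  define F0 where "F0 k = F k {}" for k
  define G0 where "G0 k = G k {}" for k
  have z: "F0 k x = 0" "G0 k x = 0" if "x \<notin> X" for k x
    using 0 that by (auto simp: F0_def G0_def)
  show ?case
    unfolding cube_form_0 F0_def[symmetric] G0_def[symmetric]
    apply (subst translate_form_eq[where p = p and X = X and D = D and a = F0 and b = G0, OF p X D XD z(2)], assumption+)
    apply (subst translate_form_eq[where p = p and X = X and D = D and a = F0 and b = F0, OF p X D XD z(1)], assumption+)
    apply (subst translate_form_eq[where p = p and X = X and D = D and a = G0 and b = G0, OF p X D XD z(2)], assumption+)
    apply (rule order_trans[OF Cauchy_Schwarz_ineq_sum])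
    apply (simp add: power2_eq_square)
    done
next
  case (Suc d)
  define B where "B F G = (\<Sum>g\<in>D. cube_form X D p d (\<lambda>k S x. F k S x * G k S (x + g)))"
    for F G :: "nat \<Rightarrow> nat set \<Rightarrow> 'g \<Rightarrow> real"
  define T where "T F g k S x = F k S x * F k (insert d S) (x + g)"
    for F :: "nat \<Rightarrow> nat set \<Rightarrow> 'g \<Rightarrow> real" and g k S x
  have *: "(\<Sum>g\<in>D. cube_form X D p (Suc d) (\<lambda>k S x. F k S x * G k S (x + g))) =
    (\<Sum>g\<in>D. B (T F g) (T G g))" for F G :: "nat \<Rightarrow> nat set \<Rightarrow> 'g \<Rightarrow> real"
    unfolding cube_form_Suc B_def
    by (subst sum.swap) (simp add: T_def mult_ac add_ac)
  show ?case
    unfolding *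
  proof (rule sum_squared_le_of_squares_le)
    fix g
    show "(B (T F g) (T G g))\<^sup>2 \<le> B (T F g) (T F g) * B (T G g) (T G g)"
      unfolding B_def using Suc.prems by (intro Suc.IH) (auto simp: T_def)
    show "0 \<le> B (T F g) (T F g)" "0 \<le> B (T G g) (T G g)"
      unfolding B_def using Suc.prems by (auto intro!: sum_nonneg cube_form_nonneg simp: T_def)
  qed
qed

text \<open>One Cauchy--Schwarz step in the last direction decouples the vertices that avoid it,
  \<open>F\<close>, from those that use it, \<open>F'\<close>. What remains has equal functions on
  the two ends of each edge in that direction, so the induction hypothesis applies to the products
  \<open>F k S x * F k S (x + g)\<close> for each \<open>g\<close>, and Hoelder's inequality over
  \<open>g\<close> separates the factors (\<open>hol\<close>).\<close>

theorem gowers_cauchy_schwarz: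
  assumes "\<And>k S x. 0 \<le> F k S x" "\<And>k S x. x \<notin> X \<Longrightarrow> F k S x = 0"
  shows "cube_form X D p d F ^ (p * 2 ^ d)
    \<le> (\<Prod>k<p. \<Prod>S\<in>Pow {..<d}. cube_form X D p d (\<lambda>_ _. F k S))"
  using assms
proof (induction d arbitrary: F)
  case 0
  then show ?case by (simp add: cube_form_0 prod_power_distrib)
next
  case (Suc d)
  define B where "B F G = (\<Sum>g\<in>D. cube_form X D p d (\<lambda>k S x. F k S x * G k S (x + g)))"
    for F G :: "nat \<Rightarrow> nat set \<Rightarrow> 'g \<Rightarrow> real"
  define F' where "F' k S = F k (insert d S)" for k S
  define C where "C f = cube_form X D p (Suc d) (\<lambda>_ _. f)" for f
  have C: "C f = (\<Sum>g\<in>D. cube_form X D p d (\<lambda>_ _ x. f x * f (x + g)))" for f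
    by (simp add: C_def cube_form_Suc)
  define V where "V = {..<p} \<times> Pow {..<d}"
  have V: "finite V" "V \<noteq> {}" "card V = p * 2 ^ d"
    using p by (auto simp: V_def card_cartesian_product card_Pow lessThan_empty_iff)
  have hol: "B F F ^ (p * 2 ^ d) \<le> (\<Prod>k<p. \<Prod>S\<in>Pow {..<d}. C (F k S))"
    if nn: "\<And>k S x. 0 \<le> F k S x" "\<And>k S x. x \<notin> X \<Longrightarrow> F k S x = 0"
    for F :: "nat \<Rightarrow> nat set \<Rightarrow> 'g \<Rightarrow> real"
  proof -
    have "B F F ^ card V \<le> (\<Prod>v\<in>V. \<Sum>g\<in>D. cube_form X D p d (\<lambda>_ _ x. F (fst v) (snd v) x * F (fst v) (snd v) (x + g)))"
      unfolding B_def
    proof (rule generalized_holder[OF V(1,2) D])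
      fix g
      have "cube_form X D p d (\<lambda>k S x. F k S x * F k S (x + g)) ^ card V
        \<le> (\<Prod>k<p. \<Prod>S\<in>Pow {..<d}. cube_form X D p d (\<lambda>_ _ x. F k S x * F k S (x + g)))"
        unfolding V(3) using nn by (intro Suc.IH) auto
      then show "cube_form X D p d (\<lambda>k S x. F k S x * F k S (x + g)) ^ card V
        \<le> (\<Prod>v\<in>V. cube_form X D p d (\<lambda>_ _ x. F (fst v) (snd v) x * F (fst v) (snd v) (x + g)))"
        by (simp add: V_def prod.cartesian_product case_prod_unfold)
    qed (use nn in \<open>auto intro!: cube_form_nonneg\<close>)
    then show ?thesis
      unfolding V(3) C[symmetric] by (simp add: V_def prod.cartesian_product case_prod_unfold)
  qed
  have CS: "(B F F')\<^sup>2 \<le> B F F * B F' F'"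
    unfolding B_def using Suc.prems by (intro cube_form_Cauchy_Schwarz) (auto simp: F'_def)
  have B0: "0 \<le> B F F" "0 \<le> B F' F'"
    unfolding B_def using Suc.prems by (auto intro!: sum_nonneg cube_form_nonneg simp: F'_def)
  have "cube_form X D p (Suc d) F ^ (p * 2 ^ Suc d) = ((B F F')\<^sup>2) ^ (p * 2 ^ d)"
    unfolding cube_form_Suc B_def F'_def by (simp add: power_mult[symmetric] mult_ac)
  also have "\<dots> \<le> (B F F * B F' F') ^ (p * 2 ^ d)"
    using CS by (intro power_mono) auto
  also have "\<dots> \<le> (\<Prod>k<p. \<Prod>S\<in>Pow {..<d}. C (F k S)) * (\<Prod>k<p. \<Prod>S\<in>Pow {..<d}. C (F' k S))"
    unfolding power_mult_distrib using Suc.prems B0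
    by (intro mult_mono hol prod_nonneg) (auto simp: F'_def C_def intro!: cube_form_nonneg)
  also have "\<dots> = (\<Prod>k<p. \<Prod>S\<in>Pow {..<Suc d}. C (F k S))"
    by (simp add: prod_Pow_lessThan_Suc prod.distrib F'_def)
  finally show ?case by (simp add: C_def)
qed

end

section \<open>Tensorization\<close>
lemma sum_fun_apply: "(\<Sum>j\<in>S. h j) i = (\<Sum>j\<in>S. (h j i :: 'b::comm_monoid_add))"
  by (induction S rule: infinite_finite_induct) auto

section \<open>Infinite sums over the lattice as finite forms\<close>

definition dcube :: "nat \<Rightarrow> nat \<Rightarrow> (nat \<Rightarrow> int) set" where
  "dcube m n = {x \<in> lattice m. \<forall>i<m. \<bar>x i\<bar> < int n}"

lemma finite_cube [simp]: "finite (cube m n)"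
proof (rule finite_subset)
  show "cube m n \<subseteq> {x. \<forall>i. (i \<in> {..<m} \<longrightarrow> x i \<in> {0..<int n}) \<and> (i \<notin> {..<m} \<longrightarrow> x i = 0)}"
    by (auto simp: cube_def lattice_def)
qed (intro finite_set_of_finite_funs; simp)

lemma finite_dcube [simp]: "finite (dcube m n)"
proof (rule finite_subset)
  show "dcube m n \<subseteq> {x. \<forall>i. (i \<in> {..<m} \<longrightarrow> x i \<in> {-int n<..<int n}) \<and> (i \<notin> {..<m} \<longrightarrow> x i = 0)}"
    by (auto simp: dcube_def lattice_def)
qed (intro finite_set_of_finite_funs; simp)

lemma diff_mem_dcube: "x \<in> cube m n \<Longrightarrow> y \<in> cube m n \<Longrightarrow> y - x \<in> dcube m n"
  by (auto simp: cube_def dcube_def lattice_def) (smt (verit))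

lemma cube_subset_lattice: "cube m n \<subseteq> lattice m"
  by (auto simp: cube_def)

lemma dcube_subset_lattice: "dcube m n \<subseteq> lattice m"
  by (auto simp: dcube_def)

lemma add_sum_mem_lattice:
  assumes "x \<in> lattice m" "\<And>j. j \<in> S \<Longrightarrow> h j \<in> lattice m"
  shows "x + (\<Sum>j\<in>S. h j) \<in> lattice m"
  using assms by (auto simp: lattice_def sum_fun_apply)

lemma prod_zero_one_functions_eq_prod_Pow:
  fixes f :: "(nat \<Rightarrow> int) \<Rightarrow> real" and x :: "nat \<Rightarrow> int" and h :: "nat \<Rightarrow> nat \<Rightarrow> int"
  shows "(\<Prod>\<omega>\<in>{..<d} \<rightarrow>\<^sub>E {0, 1}. f (\<lambda>i. x i + (\<Sum>j<d. \<omega> j * h j i))) =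
    (\<Prod>S\<in>Pow {..<d}. f (x + (\<Sum>j\<in>S. h j)))"
proof (rule prod.reindex_bij_witness[where i = "\<lambda>S. \<lambda>j\<in>{..<d}. if j \<in> S then 1 else 0"
      and j = "\<lambda>\<omega>. {j\<in>{..<d}. \<omega> j = 1}"])
  fix \<omega> :: "nat \<Rightarrow> int" assume \<omega>: "\<omega> \<in> {..<d} \<rightarrow>\<^sub>E {0, 1}"
  have *: "\<omega> j = 0 \<or> \<omega> j = 1" if "j < d" for j
    using \<omega> that by (auto simp: PiE_iff)
  have "(\<Sum>j\<in>{j\<in>{..<d}. \<omega> j = 1}. h j i) = (\<Sum>j<d. \<omega> j * h j i)" for i
    unfolding sum.inter_filter[OF finite_lessThan] using * by (intro sum.cong) auto
  then show "f (x + (\<Sum>j\<in>{j\<in>{..<d}. \<omega> j = 1}. h j)) = f (\<lambda>i. x i + (\<Sum>j<d. \<omega> j * h j i))"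
    by (intro arg_cong[where f = f]) (auto simp: fun_eq_iff sum_fun_apply)
  show "(\<lambda>j\<in>{..<d}. if j \<in> {j \<in> {..<d}. \<omega> j = 1} then 1 else 0) = \<omega>"
    using * \<omega> by (auto simp: fun_eq_iff PiE_iff extensional_def restrict_def)
qed auto

lemma cube_corr_eq:
  assumes h: "h \<in> {..<d} \<rightarrow>\<^sub>E lattice m" and f: "\<forall>x\<in>lattice m - cube m n. f x = 0"
  shows "cube_corr m d f h = (\<Sum>x\<in>cube m n. \<Prod>S\<in>Pow {..<d}. f (x + (\<Sum>j\<in>S. h j)))"
proof -
  have "cube_corr m d f h = (\<Sum>\<^sub>\<infinity>x\<in>lattice m. \<Prod>S\<in>Pow {..<d}. f (x + (\<Sum>j\<in>S. h j)))"
    unfolding cube_corr_def prod_zero_one_functions_eq_prod_Pow ..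
  also have "\<dots> = (\<Sum>\<^sub>\<infinity>x\<in>cube m n. \<Prod>S\<in>Pow {..<d}. f (x + (\<Sum>j\<in>S. h j)))"
  proof (rule infsum_cong_neutral)
    fix x assume "x \<in> lattice m - cube m n"
    then have "f (x + (\<Sum>j\<in>{}. h j)) = 0" using f by simp
    moreover have "{} \<in> Pow {..<d}" by simp
    ultimately show "(\<Prod>S\<in>Pow {..<d}. f (x + (\<Sum>j\<in>S. h j))) = 0"
      by (meson finite_Pow_iff finite_lessThan prod_zero)
  qed (use cube_subset_lattice in auto)
  finally show ?thesis by simp
qed

lemma infsum_cube_corr_power:
  assumes p: "p \<ge> 1" and f: "\<forall>x\<in>lattice m - cube m n. f x = 0"
  shows "(\<Sum>\<^sub>\<infinity>h\<in>{..<d} \<rightarrow>\<^sub>E lattice m. cube_corr m d f h ^ p)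
    = cube_form (cube m n) (dcube m n) p d (\<lambda>_ _. f)"
proof -
  have "(\<Sum>\<^sub>\<infinity>h\<in>{..<d} \<rightarrow>\<^sub>E lattice m. cube_corr m d f h ^ p)
    = (\<Sum>\<^sub>\<infinity>h\<in>{..<d} \<rightarrow>\<^sub>E dcube m n. cube_corr m d f h ^ p)"
  proof (rule infsum_cong_neutral)
    \<comment> \<open>If \<open>h j\<close> is not a difference of two points of the cube, then the
      vertices belonging to \<open>{}\<close> and \<open>{j}\<close> cannot both lie in it, and the
      product vanishes.\<close>
    fix h assume h: "h \<in> ({..<d} \<rightarrow>\<^sub>E lattice m) - ({..<d} \<rightarrow>\<^sub>E dcube m n)"
    then obtain j where j: "j < d" "h j \<notin> dcube m n" "h j \<in> lattice m"
      by (auto simp: PiE_iff)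
    have "(\<Prod>S\<in>Pow {..<d}. f (x + (\<Sum>j\<in>S. h j))) = 0" if x: "x \<in> cube m n" for x
    proof -
      have "x + h j \<notin> cube m n"
        using diff_mem_dcube[OF x, of "x + h j"] j by auto
      moreover have "x + h j \<in> lattice m"
        using x j cube_subset_lattice by (auto simp: lattice_def cube_def)
      ultimately have "f (x + (\<Sum>j\<in>{j}. h j)) = 0" using f by simp
      moreover have "{j} \<in> Pow {..<d}" using j by simp
      ultimately show ?thesis by (meson finite_Pow_iff finite_lessThan prod_zero)
    qed
    then have "(\<Sum>x\<in>cube m n. \<Prod>S\<in>Pow {..<d}. f (x + (\<Sum>j\<in>S. h j))) = 0"
      by (intro sum.neutral) blast
    then have "cube_corr m d f h = 0"
      using cube_corr_eq[of h d m n f] h f by auto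
    then show "cube_corr m d f h ^ p = 0" using p by (simp add: power_0_left)
  qed (use dcube_subset_lattice in \<open>auto simp: PiE_iff\<close>)
  also have "\<dots> = (\<Sum>h\<in>{..<d} \<rightarrow>\<^sub>E dcube m n. cube_corr m d f h ^ p)"
    by (simp add: finite_PiE)
  also have "\<dots> = cube_form (cube m n) (dcube m n) p d (\<lambda>_ _. f)"
    unfolding cube_form_def
  proof (intro sum.cong refl)
    fix h assume "h \<in> {..<d} \<rightarrow>\<^sub>E dcube m n"
    then have "h \<in> {..<d} \<rightarrow>\<^sub>E lattice m" using dcube_subset_lattice by (auto simp: PiE_iff)
    then show "cube_corr m d f h ^ p = (\<Prod>k<p. \<Sum>x\<in>cube m n. \<Prod>S\<in>Pow {..<d}. f (x + (\<Sum>j\<in>S. h j)))"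
      using f by (simp add: cube_corr_eq)
  qed
  finally show ?thesis .
qed

lemma cube_energy_eq_cube_form:
  assumes "p \<ge> 1" "A \<subseteq> cube m n"
  shows "cube_energy m d p A = cube_form (cube m n) (dcube m n) p d (\<lambda>_ _. indicator A)"
  unfolding cube_energy_eq[OF assms(1)] using assms
  by (intro infsum_cube_corr_power) (auto simp: indicator_def)

lemma cube_form_expand:
  assumes "finite X"
  shows "cube_form X D p d F = (\<Sum>h\<in>{..<d} \<rightarrow>\<^sub>E D. \<Sum>x\<in>{..<p} \<rightarrow>\<^sub>E X.
    \<Prod>k<p. \<Prod>S\<in>Pow {..<d}. F k S (x k + (\<Sum>j\<in>S. h j)))"
  unfolding cube_form_def using assms by (intro sum.cong refl prod_sum_PiE) auto

lemma cube_form_scale: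
  "cube_form X D p d (\<lambda>k S x. c k S * F k S x) = (\<Prod>k<p. \<Prod>S\<in>Pow {..<d}. c k S) * cube_form X D p d F"
  unfolding cube_form_def
  by (simp add: prod.distrib flip: sum_distrib_left)

text \<open>\<open>\<phi>\<close> selects one summand for each of the \<open>p * 2 ^ d\<close>
  vertices. The summands will be the level sets of a tensor power, so the number of selections is
  the loss to be controlled.\<close>

lemma cube_form_multilinear:
  assumes X: "finite X" and L: "finite L"
  shows "cube_form X D p d (\<lambda>k S x. \<Sum>l\<in>L. f l x) =
    (\<Sum>\<phi>\<in>({..<p} \<times> Pow {..<d}) \<rightarrow>\<^sub>E L. cube_form X D p d (\<lambda>k S. f (\<phi> (k, S))))"
proof -
  define V where "V = {..<p} \<times> Pow {..<d}"
  have *: "(\<Prod>k<p. \<Prod>S\<in>Pow {..<d}. G k S) = (\<Prod>v\<in>V. case v of (k, S) \<Rightarrow> G k S)"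
    for G :: "nat \<Rightarrow> nat set \<Rightarrow> real"
    by (simp add: V_def prod.cartesian_product)
  have fV: "finite V" by (simp add: V_def)
  have "(\<Prod>v\<in>V. case v of (k, S) \<Rightarrow> \<Sum>l\<in>L. f l (x k + (\<Sum>j\<in>S. h j))) =
    (\<Sum>\<phi>\<in>V \<rightarrow>\<^sub>E L. \<Prod>v\<in>V. case v of (k, S) \<Rightarrow> f (\<phi> (k, S)) (x k + (\<Sum>j\<in>S. h j)))" for x h
    using prod_sum_PiE[of V "\<lambda>_. L" "\<lambda>v l. case v of (k, S) \<Rightarrow> f l (x k + (\<Sum>j\<in>S. h j))"] fV L
    by (simp add: case_prod_unfold)
  then show ?thesis
    unfolding cube_form_expand[OF X] * V_def[symmetric]
    by (simp add: sum.swap[of _ "V \<rightarrow>\<^sub>E L"])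
qed

text \<open>The ambient group consists of all integer sequences, but base points and directions,
  hence all vertices, stay in \<open>lattice m\<close>. Assumptions on that subgroup therefore
  suffice.\<close>

lemma cube_form_cong_lattice:
  assumes "\<And>k S x. x \<in> lattice m \<Longrightarrow> F k S x = G k S x"
  shows "cube_form (cube m n) (dcube m n) p d F = cube_form (cube m n) (dcube m n) p d G"
  unfolding cube_form_def
proof (intro sum.cong prod.cong refl)
  fix h k x S assume "h \<in> {..<d} \<rightarrow>\<^sub>E dcube m n" "x \<in> cube m n" "S \<in> Pow {..<d}"
  then have "x + (\<Sum>j\<in>S. h j) \<in> lattice m"
    using dcube_subset_lattice[of m n] cube_subset_lattice[of m n]
    by (intro add_sum_mem_lattice) (auto simp: PiE_iff)
  then show "F k S (x + (\<Sum>j\<in>S. h j)) = G k S (x + (\<Sum>j\<in>S. h j))" by (rule assms)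
qed

lemma sum_cube_Suc:
  "(\<Sum>x\<in>cube (Suc m) n. f x) = (\<Sum>y\<in>{0..<int n}. \<Sum>x\<in>cube m n. f (x(m := y)))"
  unfolding sum.cartesian_product
  by (rule sum.reindex_bij_witness[where i = "\<lambda>(y, x). x(m := y)" and j = "\<lambda>x. (x m, x(m := 0))"])
    (auto simp: cube_def lattice_def fun_eq_iff less_Suc_eq dest: Suc_leI)

lemma sum_dcube_Suc:
  "(\<Sum>x\<in>dcube (Suc m) n. f x) = (\<Sum>y\<in>{-int n<..<int n}. \<Sum>x\<in>dcube m n. f (x(m := y)))"
  unfolding sum.cartesian_product
  by (rule sum.reindex_bij_witness[where i = "\<lambda>(y, x). x(m := y)" and j = "\<lambda>x. (x m, x(m := 0))"])
    (auto simp: dcube_def lattice_def fun_eq_iff less_Suc_eq abs_less_iff dest: Suc_leI)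

lemma sum_PiE_product:
  fixes d :: nat
  assumes C: "\<And>f :: 'c \<Rightarrow> real. (\<Sum>c\<in>C. f c) = (\<Sum>y\<in>B. \<Sum>x\<in>A. f (\<phi> x y))"
  shows "(\<Sum>h\<in>{..<d} \<rightarrow>\<^sub>E C. f h :: real) =
    (\<Sum>\<eta>\<in>{..<d} \<rightarrow>\<^sub>E B. \<Sum>h\<in>{..<d} \<rightarrow>\<^sub>E A. f (\<lambda>j\<in>{..<d}. \<phi> (h j) (\<eta> j)))"
proof (induction d arbitrary: f)
  case 0
  then show ?case by (simp add: restrict_def)
next
  case (Suc d)
  have *: "(\<lambda>j\<in>{..<d}. \<phi> (h j) (\<eta> j))(d := \<phi> x y) = (\<lambda>j\<in>{..<Suc d}. \<phi> ((h(d := x)) j) ((\<eta>(d := y)) j))"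
    for h \<eta> x y by (auto simp: fun_eq_iff restrict_def)
  show ?case
    unfolding sum_PiE_lessThan_Suc C Suc.IH *
    by (intro sum.cong refl) (subst sum.swap, rule refl)
qed

text \<open>Fubini in the last coordinate: \<open>\<eta>\<close> and \<open>\<xi>\<close> are the
  last coordinates of the directions and of the base points, and the inner form only sees the fibres
  over the resulting vertices.\<close>

lemma cube_form_cube_Suc:
  "cube_form (cube (Suc m) n) (dcube (Suc m) n) p d F =
    (\<Sum>\<eta>\<in>{..<d} \<rightarrow>\<^sub>E {-int n<..<int n}. \<Sum>\<xi>\<in>{..<p} \<rightarrow>\<^sub>E {0..<int n}.
       cube_form (cube m n) (dcube m n) p d (\<lambda>k S x. F k S (x(m := \<xi> k + (\<Sum>j\<in>S. \<eta> j)))))"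
proof -
  have pt: "x(m := y) + (\<Sum>i\<in>S. (\<lambda>j\<in>{..<d}. (h j)(m := \<eta> j)) i)
    = (x + (\<Sum>j\<in>S. h j))(m := y + (\<Sum>j\<in>S. \<eta> j))" if "S \<in> Pow {..<d}"
    for S x y h and \<eta> :: "nat \<Rightarrow> int"
  proof -
    have "(\<Sum>i\<in>S. (\<lambda>j\<in>{..<d}. (h j)(m := \<eta> j)) i) = (\<Sum>j\<in>S. (h j)(m := \<eta> j))"
      using that by (intro sum.cong) auto
    then show ?thesis by (auto simp: fun_eq_iff sum_fun_apply)
  qed
  have "cube_form (cube (Suc m) n) (dcube (Suc m) n) p d F =
    (\<Sum>\<eta>\<in>{..<d} \<rightarrow>\<^sub>E {-int n<..<int n}. \<Sum>h\<in>{..<d} \<rightarrow>\<^sub>E dcube m n. \<Prod>k<p. \<Sum>y\<in>{0..<int n}. \<Sum>x\<in>cube m n.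
       \<Prod>S\<in>Pow {..<d}. F k S ((x + (\<Sum>j\<in>S. h j))(m := y + (\<Sum>j\<in>S. \<eta> j))))"
    unfolding cube_form_def
      sum_PiE_product[where C = "dcube (Suc m) n", OF sum_dcube_Suc] sum_cube_Suc
    by (simp only: pt cong: prod.cong)
  also have "\<dots> = (\<Sum>\<eta>\<in>{..<d} \<rightarrow>\<^sub>E {-int n<..<int n}. \<Sum>h\<in>{..<d} \<rightarrow>\<^sub>E dcube m n. \<Sum>\<xi>\<in>{..<p} \<rightarrow>\<^sub>E {0..<int n}.
       \<Prod>k<p. \<Sum>x\<in>cube m n.
       \<Prod>S\<in>Pow {..<d}. F k S ((x + (\<Sum>j\<in>S. h j))(m := \<xi> k + (\<Sum>j\<in>S. \<eta> j))))"
    by (intro sum.cong refl prod_sum_PiE) auto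
  also have "\<dots> = (\<Sum>\<eta>\<in>{..<d} \<rightarrow>\<^sub>E {-int n<..<int n}. \<Sum>\<xi>\<in>{..<p} \<rightarrow>\<^sub>E {0..<int n}.
       cube_form (cube m n) (dcube m n) p d (\<lambda>k S x. F k S (x(m := \<xi> k + (\<Sum>j\<in>S. \<eta> j)))))"
    unfolding cube_form_def by (intro sum.cong refl sum.swap)
  finally show ?thesis .
qed

abbreviation interval_form ::
  "nat \<Rightarrow> nat \<Rightarrow> nat \<Rightarrow> (nat \<Rightarrow> nat set \<Rightarrow> int \<Rightarrow> real) \<Rightarrow> real" where
  "interval_form n \<equiv> cube_form {0..<int n} {-int n<..<int n}"

lemma lattice_0: "lattice 0 = {0}"
  by (auto simp: lattice_def)

lemma cube_0: "cube 0 n = {0}" and dcube_0: "dcube 0 n = {0}"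
  by (auto simp: cube_def dcube_def lattice_def)

text \<open>By the Gowers--Cauchy--Schwarz inequality a mixed form is at most the geometric mean of
  diagonal ones, and to each of these the inequality for one function applies. The root of order
  \<open>N\<close> is taken at the end.\<close>

lemma interval_form_holder:
  assumes p: "p \<ge> 1" and q: "q > 0"
    and single: "\<And>g. (\<And>x. 0 \<le> g x) \<Longrightarrow> (\<And>x. x \<notin> {0..<int n} \<Longrightarrow> g x = 0) \<Longrightarrow>
      interval_form n p d (\<lambda>_ _. g) \<le> (\<Sum>y\<in>{0..<int n}. g y powr q) powr (real (p * 2 ^ d) / q)"
    and F: "\<And>k S x. 0 \<le> F k S x" "\<And>k S x. x \<notin> {0..<int n} \<Longrightarrow> F k S x = 0"
  shows "interval_form n p d F
    \<le> (\<Prod>k<p. \<Prod>S\<in>Pow {..<d}. (\<Sum>y\<in>{0..<int n}. F k S y powr q) powr (1 / q))"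
proof (rule power_le_imp_le_base)
  define N where "N = p * 2 ^ d"
  have N: "N > 0" using p by (simp add: N_def)
  have "interval_form n p d F ^ N
    \<le> (\<Prod>k<p. \<Prod>S\<in>Pow {..<d}. interval_form n p d (\<lambda>_ _. F k S))"
    unfolding N_def using p F by (intro gowers_cauchy_schwarz) auto
  also have "\<dots> \<le> (\<Prod>k<p. \<Prod>S\<in>Pow {..<d}. (\<Sum>y\<in>{0..<int n}. F k S y powr q) powr (real N / q))"
    unfolding N_def using F
    by (intro prod_mono conjI single cube_form_nonneg prod_nonneg ballI) auto
  also have "\<dots> = (\<Prod>k<p. \<Prod>S\<in>Pow {..<d}. ((\<Sum>y\<in>{0..<int n}. F k S y powr q) powr (1 / q)) ^ N)"
    using N by (intro prod.cong refl) (simp add: powr_powr flip: powr_realpow')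
  also have "\<dots> = (\<Prod>k<p. \<Prod>S\<in>Pow {..<d}. (\<Sum>y\<in>{0..<int n}. F k S y powr q) powr (1 / q)) ^ N"
    by (simp add: prod_power_distrib)
  finally show "interval_form n p d F ^ Suc (N - 1) \<le>
    (\<Prod>k<p. \<Prod>S\<in>Pow {..<d}. (\<Sum>y\<in>{0..<int n}. F k S y powr q) powr (1 / q)) ^ Suc (N - 1)"
    using N by simp
qed (auto intro!: prod_nonneg)

text \<open>The induction on \<open>m\<close> only closes for families, since fixing the last
  coordinates of the vertices turns even a single function into several fibres.\<close>

lemma cube_form_holder:
  assumes p: "p \<ge> 1" and q: "q > 0"
    and single: "\<And>g. (\<And>x. 0 \<le> g x) \<Longrightarrow> (\<And>x. x \<notin> {0..<int n} \<Longrightarrow> g x = 0) \<Longrightarrow>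
      interval_form n p d (\<lambda>_ _. g) \<le> (\<Sum>y\<in>{0..<int n}. g y powr q) powr (real (p * 2 ^ d) / q)"
    and F: "\<And>k S x. x \<in> lattice m \<Longrightarrow> 0 \<le> F k S x"
      "\<And>k S x. x \<in> lattice m \<Longrightarrow> x \<notin> cube m n \<Longrightarrow> F k S x = 0"
  shows "cube_form (cube m n) (dcube m n) p d F
    \<le> (\<Prod>k<p. \<Prod>S\<in>Pow {..<d}. (\<Sum>x\<in>cube m n. F k S x powr q) powr (1 / q))"
  using F
proof (induction m arbitrary: F)
  case 0
  have "{..<d} \<rightarrow>\<^sub>E {0 :: nat \<Rightarrow> int} = {\<lambda>j\<in>{..<d}. 0}"
    by (auto simp: fun_eq_iff PiE_iff extensional_def)
  moreover have "F k S (0 + (\<Sum>j\<in>S. (\<lambda>j\<in>{..<d}. 0 :: nat \<Rightarrow> int) j)) = F k S 0" if "S \<in> Pow {..<d}" for k S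
    using that by (intro arg_cong[where f = "F k S"]) (auto intro!: sum.neutral)
  then have "(\<Prod>k<p. \<Prod>S\<in>Pow {..<d}. F k S (0 + (\<Sum>j\<in>S. (\<lambda>j\<in>{..<d}. 0 :: nat \<Rightarrow> int) j)))
    = (\<Prod>k<p. \<Prod>S\<in>Pow {..<d}. F k S 0)"
    by (intro prod.cong refl)
  ultimately have "cube_form (cube 0 n) (dcube 0 n) p d F = (\<Prod>k<p. \<Prod>S\<in>Pow {..<d}. F k S 0)"
    unfolding cube_form_def cube_0 dcube_0 by (simp del: restrict_apply)
  also have "\<dots> = (\<Prod>k<p. \<Prod>S\<in>Pow {..<d}. (\<Sum>x\<in>cube 0 n. F k S x powr q) powr (1 / q))"
  proof -
    have "F k S 0 \<ge> 0" for k S by (rule 0) (simp add: lattice_0 fun_eq_iff)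
    then show ?thesis using q by (simp add: cube_0 powr_powr)
  qed
  finally show ?case by simp
next
  case (Suc m)
  \<comment> \<open>The \<open>q\<close>-norm of the fibre over \<open>y\<close>. Induction bounds
    the inner form by a product of these, so the outer sum is a one-dimensional form in
    \<open>\<phi>\<close>; inner and outer norms compose because their exponents agree.\<close>
  define \<phi> where "\<phi> k S y = (\<Sum>x\<in>cube m n. F k S (x(m := y)) powr q) powr (1 / q)" for k S y
  have up: "x(m := y) \<in> lattice (Suc m)" if "x \<in> lattice m" for x y
    using that by (auto simp: lattice_def)
  have out: "F k S (x(m := y)) = 0" if "x \<in> lattice m" "x \<notin> cube m n \<or> y \<notin> {0..<int n}" for k S x y
    using that by (intro Suc.prems up) (auto simp: cube_def less_Suc_eq split: if_splits)
  have \<phi>0: "\<phi> k S y = 0" if "y \<notin> {0..<int n}" for k S y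
  proof -
    have "F k S (x(m := y)) = 0" if "x \<in> cube m n" for x
      using out[of x y k S] that \<open>y \<notin> {0..<int n}\<close> cube_subset_lattice by blast
    then show ?thesis unfolding \<phi>_def by simp
  qed
  have "cube_form (cube (Suc m) n) (dcube (Suc m) n) p d F \<le>
    (\<Sum>\<eta>\<in>{..<d} \<rightarrow>\<^sub>E {-int n<..<int n}. \<Sum>\<xi>\<in>{..<p} \<rightarrow>\<^sub>E {0..<int n}.
       \<Prod>k<p. \<Prod>S\<in>Pow {..<d}. \<phi> k S (\<xi> k + (\<Sum>j\<in>S. \<eta> j)))"
    unfolding cube_form_cube_Suc \<phi>_def
    by (intro sum_mono Suc.IH Suc.prems(1) up out) auto
  also have "\<dots> = interval_form n p d \<phi>"
    by (simp add: cube_form_expand)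
  also have "\<dots> \<le> (\<Prod>k<p. \<Prod>S\<in>Pow {..<d}. (\<Sum>y\<in>{0..<int n}. \<phi> k S y powr q) powr (1 / q))"
    using \<phi>0 by (intro interval_form_holder p q single) (auto simp: \<phi>_def)
  also have "\<dots> = (\<Prod>k<p. \<Prod>S\<in>Pow {..<d}. (\<Sum>x\<in>cube (Suc m) n. F k S x powr q) powr (1 / q))"
    using q by (simp add: \<phi>_def powr_powr sum_cube_Suc sum_nonneg)
  finally show ?case .
qed

section \<open>Tensor powers and the passage from sets to functions\<close>

lemma cube_form_tensor_power:
  "cube_form (cube m n) (dcube m n) p d (\<lambda>_ _ x. \<Prod>i<m. g (x i)) = interval_form n p d (\<lambda>_ _. g) ^ m"
proof (induction m)
  case 0
  then show ?case by (simp add: cube_form_def cube_0 dcube_0 card_PiE)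
next
  case (Suc m)
  have "(\<Prod>i<Suc m. g ((x(m := y)) i)) = g y * (\<Prod>i<m. g (x i))" for x y
    by (simp add: lessThan_Suc)
  then show ?case
    unfolding cube_form_cube_Suc
    by (simp only: Suc.IH cube_form_scale[where F = "\<lambda>_ _ x. \<Prod>i<m. g (x i)"] cube_form_expand[OF finite_atLeastLessThan_int]
        power_Suc flip: sum_distrib_right)
qed

lemma sum_cube_tensor_power:
  "(\<Sum>x\<in>cube m n. \<Prod>i<m. g (x i) :: real) = (\<Sum>y\<in>{0..<int n}. g y) ^ m"
proof (induction m)
  case 0
  then show ?case by (simp add: cube_0)
next
  case (Suc m)
  have "(\<Prod>i<Suc m. g ((x(m := y)) i)) = g y * (\<Prod>i<m. g (x i))" for x y
    by (simp add: lessThan_Suc)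
  then show ?case
    by (simp add: sum_cube_Suc Suc.IH sum_distrib_left[symmetric] sum_distrib_right[symmetric])
qed

text \<open>The product depends only on how often each \<open>y\<close> occurs among the
  coordinates, and each of these \<open>n\<close> counts lies between 0 and
  \<open>m\<close>.\<close>

lemma card_tensor_power_values:
  "card ((\<lambda>x. \<Prod>i<m. g (x i) :: real) ` cube m n) \<le> (m + 1) ^ n"
proof -
  define \<kappa> where "\<kappa> x = (\<lambda>y\<in>{0..<int n}. card {i\<in>{..<m}. x i = y})" for x :: "nat \<Rightarrow> int"
  have "(\<Prod>i<m. g (x i)) = (\<Prod>y\<in>{0..<int n}. g y ^ \<kappa> x y)" if x: "x \<in> cube m n" for x
  proof -
    have "(\<Prod>i<m. g (x i)) = (\<Prod>y\<in>{0..<int n}. \<Prod>i\<in>{i\<in>{..<m}. x i = y}. g (x i))"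
      using x by (intro prod.group[symmetric]) (auto simp: cube_def)
    also have "\<dots> = (\<Prod>y\<in>{0..<int n}. g y ^ \<kappa> x y)"
      by (intro prod.cong refl) (simp add: \<kappa>_def)
    finally show ?thesis .
  qed
  then have "(\<lambda>x. \<Prod>i<m. g (x i)) ` cube m n \<subseteq>
    (\<lambda>c. \<Prod>y\<in>{0..<int n}. g y ^ c y) ` ({0..<int n} \<rightarrow>\<^sub>E {..m})"
  proof (intro subsetI, elim imageE)
    fix v x assume v: "v = (\<Prod>i<m. g (x i))" and x: "x \<in> cube m n"
      and *: "\<And>x. x \<in> cube m n \<Longrightarrow> (\<Prod>i<m. g (x i)) = (\<Prod>y\<in>{0..<int n}. g y ^ \<kappa> x y)"
    have "card {i\<in>{..<m}. x i = y} \<le> m" for y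
      using card_mono[of "{..<m}" "{i\<in>{..<m}. x i = y}"] by auto
    then have "\<kappa> x \<in> {0..<int n} \<rightarrow>\<^sub>E {..m}" by (auto simp: \<kappa>_def)
    then show "v \<in> (\<lambda>c. \<Prod>y\<in>{0..<int n}. g y ^ c y) ` ({0..<int n} \<rightarrow>\<^sub>E {..m})"
      using v * x by blast
  qed
  then have "card ((\<lambda>x. \<Prod>i<m. g (x i)) ` cube m n) \<le> card ({0..<int n} \<rightarrow>\<^sub>E {..m})"
    by (intro surj_card_le finite_PiE) auto
  also have "\<dots> = (m + 1) ^ n"
    by (simp add: card_PiE)
  finally show ?thesis .
qed

text \<open>The end of the tensor power trick: if \<open>a > b > 0\<close>, then
  \<open>(a / b) ^ m\<close> outgrows every polynomial in \<open>m\<close>.\<close>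

lemma le_of_power_le_polynomial:
  fixes a b :: real
  assumes b: "0 \<le> b" and le: "\<And>m. m \<ge> 1 \<Longrightarrow> a ^ m \<le> (real m + 1) ^ K * b ^ m"
  shows "a \<le> b"
proof (rule ccontr)
  assume "\<not> a \<le> b"
  then have ab: "b < a" by simp
  show False
  proof (cases "b = 0")
    case True
    then show False using le[of 1] ab by simp
  next
    case False
    define c where "c = a / b"
    have c: "c > 1" using ab False b by (simp add: c_def)
    have "(\<lambda>m. (real m + 1) ^ K / c ^ m) \<longlonglongrightarrow> 0"
    proof -
      have "filterlim (\<lambda>m. (real m + 1) * ln c) at_top sequentially"
        using c by (intro filterlim_at_top_mult_tendsto_pos[OF tendsto_const]) (simp, real_asymp)
      then have "(\<lambda>m. ((real m + 1) * ln c) ^ K / exp ((real m + 1) * ln c)) \<longlonglongrightarrow> 0"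
        using filterlim_compose[OF tendsto_power_div_exp_0] by blast
      then have "(\<lambda>m. c / ln c ^ K * (((real m + 1) * ln c) ^ K / exp ((real m + 1) * ln c))) \<longlonglongrightarrow> c / ln c ^ K * 0"
        by (rule tendsto_mult_left)
      moreover have "c / ln c ^ K * (((real m + 1) * ln c) ^ K / exp ((real m + 1) * ln c))
        = (real m + 1) ^ K / c ^ m" for m
      proof -
        have "exp ((real m + 1) * ln c) = c ^ Suc m"
          using c exp_of_nat_mult[of "Suc m" "ln c"] by (simp add: add.commute)
        then show ?thesis using c by (simp add: power_mult_distrib)
      qed
      ultimately show ?thesis by simp
    qed
    then have "eventually (\<lambda>m. (real m + 1) ^ K / c ^ m < 1) sequentially"
      by (rule order_tendstoD) simp
    then have "eventually (\<lambda>m. 1 \<le> m \<and> (real m + 1) ^ K / c ^ m < 1) sequentially"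
      by (intro eventually_conj eventually_ge_at_top)
    then obtain m where m: "m \<ge> 1" "(real m + 1) ^ K / c ^ m < 1"
      using eventually_happens'[OF sequentially_bot] by blast
    have "(real m + 1) ^ K < c ^ m"
      using m(2) c by (simp add: divide_less_eq)
    then have "(real m + 1) ^ K * b ^ m < c ^ m * b ^ m"
      using b False by (intro mult_strict_right_mono) auto
    also have "\<dots> = a ^ m"
      using False by (simp add: c_def flip: power_mult_distrib)
    finally show False using le[OF m(1)] by simp
  qed
qed

text \<open>The tensor power \<open>f\<close> is a combination of indicators of its level sets. The
  hypothesis bounds the diagonal terms, the Gowers--Cauchy--Schwarz inequality bounds the mixed
  ones, and the number of terms is polynomial in \<open>m\<close>.\<close>

theorem interval_form_le_of_set_bound:
  fixes t :: real
  assumes p: "p \<ge> 1" and t: "t > 0"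
    and sets: "\<And>m A. m \<ge> 1 \<Longrightarrow> A \<subseteq> cube m n \<Longrightarrow>
      cube_form (cube m n) (dcube m n) p d (\<lambda>_ _. indicator A) \<le> real (card A) powr t"
    and g: "\<And>x. 0 \<le> g x" "\<And>x. x \<notin> {0..<int n} \<Longrightarrow> g x = 0"
  shows "interval_form n p d (\<lambda>_ _. g) \<le> (\<Sum>y\<in>{0..<int n}. g y powr (real (p * 2 ^ d) / t)) powr t"
proof (rule le_of_power_le_polynomial)
  fix m :: nat assume m: "m \<ge> 1"
  define N where "N = p * 2 ^ d"
  define q where "q = real N / t"
  define s where "s = (\<Sum>y\<in>{0..<int n}. g y powr q)"
  define \<Lambda> where "\<Lambda> = cube_form (cube m n) (dcube m n) p d"
  define f where "f x = (\<Prod>i<m. g (x i))" for x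
  define L where "L = f ` cube m n"
  define A where "A l = {x\<in>cube m n. f x = l}" for l
  define V where "V = {..<p} \<times> Pow {..<d}"
  define F where "F l x = l * indicator (A l) x" for l x
  have N: "N > 0" and q: "q > 0" using p t by (auto simp: N_def q_def)
  have L0: "l \<ge> 0" if "l \<in> L" for l using that g by (auto simp: L_def f_def prod_nonneg)
  have finL: "finite L" by (simp add: L_def)
  have level: "\<Lambda> (\<lambda>_ _. F l) \<le> (s ^ m) powr t" if l: "l \<in> L" for l
  proof -
    have "\<Lambda> (\<lambda>_ _. F l) = l ^ N * \<Lambda> (\<lambda>_ _. indicator (A l))"
      unfolding \<Lambda>_def F_def
      by (subst cube_form_scale[where c = "\<lambda>_ _. l"])
        (simp add: N_def card_Pow mult.commute flip: power_mult)
    also have "\<dots> \<le> l ^ N * real (card (A l)) powr t"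
      unfolding \<Lambda>_def using L0[OF l] m by (intro mult_left_mono sets) (auto simp: A_def)
    \<comment> \<open>Since \<open>q * t = N\<close>, the scalar can be moved inside
      \<open>powr t\<close>; there it turns the cardinality of the level set into the part of the
      sum of \<open>f powr q\<close> over that level.\<close>
    also have "l ^ N = (l powr q) powr t"
      using L0[OF l] N t by (simp add: q_def powr_powr powr_realpow')
    also have "(l powr q) powr t * real (card (A l)) powr t = (real (card (A l)) * l powr q) powr t"
      by (simp add: powr_mult mult.commute)
    also have "real (card (A l)) * l powr q = (\<Sum>x\<in>A l. f x powr q)"
      by (simp add: A_def)
    also have "(\<Sum>x\<in>A l. f x powr q) powr t \<le> (\<Sum>x\<in>cube m n. f x powr q) powr t"
      using t by (intro powr_mono2 sum_mono2 sum_nonneg) (auto simp: A_def)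
    also have "(\<Sum>x\<in>cube m n. f x powr q) = s ^ m"
      unfolding s_def sum_cube_tensor_power[symmetric] f_def
      using g by (simp add: prod_powr_distrib)
    finally show ?thesis .
  qed
  have mixed: "\<Lambda> (\<lambda>k S. F (\<phi> (k, S))) \<le> (s ^ m) powr t" if \<phi>: "\<phi> \<in> V \<rightarrow>\<^sub>E L" for \<phi>
  proof (rule power_le_imp_le_base)
    \<comment> \<open>Outside the index range \<open>\<phi>\<close> takes an unspecified value, and
      nonnegativity is required for all indices; hence the value zero there.\<close>
    define F' where "F' k S = (if k < p \<and> S \<subseteq> {..<d} then F (\<phi> (k, S)) else (\<lambda>_. 0))" for k S
    have \<phi>L: "\<phi> (k, S) \<in> L" if "k < p" "S \<subseteq> {..<d}" for k S
      using \<phi> that by (auto simp: V_def)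
    have "\<Lambda> (\<lambda>k S. F (\<phi> (k, S))) = \<Lambda> F'"
      unfolding \<Lambda>_def by (rule cube_form_cong) (simp add: F'_def)
    also have "\<Lambda> F' ^ N \<le> (\<Prod>k<p. \<Prod>S\<in>Pow {..<d}. \<Lambda> (\<lambda>_ _. F' k S))"
      unfolding N_def \<Lambda>_def using p \<phi>L L0
      by (intro gowers_cauchy_schwarz diff_mem_dcube) (auto simp: F'_def F_def A_def)
    also have "\<dots> \<le> (\<Prod>k<p. \<Prod>S\<in>Pow {..<d}. (s ^ m) powr t)"
    proof (intro prod_mono conjI prod_nonneg ballI)
      fix k S assume "k \<in> {..<p}" "S \<in> Pow {..<d}"
      then have *: "F' k S = F (\<phi> (k, S))" "\<phi> (k, S) \<in> L" using \<phi>L by (auto simp: F'_def)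
      show "\<Lambda> (\<lambda>_ _. F' k S) \<le> (s ^ m) powr t" unfolding * by (rule level) fact
      show "0 \<le> \<Lambda> (\<lambda>_ _. F' k S)"
        unfolding \<Lambda>_def * using L0 *(2) by (intro cube_form_nonneg) (simp add: F_def)
    qed (auto intro!: cube_form_nonneg simp: \<Lambda>_def F'_def F_def L0 \<phi>L)
    also have "\<dots> = ((s ^ m) powr t) ^ N"
      by (simp add: N_def card_Pow mult.commute flip: power_mult)
    finally show "\<Lambda> (\<lambda>k S. F (\<phi> (k, S))) ^ Suc (N - 1) \<le> ((s ^ m) powr t) ^ Suc (N - 1)"
      using N by simp
  qed simp
  have "interval_form n p d (\<lambda>_ _. g) ^ m = \<Lambda> (\<lambda>_ _. f)"
    unfolding \<Lambda>_def f_def cube_form_tensor_power ..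
  also have "\<dots> = \<Lambda> (\<lambda>_ _ x. \<Sum>l\<in>L. F l x)"
    unfolding \<Lambda>_def
  proof (rule cube_form_cong_lattice)
    fix x assume x: "x \<in> lattice m"
    show "f x = (\<Sum>l\<in>L. F l x)"
    proof (cases "x \<in> cube m n")
      case True
      then have "(\<Sum>l\<in>L. F l x) = (\<Sum>l\<in>L. if l = f x then l else 0)"
        by (intro sum.cong) (auto simp: F_def A_def)
      then show ?thesis using True finL by (auto simp: L_def)
    next
      case False
      then obtain i where "i < m" "x i \<notin> {0..<int n}" using x by (auto simp: cube_def)
      then have "f x = 0" using g(2) by (auto simp: f_def)
      then show ?thesis using False by (simp add: F_def A_def)
    qed
  qed
  also have "\<dots> = (\<Sum>\<phi>\<in>V \<rightarrow>\<^sub>E L. \<Lambda> (\<lambda>k S. F (\<phi> (k, S))))"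
    unfolding \<Lambda>_def V_def by (rule cube_form_multilinear) (use finL in auto)
  also have "\<dots> \<le> (\<Sum>\<phi>\<in>V \<rightarrow>\<^sub>E L. (s ^ m) powr t)"
    by (rule sum_mono) (rule mixed)
  also have "\<dots> = real (card L ^ N) * (s ^ m) powr t"
    by (simp add: V_def card_PiE N_def card_cartesian_product card_Pow)
  also have "\<dots> \<le> real (((m + 1) ^ n) ^ N) * (s ^ m) powr t"
    using card_tensor_power_values[where g = g and m = m and n = n] unfolding L_def f_def
    by (intro mult_right_mono of_nat_mono power_mono) auto
  also have "\<dots> = (real m + 1) ^ (n * N) * (s powr t) ^ m"
    using m by (simp add: power_mult[symmetric] s_def sum_nonneg powr_powr mult.commute
        flip: powr_realpow' of_nat_Suc) (simp add: add.commute)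
  finally show "interval_form n p d (\<lambda>_ _. g) ^ m \<le> (real m + 1) ^ (n * N) * (s powr t) ^ m" .
qed simp

section \<open>Admissible exponents and the binary cube\<close>
definition t_admissible :: "nat \<Rightarrow> nat \<Rightarrow> nat \<Rightarrow> real \<Rightarrow> bool" where
  "t_admissible d p n t \<longleftrightarrow> t > 0 \<and>
     (\<forall>m\<ge>1. \<forall>A\<subseteq>cube m n. cube_energy m d p A \<le> real (card A) powr t)"

lemma t_exp_eq: "t_exp d p n = Inf {t. t_admissible d p n t}"
  by (simp add: t_exp_def t_admissible_def)

lemma t_exp_le: "t_admissible d p n t \<Longrightarrow> t_exp d p n \<le> t"
  unfolding t_exp_eq by (rule cInf_lower) (auto intro!: bdd_belowI[of _ 0] simp: t_admissible_def)

text \<open>The infimum of an empty set of reals carries no information, hence the witness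
  \<open>t0\<close>.\<close>

lemma le_t_exp:
  assumes "t_admissible d p n t0" "\<And>t. t_admissible d p n t \<Longrightarrow> a \<le> t"
  shows "a \<le> t_exp d p n"
  unfolding t_exp_eq using assms by (intro cInf_greatest) auto

lemma t_admissible_mono:
  assumes "t_admissible d p n t" "t \<le> t'"
  shows "t_admissible d p n t'"
  unfolding t_admissible_def
proof (intro conjI allI impI)
  show "t' > 0" using assms by (simp add: t_admissible_def)
  fix m A assume mA: "1 \<le> m" "A \<subseteq> cube m n"
  have "cube_energy m d p A \<le> real (card A) powr t"
    using assms mA by (auto simp: t_admissible_def)
  also have "\<dots> \<le> real (card A) powr t'"
  proof (cases "card A = 0")
    case False
    then show ?thesis using assms(2) by (intro powr_mono) auto
  qed simp
  finally show "cube_energy m d p A \<le> real (card A) powr t'" .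
qed

lemma t_admissible_of_lt:
  assumes "t_exp d p n < t" "t_admissible d p n t0"
  shows "t_admissible d p n t"
proof -
  obtain s where "t_admissible d p n s" "s < t"
    using assms cInf_lessD[of "{t. t_admissible d p n t}" t] unfolding t_exp_eq by auto
  then show ?thesis using t_admissible_mono by fastforce
qed

definition interval_ineq :: "nat \<Rightarrow> nat \<Rightarrow> nat \<Rightarrow> real \<Rightarrow> bool" where
  "interval_ineq d p n t \<longleftrightarrow> (\<forall>g. (\<forall>x. 0 \<le> g x) \<longrightarrow> (\<forall>x. x \<notin> {0..<int n} \<longrightarrow> g x = 0) \<longrightarrow>
     interval_form n p d (\<lambda>_ _. g) \<le> (\<Sum>y\<in>{0..<int n}. g y powr (real (p * 2 ^ d) / t)) powr t)"

lemma cube_form_le_of_interval_ineq: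
  assumes p: "p \<ge> 1" and t: "t > 0" and ineq: "interval_ineq d p n t"
    and f: "\<And>x. x \<in> lattice m \<Longrightarrow> 0 \<le> f x" "\<And>x. x \<in> lattice m \<Longrightarrow> x \<notin> cube m n \<Longrightarrow> f x = 0"
  shows "cube_form (cube m n) (dcube m n) p d (\<lambda>_ _. f)
    \<le> (\<Sum>x\<in>cube m n. f x powr (real (p * 2 ^ d) / t)) powr t"
proof -
  define N where "N = p * 2 ^ d"
  define q where "q = real N / t"
  have N: "N > 0" and q: "q > 0" "real N / q = t" using p t by (auto simp: N_def q_def)
  have "cube_form (cube m n) (dcube m n) p d (\<lambda>_ _. f)
    \<le> (\<Prod>k<p. \<Prod>S\<in>Pow {..<d}. (\<Sum>x\<in>cube m n. f x powr q) powr (1 / q))"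
  proof (rule cube_form_holder[OF p q(1)])
    fix g :: "int \<Rightarrow> real"
    assume "\<And>x. 0 \<le> g x" "\<And>x. x \<notin> {0..<int n} \<Longrightarrow> g x = 0"
    then show "interval_form n p d (\<lambda>_ _. g) \<le> (\<Sum>y\<in>{0..<int n}. g y powr q) powr (real (p * 2 ^ d) / q)"
      using ineq q(2) by (simp add: interval_ineq_def q_def N_def)
  qed (use f in auto)
  also have "\<dots> = ((\<Sum>x\<in>cube m n. f x powr q) powr (1 / q)) ^ N"
    by (simp add: N_def card_Pow mult.commute flip: power_mult)
  also have "\<dots> = (\<Sum>x\<in>cube m n. f x powr q) powr t"
    using N q by (simp add: powr_powr flip: powr_realpow')
  finally show ?thesis by (simp add: q_def N_def)
qed

lemma t_admissible_of_interval_ineq: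
  assumes p: "p \<ge> 1" and t: "t > 0" and ineq: "interval_ineq d p n t"
  shows "t_admissible d p n t"
  unfolding t_admissible_def
proof (intro conjI allI impI)
  fix m A assume A: "A \<subseteq> cube m n"
  have "cube_energy m d p A \<le> (\<Sum>x\<in>cube m n. indicator A x powr (real (p * 2 ^ d) / t)) powr t"
    unfolding cube_energy_eq_cube_form[OF p A] using A
    by (intro cube_form_le_of_interval_ineq p t ineq) (auto simp: indicator_def)
  also have "(\<Sum>x\<in>cube m n. indicator A x powr (real (p * 2 ^ d) / t)) = (\<Sum>x\<in>cube m n. indicator A x :: real)"
    using p t by (intro sum.cong) (auto simp: indicator_def)
  also have "\<dots> = card A"
    using A by (simp add: indicator_def sum.If_cases Int_absorb1)
  finally show "cube_energy m d p A \<le> real (card A) powr t" .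
qed fact

lemma interval_ineq_of_t_admissible:
  assumes p: "p \<ge> 1" and t: "t_admissible d p n t"
  shows "interval_ineq d p n t"
  unfolding interval_ineq_def
proof (intro allI impI interval_form_le_of_set_bound[OF p])
  fix m A assume "1 \<le> m" "A \<subseteq> cube m n"
  then show "cube_form (cube m n) (dcube m n) p d (\<lambda>_ _. indicator A) \<le> real (card A) powr t"
    using t p by (simp add: t_admissible_def flip: cube_energy_eq_cube_form)
qed (use t in \<open>auto simp: t_admissible_def\<close>)

lemma gowers_norm_le_of_interval_ineq:
  assumes p: "p \<ge> 1" and t: "t > 0" and ineq: "interval_ineq d p n t"
    and f: "\<forall>x\<in>lattice m. f x \<ge> 0" "\<forall>x\<in>lattice m - cube m n. f x = 0"
  shows "gowers_norm m d p f \<le> lq_norm m (2 ^ d * real p / t) f"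
proof -
  define q where "q = real (p * 2 ^ d) / t"
  have q: "q > 0" "2 ^ d * real p / t = q" using p t by (auto simp: q_def mult.commute)
  define s where "s = (\<Sum>x\<in>cube m n. f x powr q)"
  have "(\<Sum>\<^sub>\<infinity>x\<in>lattice m. f x powr q) = (\<Sum>\<^sub>\<infinity>x\<in>cube m n. f x powr q)"
    using f q cube_subset_lattice[of m n] by (intro infsum_cong_neutral) auto
  then have lq: "lq_norm m (2 ^ d * real p / t) f = s powr (1 / q)"
    by (simp add: lq_norm_def q s_def)
  have "gowers_norm m d p f = cube_form (cube m n) (dcube m n) p d (\<lambda>_ _. f) powr (1 / (2 ^ d * real p))"
    unfolding gowers_norm_def infsum_cube_corr_power[OF p f(2)] ..
  also have "\<dots> \<le> (s powr t) powr (1 / (2 ^ d * real p))"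
  proof (rule powr_mono2)
    show "cube_form (cube m n) (dcube m n) p d (\<lambda>_ _. f) \<le> s powr t"
      unfolding s_def q_def using f by (intro cube_form_le_of_interval_ineq p t ineq) auto
    \<comment> \<open>Nothing is assumed about \<open>f\<close> off the lattice, so positivity is
      read off from its truncation, which has the same form.\<close>
    have "cube_form (cube m n) (dcube m n) p d (\<lambda>_ _. f)
      = cube_form (cube m n) (dcube m n) p d (\<lambda>_ _ x. if x \<in> lattice m then f x else 0)"
      by (rule cube_form_cong_lattice) simp
    also have "\<dots> \<ge> 0" using f by (intro cube_form_nonneg) auto
    finally show "0 \<le> cube_form (cube m n) (dcube m n) p d (\<lambda>_ _. f)" .
  qed simp
  also have "\<dots> = lq_norm m (2 ^ d * real p / t) f"
    unfolding lq using t by (simp add: powr_powr q_def mult.commute)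
  finally show ?thesis .
qed

text \<open>A zero direction duplicates every vertex: a subset of \<open>D\<close> splits into its
  part in \<open>J\<close>, which determines the vertex, and a free part outside \<open>J\<close>,
  which only contributes multiplicity.\<close>

lemma prod_Pow_support:
  fixes u :: "'a::comm_monoid_add \<Rightarrow> 'b::comm_semiring_1"
  assumes D: "finite D" and J: "J \<subseteq> D" and h: "\<And>j. j \<in> D - J \<Longrightarrow> h j = 0"
  shows "(\<Prod>S\<in>Pow D. u (\<Sum>j\<in>S. h j)) = (\<Prod>S\<in>Pow J. u (\<Sum>j\<in>S. h j)) ^ 2 ^ card (D - J)"
proof -
  have "(\<Prod>S\<in>Pow D. u (\<Sum>j\<in>S. h j)) = (\<Prod>(S, T)\<in>Pow J \<times> Pow (D - J). u (\<Sum>j\<in>S. h j))"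
  proof (rule prod.reindex_bij_witness[where i = "\<lambda>(S, T). S \<union> T" and j = "\<lambda>S. (S \<inter> J, S - J)"])
    fix S assume S: "S \<in> Pow D"
    have "finite S" using S D by (auto intro: finite_subset)
    then have "(\<Sum>j\<in>S \<inter> J. h j) = (\<Sum>j\<in>S. h j)"
      using S h by (intro sum.mono_neutral_left) auto
    then show "(case (S \<inter> J, S - J) of (S, T) \<Rightarrow> u (sum h S)) = u (sum h S)" by simp
  next
    fix S assume S: "S \<in> Pow D"
    show "(case (S \<inter> J, S - J) of (S, T) \<Rightarrow> S \<union> T) = S" by auto
    show "(S \<inter> J, S - J) \<in> Pow J \<times> Pow (D - J)" using S by auto
  next
    fix v assume v: "v \<in> Pow J \<times> Pow (D - J)"
    obtain S T where ST: "v = (S, T)" by (cases v)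
    show "((case v of (S, T) \<Rightarrow> S \<union> T) \<inter> J, (case v of (S, T) \<Rightarrow> S \<union> T) - J) = v"
      using v by (auto simp: ST)
    show "(case v of (S, T) \<Rightarrow> S \<union> T) \<in> Pow D"
      using v J by (auto simp: ST)
  qed
  also have "\<dots> = (\<Prod>S\<in>Pow J. \<Prod>T\<in>Pow (D - J). u (\<Sum>j\<in>S. h j))"
    by (rule prod.cartesian_product[symmetric])
  also have "\<dots> = (\<Prod>S\<in>Pow J. u (\<Sum>j\<in>S. h j)) ^ 2 ^ card (D - J)"
    using D by (simp only: prod_constant card_Pow finite_Diff prod_power_distrib)
  finally show ?thesis .
qed

lemma interval_form_eq_sum_power:
  "interval_form n p d (\<lambda>_ _. g) = (\<Sum>h\<in>{..<d} \<rightarrow>\<^sub>E {-int n<..<int n}.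
     (\<Sum>x\<in>{0..<int n}. (\<Prod>S\<in>Pow {j\<in>{..<d}. h j \<noteq> 0}. g (x + (\<Sum>j\<in>S. h j)))
        ^ 2 ^ (d - card {j\<in>{..<d}. h j \<noteq> 0})) ^ p)"
proof -
  have "(\<Prod>S\<in>Pow {..<d}. g (x + (\<Sum>j\<in>S. h j)))
    = (\<Prod>S\<in>Pow {j\<in>{..<d}. h j \<noteq> 0}. g (x + (\<Sum>j\<in>S. h j))) ^ 2 ^ (d - card {j\<in>{..<d}. h j \<noteq> 0})"
    for x and h :: "nat \<Rightarrow> int"
  proof -
    have "card ({..<d} - {j\<in>{..<d}. h j \<noteq> 0}) = d - card {j\<in>{..<d}. h j \<noteq> 0}"
      by (subst card_Diff_subset) auto
    moreover have "(\<Prod>S\<in>Pow {..<d}. g (x + (\<Sum>j\<in>S. h j)))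
      = (\<Prod>S\<in>Pow {j\<in>{..<d}. h j \<noteq> 0}. g (x + (\<Sum>j\<in>S. h j))) ^ 2 ^ card ({..<d} - {j\<in>{..<d}. h j \<noteq> 0})"
      by (rule prod_Pow_support[of "{..<d}" "{j\<in>{..<d}. h j \<noteq> 0}" h "\<lambda>s. g (x + s)"]) auto
    ultimately show ?thesis by (rule subst)
  qed
  then show ?thesis
    unfolding cube_form_def prod_constant card_lessThan by (simp only:)
qed



text \<open>Two nonzero directions already produce vertices that do not fit into
  \<open>{0, 1}\<close>. What remains is the zero tuple, with both base points, and the
  \<open>2 * d\<close> tuples with one entry 1 or -1, each with a single base point.\<close>

lemma interval_form_two:
  assumes g: "\<And>x. x \<notin> {0, 1} \<Longrightarrow> g x = 0" and p: "p \<ge> 1"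
  shows "interval_form 2 p d (\<lambda>_ _. g) =
    (g 0 ^ 2 ^ d + g 1 ^ 2 ^ d) ^ p + 2 * real d * ((g 0 * g 1) ^ 2 ^ (d - 1)) ^ p"
proof -
  define supp where "supp h = {j\<in>{..<d}. h j \<noteq> 0}" for h :: "nat \<Rightarrow> int"
  define R where "R h = (\<Sum>x\<in>{0, 1}. (\<Prod>S\<in>Pow (supp h). g (x + (\<Sum>j\<in>S. h j))) ^ 2 ^ (d - card (supp h)))" for h
  \<comment> \<open>The tuple with entry \<open>s\<close> in position \<open>j\<close> and zeros
    elsewhere.\<close>
  define e where "e = (\<lambda>(j, s). \<lambda>i\<in>{..<d}. if i = j then s else (0::int))"
  define z where "z = (\<lambda>i\<in>{..<d}. 0::int)"
  define H where "H = insert z (e ` ({..<d} \<times> {-1, 1}))"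
  have iv: "{0..<int 2} = {0, 1}" "{-int 2<..<int 2} = {-1, 0, 1}" by auto
  have supp_e: "supp (e (j, s)) = {j}" if "j < d" "s \<noteq> 0" for j s
    using that by (auto simp: supp_def e_def)
  have R_z: "R z = g 0 ^ 2 ^ d + g 1 ^ 2 ^ d"
    by (simp add: R_def supp_def z_def)
  have R_e: "R (e (j, s)) = (g 0 * g 1) ^ 2 ^ (d - 1)" if j: "j < d" and s: "s \<in> {-1, 1}" for j s
  proof -
    have sum_e: "(\<Sum>i\<in>{j}. e (j, s) i) = s" using j by (simp add: e_def)
    have "Pow {j} = {{}, {j}}" by auto
    then have pr: "(\<Prod>S\<in>Pow {j}. g (x + (\<Sum>i\<in>S. e (j, s) i))) = g x * g (x + s)" for x
      using sum_e by (simp del: sum.insert)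
    have "g 2 = 0" "g (-1) = 0" using g by auto
    have "supp (e (j, s)) = {j}" using s j by (intro supp_e) auto
    then have R: "R (e (j, s)) = (g 0 * g (0 + s)) ^ 2 ^ (d - 1) + (g 1 * g (1 + s)) ^ 2 ^ (d - 1)"
      unfolding R_def by (simp only: pr) simp
    show ?thesis
    proof (cases "s = 1")
      case True
      then show ?thesis unfolding R using \<open>g 2 = 0\<close> by (simp add: power_0_left)
    next
      case False
      then have "s = -1" using s by simp
      then show ?thesis unfolding R using \<open>g (-1) = 0\<close> by (simp add: power_0_left mult.commute)
    qed
  qed
  have R_0: "R h = 0" if h: "h \<in> ({..<d} \<rightarrow>\<^sub>E {-1, 0, 1}) - H" for h
  proof -
    have ext: "h j = undefined" if "\<not> j < d" for j using h that by (auto simp: PiE_iff extensional_def)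
    have "h \<noteq> z" using h by (auto simp: H_def)
    moreover have "h = z" if "\<forall>i<d. h i = 0"
      using that ext by (auto simp: z_def fun_eq_iff)
    ultimately obtain i where i: "i < d" "h i \<noteq> 0" by blast
    have "h \<noteq> e (i, h i)" using h i by (auto simp: H_def PiE_iff)
    moreover have "h = e (i, h i)" if "\<forall>j<d. j \<noteq> i \<longrightarrow> h j = 0"
      using that ext by (auto simp: e_def fun_eq_iff)
    ultimately obtain j where j: "j < d" "h j \<noteq> 0" "j \<noteq> i" by blast
    have v: "h i \<in> {-1, 1}" "h j \<in> {-1, 1}" using h i j by (auto simp: PiE_iff)
    have "(\<Prod>S\<in>Pow (supp h). g (x + (\<Sum>j\<in>S. h j))) = 0" for x
    proof -
      have "\<exists>S\<in>{{}, {i}, {j}, {i, j}}. x + (\<Sum>j\<in>S. h j) \<notin> {0, 1}"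
        using v j(3) by auto
      moreover have "{{}, {i}, {j}, {i, j}} \<subseteq> Pow (supp h)"
        using i j by (auto simp: supp_def)
      ultimately have "\<exists>S\<in>Pow (supp h). g (x + (\<Sum>j\<in>S. h j)) = 0"
        using g by blast
      then show ?thesis by (intro prod_zero) (auto simp: supp_def)
    qed
    then show ?thesis by (simp add: R_def power_0_left)
  qed
  have inj: "inj_on e ({..<d} \<times> {-1, 1})"
  proof (rule inj_onI, clarify)
    fix j s j' s' assume A: "j < d" "s \<in> {-1, 1::int}" "j' < d" "s' \<in> {-1, 1::int}" "e (j, s) = e (j', s')"
    have "s \<noteq> 0" "s' \<noteq> 0" using A by auto
    then have "supp (e (j, s)) = {j}" "supp (e (j', s')) = {j'}" using supp_e A(1,3) by blast+
    then have "j = j'" unfolding A(5) by simp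
    moreover have "e (j, s) j = s" "e (j', s') j' = s'" using A(1,3) by (simp_all add: e_def)
    ultimately show "j = j' \<and> s = s'" unfolding A(5) by simp
  qed
  have z: "z \<notin> e ` ({..<d} \<times> {-1, 1})"
  proof
    assume "z \<in> e ` ({..<d} \<times> {-1, 1})"
    then obtain j s where "j < d" "s \<in> {-1, 1}" "z = e (j, s)" by auto
    then have "z j = s" by (simp add: e_def)
    then show False using \<open>j < d\<close> \<open>s \<in> {-1, 1}\<close> by (auto simp: z_def)
  qed
  have "interval_form 2 p d (\<lambda>_ _. g) = (\<Sum>h\<in>{..<d} \<rightarrow>\<^sub>E {-1, 0, 1}. R h ^ p)"
    unfolding interval_form_eq_sum_power unfolding iv R_def supp_def ..
  also have "\<dots> = (\<Sum>h\<in>H. R h ^ p)"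
  proof (rule sum.mono_neutral_right)
    show "finite ({..<d} \<rightarrow>\<^sub>E {-1, 0, 1::int})" by (intro finite_PiE) auto
    show "H \<subseteq> {..<d} \<rightarrow>\<^sub>E {-1, 0, 1}" by (auto simp: H_def z_def e_def split: if_splits)
    show "\<forall>h\<in>({..<d} \<rightarrow>\<^sub>E {-1, 0, 1}) - H. R h ^ p = 0" using R_0 p by (simp add: power_0_left)
  qed
  also have "\<dots> = R z ^ p + (\<Sum>v\<in>{..<d} \<times> {-1, 1}. R (e v) ^ p)"
    using z by (simp add: H_def sum.reindex[OF inj])
  also have "(\<Sum>v\<in>{..<d} \<times> {-1, 1}. R (e v) ^ p) = (\<Sum>v\<in>{..<d} \<times> {-1, 1::int}. ((g 0 * g 1) ^ 2 ^ (d - 1)) ^ p)"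
    using R_e by (intro sum.cong) auto
  also have "\<dots> = 2 * real d * ((g 0 * g 1) ^ 2 ^ (d - 1)) ^ p"
    by (simp add: card_cartesian_product)
  finally show ?thesis by (simp add: R_z)
qed

section \<open>The two-point inequality\<close>

lemma powr_slope_ineq:
  fixes r z :: real
  assumes r: "r \<ge> 2" and z: "0 < z" "z \<le> 1"
  shows "1 - z powr r \<le> (1 + z) powr (r - 1) * (1 - z)"
proof -
  have ln1: "z / (1 + z) \<le> ln (1 + z)"
  proof -
    have "ln (1 / (1 + z)) \<le> 1 / (1 + z) - 1"
      using z by (intro ln_le_minus_one) simp
    then show ?thesis using z by (simp add: ln_div field_simps)
  qed
  have ln2: "- (1 - z) / z \<le> ln z"
    using ln_le_minus_one[of "1 / z"] z by (simp add: ln_div field_simps)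
  have A: "1 + (r - 2) * (z / (1 + z)) \<le> (1 + z) powr (r - 2)"
  proof -
    have "1 + (r - 2) * (z / (1 + z)) \<le> 1 + (r - 2) * ln (1 + z)"
      using ln1 r by (intro add_left_mono mult_left_mono) auto
    also have "\<dots> \<le> exp ((r - 2) * ln (1 + z))" by (rule exp_ge_add_one_self)
    finally show ?thesis using z by (simp add: powr_def)
  qed
  have B: "1 - (r - 2) * (1 - z) / z \<le> z powr (r - 2)"
  proof -
    have "1 - (r - 2) * (1 - z) / z = 1 + (r - 2) * (- (1 - z) / z)"
      using z by (simp add: field_simps)
    also have "\<dots> \<le> 1 + (r - 2) * ln z"
      using ln2 r by (intro add_left_mono mult_left_mono) auto
    also have "\<dots> \<le> exp ((r - 2) * ln z)" by (rule exp_ge_add_one_self)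
    finally show ?thesis using z by (simp add: powr_def)
  qed
  \<comment> \<open>The bounds \<open>A\<close> and \<open>B\<close> come from tangent bounds for
    the logarithm; with the weights \<open>1 - z\<^sup>2\<close> and \<open>z\<^sup>2\<close> their
    terms in \<open>r - 2\<close> cancel exactly.\<close>
  have "1 = (1 + (r - 2) * (z / (1 + z))) * (1 - z\<^sup>2) + (1 - (r - 2) * (1 - z) / z) * z\<^sup>2"
  proof -
    have "(1 + (r - 2) * (z / (1 + z))) * (1 - z\<^sup>2) = 1 - z\<^sup>2 + (r - 2) * (z / (1 + z) * (1 + z)) * (1 - z)"
      by (simp add: algebra_simps power2_eq_square)
    moreover have "(1 - (r - 2) * (1 - z) / z) * z\<^sup>2 = z\<^sup>2 - (r - 2) * (1 - z) * z"
      using z by (simp add: field_simps power2_eq_square)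
    moreover have "z / (1 + z) * (1 + z) = z" using z by simp
    ultimately have "?thesis \<longleftrightarrow> 1 = 1 - z\<^sup>2 + (r - 2) * z * (1 - z) + (z\<^sup>2 - (r - 2) * (1 - z) * z)"
      by (simp only:)
    then show ?thesis by (simp only:) (simp add: mult_ac)
  qed
  also have "\<dots> \<le> (1 + z) powr (r - 2) * (1 - z\<^sup>2) + z powr (r - 2) * z\<^sup>2"
    using z by (intro add_mono mult_right_mono A B) (auto simp: power_le_one)
  also have "(1 + z) powr (r - 2) * (1 - z\<^sup>2) = ((1 + z) powr (r - 2) * (1 + z) powr 1) * (1 - z)"
    using z by (simp add: power2_eq_square algebra_simps)
  also have "(1 + z) powr (r - 2) * (1 + z) powr 1 = (1 + z) powr (r - 1)"
    unfolding powr_add[symmetric] by simp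
  also have "z powr (r - 2) * z\<^sup>2 = z powr r"
    using z by (simp flip: powr_numeral powr_add)
  finally show ?thesis by simp
qed

text \<open>For \<open>p = 1\<close> this is the preceding inequality at \<open>r = s\<close>. For
  \<open>p \<ge> 2\<close> one factor \<open>1 + z powr s\<close> merges with
  \<open>1 - z powr s\<close>, so that it is used at \<open>r = 2 * s\<close>, and
  \<open>s \<ge> 1\<close> suffices; the other factors are compared by
  \<open>1 + z powr s \<le> (1 + z) powr s\<close>.\<close>

lemma powr_slope_ineq_power:
  fixes s z :: real and p :: nat
  assumes p: "p \<ge> 1" and s: "s \<ge> 1" "p = 1 \<Longrightarrow> s \<ge> 2" and z: "0 < z" "z \<le> 1"
  shows "(1 + z powr s) ^ (p - 1) * (1 - z powr s) \<le> (1 + z) powr (s * p - 1) * (1 - z)"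
proof (cases "p = 1")
  case True
  then show ?thesis using powr_slope_ineq[of s z] s z by simp
next
  case False
  then have p2: "p \<ge> 2" using p by simp
  have "z powr s \<le> z powr 1" using z s by (intro powr_mono') auto
  then have "1 + z powr s \<le> (1 + z) powr 1" using z by simp
  also have "\<dots> \<le> (1 + z) powr s" using z s by (intro powr_mono) auto
  finally have base: "1 + z powr s \<le> (1 + z) powr s" .
  have "(1 + z powr s) ^ (p - 1) * (1 - z powr s) = (1 + z powr s) ^ (p - 2) * (1 - z powr (2 * s))"
  proof -
    have "p - 1 = Suc (p - 2)" using p2 by simp
    moreover have "z powr (2 * s) = z powr s * z powr s" by (simp flip: powr_add)
    ultimately show ?thesis by (simp add: algebra_simps)
  qed
  also have "\<dots> \<le> ((1 + z) powr s) ^ (p - 2) * ((1 + z) powr (2 * s - 1) * (1 - z))"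
    using s z powr_le1[of "2 * s" z] by (intro mult_mono power_mono base powr_slope_ineq) auto
  also have "((1 + z) powr s) ^ (p - 2) = (1 + z) powr (s * (real p - 2))"
    using p2 z by (simp add: powr_powr of_nat_diff flip: powr_realpow)
  also have "(1 + z) powr (s * (real p - 2)) * ((1 + z) powr (2 * s - 1) * (1 - z))
    = (1 + z) powr (s * p - 1) * (1 - z)"
    by (simp add: algebra_simps flip: powr_add)
  finally show ?thesis .
qed

text \<open>
  The difference of the two sides increases in \<open>w \<ge> 0\<close>; in terms of \<open>z = exp (- 2 * w)\<close> this is
  the preceding lemma.
\<close>

lemma cosh_powr_ineq:
  fixes w s c :: real and p :: nat
  assumes p: "p \<ge> 1" and s: "s \<ge> 1" "p = 1 \<Longrightarrow> s \<ge> 2" and c: "2 powr (s * p) = 2 ^ p + c"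
  shows "(2 * cosh (s * w)) ^ p + c \<le> (2 * cosh w) powr (s * p)"
proof -
  define \<phi> where "\<phi> w = (2 * cosh w) powr (s * p) - (2 * cosh (s * w)) ^ p" for w
  define \<phi>' where "\<phi>' w = (s * p) * (2 * cosh w) powr (s * p - 1) * (2 * sinh w)
    - p * (2 * cosh (s * w)) ^ (p - 1) * (2 * (s * sinh (s * w)))" for w
  have deriv: "(\<phi> has_real_derivative \<phi>' w) (at w)" for w
    unfolding \<phi>_def \<phi>'_def
  proof (rule DERIV_diff)
    show "((\<lambda>w. (2 * cosh w) powr (s * p)) has_real_derivative
      (s * p) * (2 * cosh w) powr (s * p - 1) * (2 * sinh w)) (at w)"
      using cosh_real_pos[of w] by (auto intro!: derivative_eq_intros simp: powr_diff)
    show "((\<lambda>w. (2 * cosh (s * w)) ^ p) has_real_derivative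
      p * (2 * cosh (s * w)) ^ (p - 1) * (2 * (s * sinh (s * w)))) (at w)"
    proof -
      have "((\<lambda>w. 2 * cosh (s * w)) has_real_derivative 2 * (s * sinh (s * w))) (at w)"
        by (auto intro!: derivative_eq_intros)
      from DERIV_power[OF this, of p] show ?thesis
        by (simp only: mult_ac One_nat_def)
    qed
  qed
  have nonneg: "\<phi>' w \<ge> 0" if w: "w \<ge> 0" for w
  proof -
    define z where "z = exp (- 2 * w)"
    have z: "0 < z" "z \<le> 1" using w by (auto simp: z_def)
    have zs: "z powr s = exp (- 2 * (s * w))" by (simp add: z_def powr_def)
    have ch: "2 * cosh w = exp w * (1 + z)" "2 * sinh w = exp w * (1 - z)"
      by (auto simp: cosh_def sinh_def z_def algebra_simps simp flip: exp_add)
    have chs: "2 * cosh (s * w) = exp (s * w) * (1 + z powr s)" "2 * sinh (s * w) = exp (s * w) * (1 - z powr s)"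
      unfolding zs by (auto simp: cosh_def sinh_def algebra_simps simp flip: exp_add)
    have "(2 * cosh (s * w)) ^ (p - 1) * (2 * sinh (s * w))
      = exp (s * w) ^ p * ((1 + z powr s) ^ (p - 1) * (1 - z powr s))"
    proof -
      have "exp (s * w) ^ p = exp (s * w) ^ (p - 1) * exp (s * w)"
        using p by (metis Suc_diff_1 less_le_trans power_Suc2 zero_less_one)
      then show ?thesis unfolding chs by (simp add: power_mult_distrib)
    qed
    also have "\<dots> \<le> exp (s * w) ^ p * ((1 + z) powr (s * p - 1) * (1 - z))"
      by (intro mult_left_mono powr_slope_ineq_power p s z) auto
    also have "exp (s * w) ^ p = exp w powr (s * p - 1) * exp w"
      by (simp add: powr_def algebra_simps flip: exp_add exp_of_nat_mult)
    also have "exp w powr (s * p - 1) * exp w * ((1 + z) powr (s * p - 1) * (1 - z))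
      = (2 * cosh w) powr (s * p - 1) * (2 * sinh w)"
      unfolding ch by (simp add: powr_mult mult_ac)
    finally have le: "(2 * cosh (s * w)) ^ (p - 1) * (2 * sinh (s * w))
      \<le> (2 * cosh w) powr (s * p - 1) * (2 * sinh w)" .
    have "\<phi>' w = (s * p) * ((2 * cosh w) powr (s * p - 1) * (2 * sinh w)
      - (2 * cosh (s * w)) ^ (p - 1) * (2 * sinh (s * w)))"
      by (simp add: \<phi>'_def algebra_simps)
    also have "\<dots> \<ge> 0" using le s by (intro mult_nonneg_nonneg) auto
    finally show ?thesis .
  qed
  \<comment> \<open>The constant \<open>c\<close> is the gap at \<open>w = 0\<close>, so
    monotonicity from there is enough; evenness of \<open>cosh\<close> covers negative
    \<open>w\<close>.\<close>
  have "\<phi> 0 \<le> \<phi> \<bar>w\<bar>"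
  proof (rule DERIV_nonneg_imp_nondecreasing[of 0 "\<bar>w\<bar>" \<phi>])
    show "\<exists>y. (\<phi> has_real_derivative y) (at x) \<and> 0 \<le> y" if "0 \<le> x" "x \<le> \<bar>w\<bar>" for x
      using deriv[of x] nonneg[OF that(1)] by (intro exI[of _ "\<phi>' x"] conjI)
  qed simp
  moreover have "\<phi> 0 = c" using c by (simp add: \<phi>_def)
  moreover have "cosh \<bar>w\<bar> = cosh w" "cosh (s * \<bar>w\<bar>) = cosh (s * w)"
    by (auto simp: abs_if)
  ultimately show ?thesis by (simp add: \<phi>_def)
qed

lemma two_point_ineq:
  fixes u v t :: real and d p :: nat
  assumes p: "p \<ge> 1" and d: "d \<ge> 2" and t: "2 powr t = 2 ^ p + 2 * real d" and uv: "0 \<le> u" "0 \<le> v"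
  shows "(u powr (t / p) + v powr (t / p)) ^ p + 2 * real d * (u * v) powr (t / 2) \<le> (u + v) powr t"
proof -
  have "2 powr real p < 2 powr t" using t d by (simp add: powr_realpow)
  then have tp: "t > p" by simp
  define s where "s = t / p"
  have sp: "s * p = t" "s \<ge> 1" using p tp by (auto simp: s_def)
  \<comment> \<open>The slope inequality needs \<open>s \<ge> 2\<close> when \<open>p = 1\<close>;
    this holds because \<open>2 powr t = 2 + 2 * d\<close> is then at least 4.\<close>
  have s2: "s \<ge> 2" if "p = 1"
  proof -
    have "2 powr (2::real) \<le> 2 powr t" using t d that by (simp add: powr_numeral)
    then have "2 \<le> t" by (subst (asm) powr_le_cancel_iff) auto
    then show ?thesis using that by (simp add: s_def)
  qed
  show ?thesis
  proof (cases "u = 0 \<or> v = 0")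
    case True
    then show ?thesis using uv tp p by (auto simp: powr_powr simp flip: powr_realpow')
  next
    case False
    then have uv: "u > 0" "v > 0" using uv by auto
    \<comment> \<open>Both sides are homogeneous of degree \<open>t\<close>. The geometric mean
      \<open>exp y\<close> of \<open>u\<close> and \<open>v\<close> factors out, and only half of
      the logarithmic ratio, \<open>w\<close>, remains.\<close>
    define y where "y = (ln u + ln v) / 2"
    define w where "w = (ln u - ln v) / 2"
    have yw: "u = exp (y + w)" "v = exp (y - w)" using uv by (auto simp: y_def w_def field_simps)
    have uv_sum: "u + v = exp y * (2 * cosh w)"
      unfolding yw by (simp add: cosh_def algebra_simps flip: exp_add)
    have uvs: "u powr s + v powr s = exp (s * y) * (2 * cosh (s * w))"
      unfolding yw by (simp add: cosh_def powr_def algebra_simps flip: exp_add)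
    have uvm: "(u * v) powr (t / 2) = exp (t * y)"
      unfolding yw by (simp add: powr_def mult_ac flip: exp_add)
    have e: "exp (s * y) ^ p = exp (t * y)"
      using sp by (simp flip: exp_of_nat_mult) (simp add: mult_ac)
    have "(u powr s + v powr s) ^ p + 2 * real d * (u * v) powr (t / 2)
      = exp (t * y) * ((2 * cosh (s * w)) ^ p + 2 * real d)"
      unfolding uvs uvm by (simp add: power_mult_distrib e algebra_simps)
    also have "\<dots> \<le> exp (t * y) * (2 * cosh w) powr (s * p)"
      using t sp s2 p by (intro mult_left_mono cosh_powr_ineq) auto
    also have "\<dots> = (u + v) powr t"
      unfolding uv_sum sp using cosh_real_pos[of w] by (simp add: powr_mult) (simp add: powr_def mult.commute)
    finally show ?thesis by (simp add: s_def)
  qed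
qed

section \<open>The extremal exponents for \<open>n = 2\<close>\<close>

context
  fixes d p :: nat and t :: real
  assumes d: "d \<ge> 2" and p: "p \<ge> 1"
  defines "t \<equiv> log 2 (2 ^ p + 2 * real d)"
begin

lemma two_powr_t: "2 powr t = 2 ^ p + 2 * real d"
proof -
  have "(0::real) < 2 ^ p + 2 * real d" by (simp add: add_pos_nonneg)
  then show ?thesis by (simp add: t_def)
qed

lemma t_pos: "t > 0"
proof -
  have "(1::real) < 2 ^ p + 2 * real d" using d by (simp add: add_pos_nonneg add_nonneg_pos add_strict_increasing2)
  then show ?thesis by (simp add: t_def)
qed

lemma interval_ineq_two: "interval_ineq d p 2 t"
  unfolding interval_ineq_def
proof (intro allI impI)
  fix g :: "int \<Rightarrow> real"
  assume g: "\<forall>x. 0 \<le> g x" "\<forall>x. x \<notin> {0..<int 2} \<longrightarrow> g x = 0"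
  define q where "q = real (p * 2 ^ d) / t"
  define u where "u = g 0 powr q"
  define v where "v = g 1 powr q"
  have iv: "{0..<int 2} = {0, 1}" by auto
  have e: "q * (t / p) = 2 ^ d" using t_pos p by (simp add: q_def)
  have "(x powr q) powr (t / p) = x ^ 2 ^ d" if "x \<ge> 0" for x
  proof -
    have "(x powr q) powr (t / p) = x powr real (2 ^ d)" unfolding powr_powr e by simp
    then show ?thesis using powr_realpow'[OF that, of "2 ^ d"] by simp
  qed
  then have "u powr (t / p) = g 0 ^ 2 ^ d" "v powr (t / p) = g 1 ^ 2 ^ d"
    using g(1) by (auto simp: u_def v_def)
  moreover have "(u * v) powr (t / 2) = ((g 0 * g 1) ^ 2 ^ (d - 1)) ^ p"
  proof -
    have "(2::real) ^ d = 2 * 2 ^ (d - 1)" using d by (cases d) auto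
    then have "q * (t / 2) = real (2 ^ (d - 1) * p)" using t_pos by (simp add: q_def)
    then have "(u * v) powr (t / 2) = (g 0 * g 1) powr real (2 ^ (d - 1) * p)"
      by (simp add: u_def v_def powr_powr flip: powr_mult)
    also have "\<dots> = ((g 0 * g 1) ^ 2 ^ (d - 1)) ^ p"
      using g(1) p by (simp add: powr_realpow' power_mult del: of_nat_mult)
    finally show ?thesis .
  qed
  ultimately show "interval_form 2 p d (\<lambda>_ _. g) \<le> (\<Sum>y\<in>{0..<int 2}. g y powr (real (p * 2 ^ d) / t)) powr t"
    using two_point_ineq[OF p d two_powr_t, of u v] interval_form_two[of g p d] g p
    unfolding iv by (simp add: u_def v_def q_def)
qed

lemma cube_form_two: "cube_form (cube 1 2) (dcube 1 2) p d (\<lambda>_ _. indicator (cube 1 2)) = 2 ^ p + 2 * real d"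
proof -
  have "cube_form (cube 1 2) (dcube 1 2) p d (\<lambda>_ _. indicator (cube 1 2))
    = cube_form (cube 1 2) (dcube 1 2) p d (\<lambda>_ _ x. \<Prod>i<1. indicator {0, 1} (x i))"
    by (rule cube_form_cong_lattice) (auto simp: indicator_def cube_def)
  also have "\<dots> = 2 ^ p + 2 * real d"
    using interval_form_two[of "indicator {0, 1}" p d] p unfolding cube_form_tensor_power by simp
  finally show ?thesis .
qed

lemma card_cube_two: "card (cube 1 2) = 2"
  using sum_cube_tensor_power[of "\<lambda>_. 1" 1 2] by simp

text \<open>Sharpness comes from the single set \<open>{0, 1}\<close> in dimension one, whose energy
  \<open>2 ^ p + 2 * d\<close> equals \<open>2 powr t\<close>.\<close>

theorem t_exp_two: "t_exp d p 2 = t"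
proof (rule antisym)
  have adm: "t_admissible d p 2 t"
    by (intro t_admissible_of_interval_ineq p t_pos interval_ineq_two)
  show "t_exp d p 2 \<le> t" by (rule t_exp_le) (rule adm)
  show "t \<le> t_exp d p 2"
  proof (rule le_t_exp[OF adm])
    fix t' assume "t_admissible d p 2 t'"
    then have "cube_energy 1 d p (cube 1 2) \<le> real (card (cube 1 2)) powr t'"
      by (auto simp: t_admissible_def)
    then have "2 powr t \<le> 2 powr t'"
      unfolding cube_energy_eq_cube_form[OF p order_refl] cube_form_two card_cube_two two_powr_t
      by simp
    then show "t \<le> t'" by simp
  qed
qed

text \<open>The same set bounds every admissible \<open>q\<close> from above, and the claimed value
  is itself admissible, so the supremum is a maximum.\<close>

theorem q_exp_two: "q_exp d p 2 = 2 ^ d * real p / t"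
  unfolding q_exp_def
proof (rule cSup_eq_maximum, goal_cases)
  case 1
  show ?case
    using p t_pos gowers_norm_le_of_interval_ineq[OF p t_pos interval_ineq_two] by simp
next
  case (2 q)
  then have q: "q > 0" and *: "gowers_norm 1 d p (indicator (cube 1 2)) \<le> lq_norm 1 q (indicator (cube 1 2))"
    by (auto simp: indicator_def)
  have "(\<Sum>\<^sub>\<infinity>x\<in>lattice 1. indicator (cube 1 2) x powr q :: real) = (\<Sum>\<^sub>\<infinity>x\<in>cube 1 2. 1)"
    using q cube_subset_lattice[of 1 2] by (intro infsum_cong_neutral) auto
  then have lq: "lq_norm 1 q (indicator (cube 1 2)) = 2 powr (1 / q)"
    unfolding lq_norm_def by (simp add: card_cube_two del: One_nat_def)
  have gw: "gowers_norm 1 d p (indicator (cube 1 2)) = (2 powr t) powr (1 / (2 ^ d * real p))"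
    unfolding gowers_norm_def using infsum_cube_corr_power[OF p, of 1 2 "indicator (cube 1 2)" d]
    by (simp add: cube_form_two two_powr_t del: One_nat_def)
  have "2 powr (t / (2 ^ d * real p)) \<le> 2 powr (1 / q)"
    using * unfolding lq gw powr_powr by simp
  then have "t / (2 ^ d * real p) \<le> 1 / q" by simp
  then show ?case using q t_pos p by (simp add: field_simps)
qed

end

section \<open>Additive energy\<close>
lemma sum_translate_le:
  fixes u :: "'g::ab_group_add \<Rightarrow> real"
  assumes "finite X" "finite D" "\<And>y. 0 \<le> u y" "\<And>y. y \<notin> X \<Longrightarrow> u y = 0"
  shows "(\<Sum>g\<in>D. u (x + g)) \<le> (\<Sum>y\<in>X. u y)"
proof -
  have "(\<Sum>g\<in>D. u (x + g)) = (\<Sum>y\<in>(+) x ` D. u y)"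
    by (subst sum.reindex) (auto simp: inj_on_def)
  also have "\<dots> = (\<Sum>y\<in>(+) x ` D \<inter> X. u y)"
    using assms by (intro sum.mono_neutral_right) auto
  also have "\<dots> \<le> (\<Sum>y\<in>X. u y)"
    using assms by (intro sum_mono2) auto
  finally show ?thesis .
qed

text \<open>The correlation \<open>r h\<close> counts base points in \<open>A\<close>, hence is at
  most \<open>card A\<close>; this settles the step in \<open>p\<close>. For the step in
  \<open>d\<close>, the self-correlation \<open>v g\<close> of the indicator \<open>u h\<close> is
  at most \<open>r h\<close> pointwise and its sum over \<open>g\<close> is at most the square of
  \<open>r h\<close>, so its \<open>p\<close>-th powers sum to at most
  \<open>r h ^ Suc p\<close>.\<close>

lemma cube_form_Suc_le:
  fixes A X D :: "'g::ab_group_add set"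
  assumes X: "finite X" and D: "finite D" and A: "A \<subseteq> X" and p: "p \<ge> 1"
  shows "cube_form X D p (Suc d) (\<lambda>_ _. indicator A) \<le> card A * cube_form X D p d (\<lambda>_ _. indicator A)"
    and "cube_form X D (Suc p) d (\<lambda>_ _. indicator A) \<le> card A * cube_form X D p d (\<lambda>_ _. indicator A)"
proof -
  define u where "u h x = (\<Prod>S\<in>Pow {..<d}. indicator A (x + (\<Sum>j\<in>S. h j)) :: real)" for h x
  define r where "r h = (\<Sum>x\<in>X. u h x)" for h
  have u01: "0 \<le> u h x" "u h x \<le> 1" for h x
    by (auto simp: u_def prod_nonneg intro!: prod_le_1)
  have uA: "u h x \<le> indicator A x" for h x
  proof (cases "x \<in> A")
    case False
    then have "indicator A (x + (\<Sum>j\<in>{}. h j)) = (0::real)" by simp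
    moreover have "{} \<in> Pow {..<d}" by simp
    ultimately have "u h x = 0" unfolding u_def by (meson finite_Pow_iff finite_lessThan prod_zero)
    then show ?thesis by simp
  qed (use u01 in simp)
  have u0: "u h x = 0" if "x \<notin> X" for h x
  proof -
    have "x \<notin> A" using that A by auto
    then show ?thesis using uA[of h x] u01(1)[of h x] by simp
  qed
  have r0: "0 \<le> r h" for h unfolding r_def by (intro sum_nonneg u01)
  have rA: "r h \<le> card A" for h
  proof -
    have "r h \<le> (\<Sum>x\<in>X. indicator A x)" unfolding r_def by (intro sum_mono uA)
    also have "\<dots> = card A" using X A by (simp add: indicator_def sum.If_cases Int_absorb1)
    finally show ?thesis .
  qed
  have E: "cube_form X D p d (\<lambda>_ _. indicator A) = (\<Sum>h\<in>{..<d} \<rightarrow>\<^sub>E D. r h ^ p)" for p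
    by (simp add: cube_form_def u_def r_def)
  have step: "(\<Sum>h\<in>{..<d} \<rightarrow>\<^sub>E D. r h ^ Suc p) \<le> card A * (\<Sum>h\<in>{..<d} \<rightarrow>\<^sub>E D. r h ^ p)"
    unfolding sum_distrib_left power_Suc by (intro sum_mono mult_right_mono rA zero_le_power r0)
  then show "cube_form X D (Suc p) d (\<lambda>_ _. indicator A) \<le> card A * cube_form X D p d (\<lambda>_ _. indicator A)"
    unfolding E .
  have "cube_form X D p (Suc d) (\<lambda>_ _. indicator A)
    = (\<Sum>g\<in>D. \<Sum>h\<in>{..<d} \<rightarrow>\<^sub>E D. (\<Sum>x\<in>X. u h x * u h (x + g)) ^ p)"
    unfolding cube_form_Suc unfolding cube_form_def u_def
    by (simp add: prod.distrib add_ac)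
  also have "\<dots> = (\<Sum>h\<in>{..<d} \<rightarrow>\<^sub>E D. \<Sum>g\<in>D. (\<Sum>x\<in>X. u h x * u h (x + g)) ^ p)"
    by (rule sum.swap)
  also have "\<dots> \<le> (\<Sum>h\<in>{..<d} \<rightarrow>\<^sub>E D. r h ^ Suc p)"
  proof (rule sum_mono)
    fix h
    define v where "v g = (\<Sum>x\<in>X. u h x * u h (x + g))" for g
    have v0: "0 \<le> v g" for g unfolding v_def by (intro sum_nonneg mult_nonneg_nonneg u01)
    have vr: "v g \<le> r h" for g
      unfolding v_def r_def using u01 by (intro sum_mono mult_left_le) auto
    have p': "Suc (p - 1) = p" using p by simp
    have "(\<Sum>g\<in>D. v g ^ p) = (\<Sum>g\<in>D. v g ^ (p - 1) * v g)"
      by (subst (1) p'[symmetric]) (simp add: mult.commute)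
    also have "\<dots> \<le> (\<Sum>g\<in>D. r h ^ (p - 1) * v g)"
      by (intro sum_mono mult_right_mono power_mono vr v0)
    also have "\<dots> = r h ^ (p - 1) * (\<Sum>x\<in>X. u h x * (\<Sum>g\<in>D. u h (x + g)))"
      unfolding v_def sum_distrib_left by (subst sum.swap) simp
    also have "\<dots> \<le> r h ^ (p - 1) * (\<Sum>x\<in>X. u h x * r h)"
      unfolding r_def[of h] using u01 u0 X D r0 by (intro mult_left_mono sum_mono sum_translate_le)
        (auto simp: r_def intro!: zero_le_power sum_nonneg)
    also have "\<dots> = r h ^ Suc (Suc (p - 1))"
      by (simp add: r_def flip: sum_distrib_right)
    finally show "(\<Sum>g\<in>D. v g ^ p) \<le> r h ^ Suc p" unfolding p' .
  qed
  also note step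
  finally show "cube_form X D p (Suc d) (\<lambda>_ _. indicator A) \<le> card A * cube_form X D p d (\<lambda>_ _. indicator A)"
    unfolding E .
qed

lemma cube_form_le_additive_energy:
  fixes A X D :: "'g::ab_group_add set"
  assumes X: "finite X" and D: "finite D" and A: "A \<subseteq> X"
  shows "cube_form X D (Suc p) (2 + d) (\<lambda>_ _. indicator A)
    \<le> real (card A) ^ (p + d) * cube_form X D 1 2 (\<lambda>_ _. indicator A)"
proof (induction d)
  case 0
  show ?case
  proof (induction p)
    case (Suc p)
    have "cube_form X D (Suc (Suc p)) (2 + 0) (\<lambda>_ _. indicator A)
      \<le> card A * cube_form X D (Suc p) (2 + 0) (\<lambda>_ _. indicator A)"
      by (rule cube_form_Suc_le[OF X D A]) simp
    also have "\<dots> \<le> card A * (real (card A) ^ (p + 0) * cube_form X D 1 2 (\<lambda>_ _. indicator A))"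
      by (intro mult_left_mono Suc.IH) auto
    finally show ?case by (simp add: mult_ac)
  qed simp
next
  case (Suc d)
  have "cube_form X D (Suc p) (2 + Suc d) (\<lambda>_ _. indicator A)
    \<le> card A * cube_form X D (Suc p) (2 + d) (\<lambda>_ _. indicator A)"
    using cube_form_Suc_le(1)[OF X D A, of "Suc p" "2 + d"] by simp
  also have "\<dots> \<le> card A * (real (card A) ^ (p + d) * cube_form X D 1 2 (\<lambda>_ _. indicator A))"
    by (intro mult_left_mono Suc.IH) auto
  finally show ?case by (simp add: mult_ac)
qed

text \<open>From \<open>(2, 1)\<close> to \<open>(d, p)\<close> there are \<open>d - 2\<close>
  increments of the first parameter and \<open>p - 1\<close> of the second, each costing a factor
  \<open>card A\<close>.\<close>

lemma t_admissible_of_additive_energy: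
  assumes d: "d \<ge> 2" and p: "p \<ge> 1" and t: "t_admissible 2 1 n t"
  shows "t_admissible d p n (t + real d + real p - 3)"
  unfolding t_admissible_def
proof (intro conjI allI impI)
  show "0 < t + real d + real p - 3" using t d p by (simp add: t_admissible_def)
  fix m A assume mA: "1 \<le> m" "A \<subseteq> cube m n"
  have e: "Suc (p - 1) = p" "2 + (d - 2) = d" using d p by auto
  have "cube_energy m d p A = cube_form (cube m n) (dcube m n) (Suc (p - 1)) (2 + (d - 2)) (\<lambda>_ _. indicator A)"
    unfolding e by (rule cube_energy_eq_cube_form[OF p mA(2)])
  also have "\<dots> \<le> real (card A) ^ (p - 1 + (d - 2)) * cube_form (cube m n) (dcube m n) 1 2 (\<lambda>_ _. indicator A)"
    by (intro cube_form_le_additive_energy mA(2)) auto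
  also have "cube_form (cube m n) (dcube m n) 1 2 (\<lambda>_ _. indicator A) = cube_energy m 2 1 A"
    by (rule cube_energy_eq_cube_form[symmetric]) (use mA in auto)
  also have "real (card A) ^ (p - 1 + (d - 2)) * \<dots> \<le> real (card A) ^ (p - 1 + (d - 2)) * real (card A) powr t"
    using t mA by (intro mult_left_mono) (auto simp: t_admissible_def)
  also have "\<dots> = real (card A) powr (t + real d + real p - 3)"
  proof (cases "card A = 0")
    case False
    have "real (card A) ^ (p - 1 + (d - 2)) = real (card A) powr real (p - 1 + (d - 2))"
      using False by (subst powr_realpow) auto
    also have "real (p - 1 + (d - 2)) = real d + real p - 3" using d p by (simp add: of_nat_diff)
    finally show ?thesis by (simp add: add_ac add_diff_eq flip: powr_add)
  qed simp
  finally show "cube_energy m d p A \<le> real (card A) powr (t + real d + real p - 3)" .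
qed

section \<open>Young's inequality for parallelograms and its stability\<close>

lemma sum_shift_eq:
  fixes F :: "int \<Rightarrow> real"
  assumes F: "\<And>y. y \<notin> {0..<int n} \<Longrightarrow> F y = 0" and x: "x \<in> {0..<int n}"
  shows "(\<Sum>h\<in>{-int n<..<int n}. F (x + h)) = (\<Sum>y\<in>{0..<int n}. F y)"
proof -
  have "(\<Sum>h\<in>{-int n<..<int n}. F (x + h)) = (\<Sum>y\<in>{x - int n<..<x + int n}. F y)"
    by (rule sum.reindex_bij_witness[where i = "\<lambda>y. y - x" and j = "\<lambda>h. x + h"]) auto
  also have "\<dots> = (\<Sum>y\<in>{0..<int n}. F y)"
    using x by (intro sum.mono_neutral_right) (auto intro!: F)
  finally show ?thesis .
qed

text \<open>Coordinates are three vertices instead of a base point and two directions: with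
  \<open>b = a + g\<close> and \<open>c = a + h\<close>, the fourth vertex is
  \<open>b + c - a\<close>.\<close>

lemma interval_form_parallelogram:
  assumes f: "\<And>x. x \<notin> {0..<int n} \<Longrightarrow> f x = 0"
  shows "interval_form n 1 2 (\<lambda>_ _. f) =
    (\<Sum>a\<in>{0..<int n}. \<Sum>b\<in>{0..<int n}. \<Sum>c\<in>{0..<int n}. f a * f b * f c * f (b + c - a))"
proof -
  have "interval_form n 1 2 (\<lambda>_ _. f) = (\<Sum>g\<in>{-int n<..<int n}. \<Sum>h\<in>{-int n<..<int n}. \<Sum>a\<in>{0..<int n}.
     f a * f (a + g) * (f (a + h) * f (a + h + g)))"
    by (simp add: numeral_2_eq_2 cube_form_Suc cube_form_0)
  also have "\<dots> = (\<Sum>a\<in>{0..<int n}. \<Sum>g\<in>{-int n<..<int n}. \<Sum>h\<in>{-int n<..<int n}.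
     f a * f (a + g) * (f (a + h) * f (a + h + g)))"
    by (subst (2) sum.swap, subst sum.swap, rule refl)
  also have "\<dots> = (\<Sum>a\<in>{0..<int n}. \<Sum>b\<in>{0..<int n}. \<Sum>c\<in>{0..<int n}. f a * f b * f c * f (b + c - a))"
  proof (rule sum.cong[OF refl])
    fix a assume a: "a \<in> {0..<int n}"
    have "(\<Sum>g\<in>{-int n<..<int n}. \<Sum>h\<in>{-int n<..<int n}. f a * f (a + g) * (f (a + h) * f (a + h + g)))
      = (\<Sum>g\<in>{-int n<..<int n}. \<Sum>c\<in>{0..<int n}. f a * f (a + g) * (f c * f (c + g)))"
      using a by (intro sum.cong refl sum_shift_eq[where F = "\<lambda>c. f a * f (a + g) * (f c * f (c + g))" for g])
        (auto simp: f)
    also have "\<dots> = (\<Sum>g\<in>{-int n<..<int n}. \<Sum>c\<in>{0..<int n}. f a * f (a + g) * f c * f (a + g + c - a))"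
      by (simp add: mult_ac add_ac)
    also have "\<dots> = (\<Sum>b\<in>{0..<int n}. \<Sum>c\<in>{0..<int n}. f a * f b * f c * f (b + c - a))"
      using a by (intro sum_shift_eq[where F = "\<lambda>b. \<Sum>c\<in>{0..<int n}. f a * f b * f c * f (b + c - a)"])
        (auto simp: f)
    finally show "(\<Sum>g\<in>{-int n<..<int n}. \<Sum>h\<in>{-int n<..<int n}. f a * f (a + g) * (f (a + h) * f (a + h + g)))
      = (\<Sum>b\<in>{0..<int n}. \<Sum>c\<in>{0..<int n}. f a * f b * f c * f (b + c - a))" .
  qed
  finally show ?thesis .
qed

text \<open>The left side is the geometric mean of \<open>X\<close> and \<open>Y\<close>. After
  AM-GM, \<open>X\<close> is kept because summing it over \<open>a\<close> produces an affinity,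
  while in \<open>Y\<close> a second AM-GM replaces the root by \<open>b + c\<close>, so that it
  sums to at most 1 for probability weights.\<close>

lemma powr_three_quarters_le:
  fixes a b c d :: real
  assumes "0 \<le> a" "0 \<le> b" "0 \<le> c" "0 \<le> d"
  shows "(a * b * c * d) powr (3 / 4) \<le> b * c * sqrt (a * d) / 2 + a * d * (b + c) / 4"
proof -
  define X where "X = b * c * sqrt (a * d)"
  define Y where "Y = a * d * sqrt (b * c)"
  have "(a * b * c * d) powr (3 / 4) = sqrt (sqrt ((a * b * c * d) ^ 3))"
  proof -
    have "sqrt x = x powr (1/2)" if "x \<ge> 0" for x using that by (simp add: powr_half_sqrt)
    then show ?thesis using assms by (simp add: powr_powr flip: powr_numeral)
  qed
  also have "(a * b * c * d) ^ 3 = ((b * c)\<^sup>2 * (a * d)) * ((a * d)\<^sup>2 * (b * c))"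
    by (simp add: power2_eq_square power3_eq_cube mult_ac)
  also have "sqrt \<dots> = X * Y"
    unfolding X_def Y_def real_sqrt_mult[of "(b * c)\<^sup>2 * (a * d)"] real_sqrt_mult[of "(b * c)\<^sup>2"] real_sqrt_mult[of "(a * d)\<^sup>2"]
    using assms by simp
  also have "sqrt (X * Y) \<le> (X + Y) / 2"
    using assms by (intro arith_geo_mean_sqrt) (auto simp: X_def Y_def)
  also have "Y \<le> a * d * ((b + c) / 2)"
    unfolding Y_def using assms by (intro mult_left_mono arith_geo_mean_sqrt) auto
  finally show ?thesis by (simp add: X_def)
qed

lemma sum_reflect_le:
  fixes F :: "int \<Rightarrow> real"
  assumes "finite X" "\<And>y. 0 \<le> F y" "\<And>y. y \<notin> X \<Longrightarrow> F y = 0"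
  shows "(\<Sum>a\<in>X. F (s - a)) \<le> (\<Sum>y\<in>X. F y)"
  using sum_translate_le[of X "uminus ` X" F s] assms by (simp add: sum.reindex inj_on_def)

text \<open>
  The loss in Young's inequality is controlled by the Hellinger affinity between \<open>F1\<close> and a
  reflection of \<open>F4\<close>.
\<close>

lemma young_affinity:
  fixes F1 F2 F3 F4 :: "int \<Rightarrow> real"
  assumes X: "finite X"
    and nn: "\<And>y. 0 \<le> F1 y" "\<And>y. 0 \<le> F2 y" "\<And>y. 0 \<le> F3 y" "\<And>y. 0 \<le> F4 y"
    and F4: "\<And>y. y \<notin> X \<Longrightarrow> F4 y = 0" "(\<Sum>y\<in>X. F4 y) \<le> 1"
    and F123: "(\<Sum>y\<in>X. F1 y) \<le> 1" "(\<Sum>y\<in>X. F2 y) \<le> 1" "(\<Sum>y\<in>X. F3 y) \<le> 1"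
  shows "(\<Sum>a\<in>X. \<Sum>b\<in>X. \<Sum>c\<in>X. (F1 a * F2 b * F3 c * F4 (b + c - a)) powr (3 / 4))
    \<le> (\<Sum>b\<in>X. \<Sum>c\<in>X. F2 b * F3 c * (\<Sum>a\<in>X. sqrt (F1 a * F4 (b + c - a)))) / 2 + 1 / 2"
proof -
  have s1: "(\<Sum>x\<in>X. F4 (s + x)) \<le> 1" for s
    using sum_translate_le[OF X X, of F4 s] nn F4 by (auto intro: order_trans)
  have "(\<Sum>a\<in>X. \<Sum>b\<in>X. \<Sum>c\<in>X. (F1 a * F2 b * F3 c * F4 (b + c - a)) powr (3 / 4))
    \<le> (\<Sum>a\<in>X. \<Sum>b\<in>X. \<Sum>c\<in>X. F2 b * F3 c * sqrt (F1 a * F4 (b + c - a)) / 2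
        + F1 a * F4 (b + c - a) * (F2 b + F3 c) / 4)"
    using nn by (intro sum_mono powr_three_quarters_le)
  also have "\<dots> = (\<Sum>a\<in>X. \<Sum>b\<in>X. \<Sum>c\<in>X. F2 b * F3 c * sqrt (F1 a * F4 (b + c - a))) / 2
      + ((\<Sum>a\<in>X. \<Sum>b\<in>X. \<Sum>c\<in>X. F1 a * F2 b * F4 ((b - a) + c)) / 4
      + (\<Sum>a\<in>X. \<Sum>b\<in>X. \<Sum>c\<in>X. F1 a * F3 c * F4 ((c - a) + b)) / 4)"
    by (simp add: sum.distrib sum_divide_distrib algebra_simps add_divide_distrib)
  also have "(\<Sum>a\<in>X. \<Sum>b\<in>X. \<Sum>c\<in>X. F1 a * F2 b * F4 ((b - a) + c)) \<le> 1"
  proof -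
    have "(\<Sum>a\<in>X. \<Sum>b\<in>X. \<Sum>c\<in>X. F1 a * F2 b * F4 ((b - a) + c)) \<le> (\<Sum>a\<in>X. \<Sum>b\<in>X. F1 a * F2 b * 1)"
      unfolding sum_distrib_left[symmetric] using nn by (intro sum_mono mult_left_mono s1) auto
    also have "\<dots> = (\<Sum>a\<in>X. F1 a) * (\<Sum>b\<in>X. F2 b)" by (simp add: sum_product)
    also have "\<dots> \<le> 1" using F123 nn by (intro mult_le_one sum_nonneg) auto
    finally show ?thesis .
  qed
  also have "(\<Sum>a\<in>X. \<Sum>b\<in>X. \<Sum>c\<in>X. F1 a * F3 c * F4 ((c - a) + b)) \<le> 1"
  proof -
    have "(\<Sum>a\<in>X. \<Sum>b\<in>X. \<Sum>c\<in>X. F1 a * F3 c * F4 ((c - a) + b))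
      = (\<Sum>a\<in>X. \<Sum>c\<in>X. \<Sum>b\<in>X. F1 a * F3 c * F4 ((c - a) + b))"
      by (intro sum.cong refl sum.swap)
    also have "\<dots> \<le> (\<Sum>a\<in>X. \<Sum>b\<in>X. F1 a * F3 b * 1)"
      unfolding sum_distrib_left[symmetric] using nn by (intro sum_mono mult_left_mono s1) auto
    also have "\<dots> = (\<Sum>a\<in>X. F1 a) * (\<Sum>b\<in>X. F3 b)" by (simp add: sum_product)
    also have "\<dots> \<le> 1" using F123 nn by (intro mult_le_one sum_nonneg) auto
    finally show ?thesis .
  qed
  also have "(\<Sum>a\<in>X. \<Sum>b\<in>X. \<Sum>c\<in>X. F2 b * F3 c * sqrt (F1 a * F4 (b + c - a)))
    = (\<Sum>b\<in>X. \<Sum>c\<in>X. F2 b * F3 c * (\<Sum>a\<in>X. sqrt (F1 a * F4 (b + c - a))))"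
    unfolding sum_distrib_left by (subst sum.swap) (intro sum.cong refl sum.swap)
  finally show ?thesis by simp
qed

text \<open>After normalizing the four masses, AM-GM bounds the affinity in
  \<open>young_affinity\<close> by 1. The version with four different masses is needed when several
  weights are restricted away from a point.\<close>

lemma young_parallelogram:
  fixes F1 F2 F3 F4 :: "int \<Rightarrow> real"
  assumes X: "finite X"
    and nn: "\<And>y. 0 \<le> F1 y" "\<And>y. 0 \<le> F2 y" "\<And>y. 0 \<le> F3 y" "\<And>y. 0 \<le> F4 y"
    and F4: "\<And>y. y \<notin> X \<Longrightarrow> F4 y = 0"
    and m: "(\<Sum>y\<in>X. F1 y) = m1" "(\<Sum>y\<in>X. F2 y) = m2" "(\<Sum>y\<in>X. F3 y) = m3" "(\<Sum>y\<in>X. F4 y) = m4"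
  shows "(\<Sum>a\<in>X. \<Sum>b\<in>X. \<Sum>c\<in>X. (F1 a * F2 b * F3 c * F4 (b + c - a)) powr (3 / 4))
    \<le> (m1 * m2 * m3 * m4) powr (3 / 4)"
proof -
  have scale: "F y = m * (F y / m)" if "(\<Sum>y\<in>X. F y) = m" "\<And>y. 0 \<le> F y" "y \<in> X \<or> F y = 0"
    for F :: "int \<Rightarrow> real" and m y
  proof (cases "m = 0")
    case True
    then have "\<forall>y\<in>X. F y = 0" using that X by (simp add: sum_nonneg_eq_0_iff)
    then show ?thesis using that by auto
  qed simp
  \<comment> \<open>Only \<open>\<le> 1\<close>: for mass zero, division by zero makes the
    normalized weight vanish, which covers the degenerate case.\<close>
  have unit: "(\<Sum>y\<in>X. F y / m) \<le> 1" if "(\<Sum>y\<in>X. F y) = m" for F :: "int \<Rightarrow> real" and m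
    using that by (simp flip: sum_divide_distrib)
  have m0: "0 \<le> m1" "0 \<le> m2" "0 \<le> m3" "0 \<le> m4"
    unfolding m[symmetric] using nn by (auto intro: sum_nonneg)
  define A where "A s = (\<Sum>a\<in>X. sqrt (F1 a / m1 * (F4 (s - a) / m4)))" for s
  have A1: "A s \<le> 1" for s
  proof -
    have "A s \<le> (\<Sum>a\<in>X. (F1 a / m1 + F4 (s - a) / m4) / 2)"
      unfolding A_def using nn m0 by (intro sum_mono arith_geo_mean_sqrt) auto
    also have "\<dots> = ((\<Sum>a\<in>X. F1 a / m1) + (\<Sum>a\<in>X. F4 (s - a) / m4)) / 2"
      by (simp add: sum.distrib add_divide_distrib sum_divide_distrib)
    also have "\<dots> \<le> (1 + 1) / 2"
      using sum_reflect_le[OF X, of "\<lambda>y. F4 y / m4" s] nn m0 F4 unit[OF m(1)] unit[OF m(4)]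
      by (intro divide_right_mono add_mono) auto
    finally show ?thesis by simp
  qed
  have "(\<Sum>a\<in>X. \<Sum>b\<in>X. \<Sum>c\<in>X. (F1 a * F2 b * F3 c * F4 (b + c - a)) powr (3 / 4))
    = (\<Sum>a\<in>X. \<Sum>b\<in>X. \<Sum>c\<in>X. (m1 * m2 * m3 * m4) powr (3 / 4) *
        (F1 a / m1 * (F2 b / m2) * (F3 c / m3) * (F4 (b + c - a) / m4)) powr (3 / 4))"
  proof (intro sum.cong refl)
    fix a b c assume abc: "a \<in> X" "b \<in> X" "c \<in> X"
    have "F1 a * F2 b * F3 c * F4 (b + c - a)
      = m1 * (F1 a / m1) * (m2 * (F2 b / m2)) * (m3 * (F3 c / m3)) * (m4 * (F4 (b + c - a) / m4))"
      using abc F4 by (intro arg_cong2[where f = times] scale m nn) auto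
    also have "\<dots> = (m1 * m2 * m3 * m4) * (F1 a / m1 * (F2 b / m2) * (F3 c / m3) * (F4 (b + c - a) / m4))"
      by (simp only: mult_ac)
    finally have e: "F1 a * F2 b * F3 c * F4 (b + c - a) = \<dots>" .
    show "(F1 a * F2 b * F3 c * F4 (b + c - a)) powr (3 / 4) = (m1 * m2 * m3 * m4) powr (3 / 4) *
        (F1 a / m1 * (F2 b / m2) * (F3 c / m3) * (F4 (b + c - a) / m4)) powr (3 / 4)"
      unfolding e by (rule powr_mult)
  qed
  also have "\<dots> = (m1 * m2 * m3 * m4) powr (3 / 4) * (\<Sum>a\<in>X. \<Sum>b\<in>X. \<Sum>c\<in>X.
        (F1 a / m1 * (F2 b / m2) * (F3 c / m3) * (F4 (b + c - a) / m4)) powr (3 / 4))"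
    by (simp only: sum_distrib_left)
  also have "\<dots> \<le> (m1 * m2 * m3 * m4) powr (3 / 4) * 1"
  proof (rule mult_left_mono)
    have "(\<Sum>a\<in>X. \<Sum>b\<in>X. \<Sum>c\<in>X.
        (F1 a / m1 * (F2 b / m2) * (F3 c / m3) * (F4 (b + c - a) / m4)) powr (3 / 4))
      \<le> (\<Sum>b\<in>X. \<Sum>c\<in>X. F2 b / m2 * (F3 c / m3) * A (b + c)) / 2 + 1 / 2"
      unfolding A_def using nn m0 F4 unit m by (intro young_affinity X) auto
    also have "(\<Sum>b\<in>X. \<Sum>c\<in>X. F2 b / m2 * (F3 c / m3) * A (b + c)) \<le> (\<Sum>b\<in>X. \<Sum>c\<in>X. F2 b / m2 * (F3 c / m3) * 1)"
      using nn m0 by (intro sum_mono mult_left_mono A1) auto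
    also have "\<dots> = (\<Sum>b\<in>X. F2 b / m2) * (\<Sum>c\<in>X. F3 c / m3)" by (simp only: mult_1_right sum_product)
    also have "\<dots> \<le> 1"
      using unit[OF m(2)] unit[OF m(3)] nn m0 by (intro mult_le_one sum_nonneg) auto
    finally show "(\<Sum>a\<in>X. \<Sum>b\<in>X. \<Sum>c\<in>X.
        (F1 a / m1 * (F2 b / m2) * (F3 c / m3) * (F4 (b + c - a) / m4)) powr (3 / 4)) \<le> 1"
      by simp
  qed simp
  finally show ?thesis by simp
qed

text \<open>The defect in AM-GM is half the squared difference of the roots \<open>x\<close> and
  \<open>y\<close>, and \<open>x + y \<le> 2\<close> turns this into a squared difference of
  \<open>\<alpha>\<close> and \<open>\<beta>\<close>.\<close>

lemma sqrt_mult_le_mean_minus: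
  fixes \<alpha> \<beta> :: real
  assumes "0 \<le> \<alpha>" "\<alpha> \<le> 1" "0 \<le> \<beta>" "\<beta> \<le> 1"
  shows "sqrt (\<alpha> * \<beta>) \<le> (\<alpha> + \<beta>) / 2 - (\<alpha> - \<beta>)\<^sup>2 / 8"
proof -
  define x where "x = sqrt \<alpha>"
  define y where "y = sqrt \<beta>"
  have xy: "0 \<le> x" "x \<le> 1" "0 \<le> y" "y \<le> 1" "\<alpha> = x\<^sup>2" "\<beta> = y\<^sup>2"
    using assms by (auto simp: x_def y_def)
  have "(\<alpha> - \<beta>)\<^sup>2 = (x - y)\<^sup>2 * (x + y)\<^sup>2"
    by (simp add: xy power2_eq_square algebra_simps)
  also have "\<dots> \<le> (x - y)\<^sup>2 * 2\<^sup>2"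
    using xy by (intro mult_left_mono power_mono) auto
  finally have "(\<alpha> - \<beta>)\<^sup>2 / 8 \<le> (x - y)\<^sup>2 / 2" by simp
  also have "(x - y)\<^sup>2 / 2 = (\<alpha> + \<beta>) / 2 - sqrt (\<alpha> * \<beta>)"
    using xy by (simp add: real_sqrt_mult power2_eq_square algebra_simps diff_divide_distrib add_divide_distrib)
  finally show ?thesis by linarith
qed

context
  fixes X :: "int set" and F :: "int \<Rightarrow> real"
  assumes X: "finite X" and F0: "\<And>y. 0 \<le> F y" and FX: "\<And>y. y \<notin> X \<Longrightarrow> F y = 0"
    and F1: "(\<Sum>y\<in>X. F y) = 1"
begin

lemma sum_sub_le_1: "(\<Sum>y\<in>{y\<in>X. P y}. F y) \<le> 1"
  using sum_mono2[of X "{y\<in>X. P y}" F] X F0 F1 by auto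

lemma sum_sub_compl: "(\<Sum>y\<in>{y\<in>X. \<not> P y}. F y) = 1 - (\<Sum>y\<in>{y\<in>X. P y}. F y)"
proof -
  have "(\<Sum>y\<in>X. F y) = (\<Sum>y\<in>{y\<in>X. P y} \<union> {y\<in>X. \<not> P y}. F y)"
    by (rule arg_cong2[where f = sum]) auto
  also have "\<dots> = (\<Sum>y\<in>{y\<in>X. P y}. F y) + (\<Sum>y\<in>{y\<in>X. \<not> P y}. F y)"
    using X by (intro sum.union_disjoint) auto
  finally show ?thesis using F1 by simp
qed

lemma affinity_part_le:
  assumes "\<And>a. a \<in> X \<Longrightarrow> P a \<Longrightarrow> Q (s - a)"
  shows "(\<Sum>a\<in>{a\<in>X. P a}. sqrt (F a * F (s - a)))
    \<le> sqrt ((\<Sum>a\<in>{a\<in>X. P a}. F a) * (\<Sum>a\<in>{a\<in>X. Q a}. F a))"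
proof (rule real_le_rsqrt)
  have "(\<Sum>a\<in>{a\<in>X. P a}. sqrt (F a * F (s - a)))\<^sup>2
    \<le> (\<Sum>a\<in>{a\<in>X. P a}. F a) * (\<Sum>a\<in>{a\<in>X. P a}. F (s - a))"
    using F0 by (intro sum_squared_le_of_squares_le) auto
  also have "(\<Sum>a\<in>{a\<in>X. P a}. F (s - a)) = (\<Sum>y\<in>(-) s ` {a\<in>X. P a}. F y)"
    by (subst sum.reindex) (auto simp: inj_on_def)
  also have "\<dots> = (\<Sum>y\<in>(-) s ` {a\<in>X. P a} \<inter> X. F y)"
    using X FX by (intro sum.mono_neutral_right) auto
  also have "\<dots> \<le> (\<Sum>y\<in>{a\<in>X. Q a}. F y)"
    using X F0 assms by (intro sum_mono2) auto
  finally show "(\<Sum>a\<in>{a\<in>X. P a}. sqrt (F a * F (s - a)))\<^sup>2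
    \<le> (\<Sum>a\<in>{a\<in>X. P a}. F a) * (\<Sum>a\<in>{a\<in>X. Q a}. F a)"
    using F0 by (simp add: mult_left_mono sum_nonneg)
qed

text \<open>The reflection sending \<open>a\<close> to \<open>b + c - a\<close> carries
  \<open>a \<le> b\<close> to values at least \<open>c\<close>, and the complement to the
  complement. Cauchy--Schwarz on both parts therefore compares the masses \<open>\<alpha>\<close>
  and \<open>\<beta>\<close>, and the quantitative AM-GM gains an eighth of the squared difference
  twice.\<close>

lemma reflection_affinity_le:
  "(\<Sum>a\<in>X. sqrt (F a * F (b + c - a)))
    \<le> 1 - ((\<Sum>a\<in>{a\<in>X. a \<le> b}. F a) - (\<Sum>a\<in>{a\<in>X. c \<le> a}. F a))\<^sup>2 / 4"
proof -
  define \<alpha> where "\<alpha> = (\<Sum>a\<in>{a\<in>X. a \<le> b}. F a)"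
  define \<beta> where "\<beta> = (\<Sum>a\<in>{a\<in>X. c \<le> a}. F a)"
  have b: "0 \<le> \<alpha>" "\<alpha> \<le> 1" "0 \<le> \<beta>" "\<beta> \<le> 1"
    unfolding \<alpha>_def \<beta>_def using F0 by (auto intro!: sum_nonneg sum_sub_le_1)
  have "(\<Sum>a\<in>X. sqrt (F a * F (b + c - a)))
    = (\<Sum>a\<in>{a\<in>X. a \<le> b} \<union> {a\<in>X. \<not> a \<le> b}. sqrt (F a * F (b + c - a)))"
    by (rule arg_cong2[where f = sum]) auto
  also have "\<dots> = (\<Sum>a\<in>{a\<in>X. a \<le> b}. sqrt (F a * F (b + c - a)))
      + (\<Sum>a\<in>{a\<in>X. \<not> a \<le> b}. sqrt (F a * F (b + c - a)))"
    using X by (intro sum.union_disjoint) auto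
  also have "\<dots> \<le> sqrt (\<alpha> * \<beta>) + sqrt ((1 - \<alpha>) * (1 - \<beta>))"
    unfolding \<alpha>_def \<beta>_def sum_sub_compl[symmetric] by (intro add_mono affinity_part_le) auto
  also have "\<dots> \<le> ((\<alpha> + \<beta>) / 2 - (\<alpha> - \<beta>)\<^sup>2 / 8)
      + ((1 - \<alpha> + (1 - \<beta>)) / 2 - ((1 - \<alpha>) - (1 - \<beta>))\<^sup>2 / 8)"
    using b by (intro add_mono sqrt_mult_le_mean_minus) auto
  also have "\<dots> = 1 - (\<alpha> - \<beta>)\<^sup>2 / 4"
    by (simp add: power2_eq_square field_simps)
  finally show ?thesis by (simp add: \<alpha>_def \<beta>_def)
qed

text \<open>The gain is \<open>V / 8\<close>, where \<open>V\<close> averages the squared difference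
  of the lower tail \<open>L b\<close> and the upper tail \<open>U c\<close> over independent
  \<open>b\<close> and \<open>c\<close>. The mean of \<open>U\<close> is at most
  \<open>1 - \<eta> / 2\<close>, whereas \<open>L\<close> is at least \<open>1 - \<eta> / 4\<close>
  on a set of mass at least \<open>\<eta> / 4\<close>; so \<open>V\<close> is at least the cube of
  \<open>\<eta> / 4\<close>.\<close>

lemma energy_spread:
  assumes \<eta>: "0 < \<eta>" "\<And>y. F y \<le> 1 - \<eta>"
  shows "(\<Sum>a\<in>X. \<Sum>b\<in>X. \<Sum>c\<in>X. (F a * F b * F c * F (b + c - a)) powr (3 / 4)) \<le> 1 - \<eta> ^ 3 / 512"
proof -
  define L where "L b = (\<Sum>a\<in>{a\<in>X. a \<le> b}. F a)" for b
  define U where "U c = (\<Sum>a\<in>{a\<in>X. c \<le> a}. F a)" for c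
  define \<mu> where "\<mu> = (\<Sum>c\<in>X. F c * U c)"
  define V where "V = (\<Sum>b\<in>X. \<Sum>c\<in>X. F b * F c * (L b - U c)\<^sup>2)"
  have "(\<Sum>a\<in>X. \<Sum>b\<in>X. \<Sum>c\<in>X. (F a * F b * F c * F (b + c - a)) powr (3 / 4))
    \<le> (\<Sum>b\<in>X. \<Sum>c\<in>X. F b * F c * (\<Sum>a\<in>X. sqrt (F a * F (b + c - a)))) / 2 + 1 / 2"
    using X F0 FX F1 by (intro young_affinity) auto
  also have "\<dots> \<le> (\<Sum>b\<in>X. \<Sum>c\<in>X. F b * F c * (1 - (L b - U c)\<^sup>2 / 4)) / 2 + 1 / 2"
    unfolding L_def U_def using F0
    by (intro add_right_mono divide_right_mono sum_mono mult_left_mono reflection_affinity_le) auto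
  also have "\<dots> = ((\<Sum>b\<in>X. F b) * (\<Sum>c\<in>X. F c) - V / 4) / 2 + 1 / 2"
    by (simp add: V_def sum_product right_diff_distrib sum_subtractf sum_divide_distrib)
  also have "\<dots> = 1 - V / 8" by (simp add: F1 field_simps)
  finally have E: "(\<Sum>a\<in>X. \<Sum>b\<in>X. \<Sum>c\<in>X. (F a * F b * F c * F (b + c - a)) powr (3 / 4)) \<le> 1 - V / 8" .
  \<comment> \<open>Jensen's inequality for the mean \<open>\<mu>\<close> of \<open>U\<close>: the
    square around \<open>\<mu>\<close> is expanded and the variance term dropped.\<close>
  have var: "(x - \<mu>)\<^sup>2 \<le> (\<Sum>c\<in>X. F c * (x - U c)\<^sup>2)" for x
  proof -
    have "(\<Sum>c\<in>X. F c * ((x - \<mu>)\<^sup>2 + 2 * (x - \<mu>) * (\<mu> - U c))) \<le> (\<Sum>c\<in>X. F c * (x - U c)\<^sup>2)"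
    proof (intro sum_mono mult_left_mono F0)
      fix c
      have "(x - U c)\<^sup>2 = (x - \<mu>)\<^sup>2 + 2 * (x - \<mu>) * (\<mu> - U c) + (\<mu> - U c)\<^sup>2"
        by (simp add: power2_eq_square algebra_simps)
      then show "(x - \<mu>)\<^sup>2 + 2 * (x - \<mu>) * (\<mu> - U c) \<le> (x - U c)\<^sup>2" by simp
    qed
    also have "(\<Sum>c\<in>X. F c * ((x - \<mu>)\<^sup>2 + 2 * (x - \<mu>) * (\<mu> - U c)))
      = (\<Sum>c\<in>X. F c) * (x - \<mu>)\<^sup>2 + 2 * (x - \<mu>) * ((\<Sum>c\<in>X. F c) * \<mu> - (\<Sum>c\<in>X. F c * U c))"
      by (simp add: sum_distrib_left sum_distrib_right sum.distrib sum_subtractf algebra_simps)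
    also have "\<dots> = (x - \<mu>)\<^sup>2" by (simp add: F1 \<mu>_def)
    finally show ?thesis .
  qed
  \<comment> \<open>Adding the sums over \<open>c \<le> a\<close> and \<open>a \<le> c\<close>
    counts the diagonal twice, so \<open>2 * \<mu>\<close> is 1 plus the sum of the squares of
    \<open>F\<close>, which is at most \<open>1 - \<eta>\<close>.\<close>
  have \<mu>: "\<mu> \<le> 1 - \<eta> / 2"
  proof -
    have \<mu>1: "\<mu> = (\<Sum>c\<in>X. \<Sum>a\<in>X. if c \<le> a then F c * F a else 0)"
      unfolding \<mu>_def U_def sum.inter_filter[OF X] sum_distrib_left by (intro sum.cong refl) auto
    have \<mu>2: "\<mu> = (\<Sum>c\<in>X. \<Sum>a\<in>X. if a \<le> c then F c * F a else 0)"
      unfolding \<mu>1 by (subst sum.swap) (intro sum.cong refl if_cong mult.commute)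
    have "2 * \<mu> = (\<Sum>c\<in>X. \<Sum>a\<in>X. (if c \<le> a then F c * F a else 0) + (if a \<le> c then F c * F a else 0))"
      unfolding sum.distrib \<mu>1[symmetric] \<mu>2[symmetric] by simp
    also have "\<dots> = (\<Sum>c\<in>X. \<Sum>a\<in>X. F c * F a + (if a = c then F c * F a else 0))"
      by (intro sum.cong refl) auto
    also have "\<dots> = (\<Sum>c\<in>X. F c) * (\<Sum>a\<in>X. F a) + (\<Sum>c\<in>X. F c * F c)"
      using X by (simp add: sum.distrib sum_product)
    also have "\<dots> \<le> 1 + (\<Sum>c\<in>X. F c * (1 - \<eta>))"
      unfolding F1 using F0 \<eta> by (simp add: sum_mono mult_left_mono)
    also have "\<dots> = 2 - \<eta>" by (simp add: F1 flip: sum_distrib_right)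
    finally show ?thesis by simp
  qed
  \<comment> \<open>All elements of \<open>B\<close> are at most its maximum \<open>m\<close>, so
    the mass of \<open>B\<close> is at most \<open>L m\<close>, which is below
    \<open>1 - \<eta> / 4\<close>.\<close>
  define B where "B = {b\<in>X. L b < 1 - \<eta> / 4}"
  have mB: "(\<Sum>b\<in>B. F b) \<le> 1 - \<eta> / 4"
  proof (cases "B = {}")
    case True
    have "X \<noteq> {}" using F1 by auto
    then obtain y where "y \<in> X" by auto
    then have "0 \<le> 1 - \<eta>" using F0[of y] \<eta>(2)[of y] by linarith
    then show ?thesis using True \<eta> by simp
  next
    case False
    define m where "m = Max B"
    have fB: "finite B" using X by (simp add: B_def)
    then have "m \<in> B" "\<And>b. b \<in> B \<Longrightarrow> b \<le> m" using False by (auto simp: m_def)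
    moreover have "B \<subseteq> X" by (auto simp: B_def)
    ultimately have "m \<in> B" "B \<subseteq> {a\<in>X. a \<le> m}" by auto
    then have "(\<Sum>b\<in>B. F b) \<le> L m" unfolding L_def using X F0 by (intro sum_mono2) auto
    also have "\<dots> \<le> 1 - \<eta> / 4" using \<open>m \<in> B\<close> by (simp add: B_def)
    finally show ?thesis .
  qed
  have "\<eta> / 4 * (\<eta> / 4)\<^sup>2 \<le> (\<Sum>b\<in>X - B. F b) * (\<eta> / 4)\<^sup>2"
  proof (rule mult_right_mono)
    have "(\<Sum>b\<in>X - B. F b) = (\<Sum>b\<in>X. F b) - (\<Sum>b\<in>B. F b)"
      using X by (intro sum_diff) (auto simp: B_def)
    then show "\<eta> / 4 \<le> (\<Sum>b\<in>X - B. F b)" using mB F1 by simp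
  qed simp
  also have "\<dots> \<le> (\<Sum>b\<in>X - B. F b * (L b - \<mu>)\<^sup>2)"
    unfolding sum_distrib_right
  proof (intro sum_mono mult_left_mono F0 power_mono)
    fix b assume "b \<in> X - B"
    then have "1 - \<eta> / 4 \<le> L b" by (auto simp: B_def)
    then show "\<eta> / 4 \<le> L b - \<mu>" using \<mu> by simp
  qed (use \<eta> in simp)
  also have "\<dots> \<le> (\<Sum>b\<in>X. F b * (L b - \<mu>)\<^sup>2)"
    using X F0 by (intro sum_mono2) auto
  also have "\<dots> \<le> (\<Sum>b\<in>X. F b * (\<Sum>c\<in>X. F c * (L b - U c)\<^sup>2))"
    by (intro sum_mono mult_left_mono var F0)
  also have "\<dots> = V" by (simp add: V_def sum_distrib_left mult_ac)
  finally have "\<eta> ^ 3 / 64 \<le> V" by (simp add: power2_eq_square power3_eq_cube)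
  then show ?thesis using E by simp
qed

text \<open>If three vertices of a parallelogram equal \<open>z\<close>, so does the fourth. Hence
  either all four are \<open>z\<close>, with contribution \<open>(1 - \<eta>) ^ 3\<close>, or one of
  the six pairs of vertices avoids \<open>z\<close>; Young's inequality with two masses
  \<open>\<eta>\<close> bounds each such case by \<open>\<eta> powr (3 / 2)\<close>.\<close>

lemma energy_concentrated:
  assumes z: "z \<in> X" and \<eta>: "F z = 1 - \<eta>"
  shows "(\<Sum>a\<in>X. \<Sum>b\<in>X. \<Sum>c\<in>X. (F a * F b * F c * F (b + c - a)) powr (3 / 4))
    \<le> (1 - \<eta>) ^ 3 + 6 * \<eta> powr (3 / 2)"
proof -
  define P where "P y = (if y = z then 0 else F y)" for y
  have P0: "0 \<le> P y" for y using F0 by (simp add: P_def)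
  have PX: "P y = 0" if "y \<notin> X" for y using FX that by (simp add: P_def)
  have P\<eta>: "(\<Sum>y\<in>X. P y) = \<eta>"
  proof -
    have "(\<Sum>y\<in>X. P y) = (\<Sum>y\<in>X - {z}. P y)"
      using z X by (simp add: sum.remove P_def)
    also have "\<dots> = (\<Sum>y\<in>X - {z}. F y)" by (intro sum.cong) (auto simp: P_def)
    also have "\<dots> = \<eta>" using z X F1 \<eta> by (simp add: sum_diff1)
    finally show ?thesis .
  qed
  have \<eta>0: "0 \<le> \<eta>" unfolding P\<eta>[symmetric] using P0 by (intro sum_nonneg) auto
  have \<eta>1: "\<eta> \<le> 1" using F0[of z] \<eta> by simp
  define T where "T F1 F2 F3 F4 = (\<Sum>a\<in>X. \<Sum>b\<in>X. \<Sum>c\<in>X. (F1 a * F2 b * F3 c * F4 (b + c - a)) powr (3 / 4))"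
    for F1 F2 F3 F4 :: "int \<Rightarrow> real"
  have \<eta>2: "(\<eta> * \<eta>) powr (3 / 4) = \<eta> powr (3 / 2)"
    using \<eta>0 by (simp add: powr_mult flip: powr_add)
  have T: "T P P F F \<le> \<eta> powr (3 / 2)" "T P F P F \<le> \<eta> powr (3 / 2)" "T P F F P \<le> \<eta> powr (3 / 2)"
    "T F P P F \<le> \<eta> powr (3 / 2)" "T F P F P \<le> \<eta> powr (3 / 2)" "T F F P P \<le> \<eta> powr (3 / 2)"
    unfolding T_def \<eta>2[symmetric]
    using young_parallelogram[OF X P0 P0 F0 F0 FX P\<eta> P\<eta> F1 F1]
      young_parallelogram[OF X P0 F0 P0 F0 FX P\<eta> F1 P\<eta> F1]
      young_parallelogram[OF X P0 F0 F0 P0 PX P\<eta> F1 F1 P\<eta>]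
      young_parallelogram[OF X F0 P0 P0 F0 FX F1 P\<eta> P\<eta> F1]
      young_parallelogram[OF X F0 P0 F0 P0 PX F1 P\<eta> F1 P\<eta>]
      young_parallelogram[OF X F0 F0 P0 P0 PX F1 F1 P\<eta> P\<eta>]
    by simp_all
  define W where "W = (\<lambda>x :: real. x powr (3 / 4))"
  have W0: "0 \<le> W x" for x by (simp add: W_def)
  have pt: "W (F a * F b * F c * F d) \<le> (if a = z then if b = z then if c = z then (1 - \<eta>) ^ 3 else 0 else 0 else 0)
      + W (P a * P b * F c * F d) + W (P a * F b * P c * F d) + W (P a * F b * F c * P d)
      + W (F a * P b * P c * F d) + W (F a * P b * F c * P d) + W (F a * F b * P c * P d)"
    if d: "d = b + c - a" for a b c d
  proof (cases "a = z \<and> b = z \<and> c = z")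
    case True
    have "W (F a * F b * F c * F d) = ((1 - \<eta>) ^ 4) powr (3 / 4)"
      using True d \<eta> by (simp add: W_def power4_eq_xxxx)
    also have "(1 - \<eta>) ^ 4 = (1 - \<eta>) powr 4" using \<eta>1 by (subst powr_numeral) auto
    also have "((1 - \<eta>) powr 4) powr (3 / 4) = (1 - \<eta>) powr 3" unfolding powr_powr by simp
    also have "\<dots> = (1 - \<eta>) ^ 3" using \<eta>1 by (subst powr_numeral) auto
    finally show ?thesis using True W0 by (simp add: add_nonneg_nonneg)
  next
    case False
    have *: "P y = F y" if "y \<noteq> z" for y using that by (simp add: P_def)
    consider "a \<noteq> z" "b \<noteq> z" | "a \<noteq> z" "c \<noteq> z" | "a \<noteq> z" "d \<noteq> z" | "b \<noteq> z" "c \<noteq> z"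
      | "b \<noteq> z" "d \<noteq> z" | "c \<noteq> z" "d \<noteq> z"
      using False d by fastforce
    then show ?thesis
      using False W0 by cases (simp_all add: * add_nonneg_nonneg add_increasing add_increasing2)
  qed
  have "T F F F F \<le> (\<Sum>a\<in>X. \<Sum>b\<in>X. \<Sum>c\<in>X. if a = z then if b = z then if c = z then (1 - \<eta>) ^ 3 else 0 else 0 else 0)
      + T P P F F + T P F P F + T P F F P + T F P P F + T F P F P + T F F P P"
    unfolding T_def sum.distrib[symmetric] W_def[symmetric]
    unfolding W_def by (intro sum_mono pt[unfolded W_def] refl)
  also have "(\<Sum>a\<in>X. \<Sum>b\<in>X. \<Sum>c\<in>X. if a = z then if b = z then if c = z then (1 - \<eta>) ^ 3 else 0 else 0 else 0)
    = (1 - \<eta>) ^ 3"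
  proof -
    have "(\<Sum>c\<in>X. if a = z then if b = z then if c = z then (1 - \<eta>) ^ 3 else 0 else 0 else 0)
      = (if a = z then if b = z then (1 - \<eta>) ^ 3 else 0 else 0)" for a b
      using X z by simp
    moreover have "(\<Sum>b\<in>X. if a = z then if b = z then (1 - \<eta>) ^ 3 else 0 else 0)
      = (if a = z then (1 - \<eta>) ^ 3 else 0)" for a
      using X z by simp
    ultimately show ?thesis using X z by simp
  qed
  finally show ?thesis using T by (simp add: T_def)
qed

end

text \<open>The power mean inequality, by summing the tangent line to \<open>y powr r\<close> at the
  mean \<open>m\<close>; the tangent bound is Young's inequality for two numbers.\<close>

lemma powr_sum_le_card_powr:
  fixes F :: "'a \<Rightarrow> real"
  assumes X: "finite X" "X \<noteq> {}" and F: "\<And>y. y \<in> X \<Longrightarrow> 0 \<le> F y" and r: "r \<ge> 1"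
  shows "(\<Sum>y\<in>X. F y) powr r \<le> real (card X) powr (r - 1) * (\<Sum>y\<in>X. F y powr r)"
proof -
  define n where "n = real (card X)"
  define m where "m = (\<Sum>y\<in>X. F y) / n"
  have n: "n > 0" using X by (simp add: n_def card_gt_0_iff)
  have m0: "m \<ge> 0" unfolding m_def using F n by (intro divide_nonneg_nonneg sum_nonneg) auto
  have S: "(\<Sum>y\<in>X. F y) = n * m" using n by (simp add: m_def)
  have tangent: "r * (m powr (r - 1) * y) - (r - 1) * m powr r \<le> y powr r" if "y \<ge> 0" for y
  proof (cases "m = 0")
    case True
    then show ?thesis by simp
  next
    case False
    then have mp: "m > 0" using m0 by simp
    show ?thesis
    proof (cases "y = 0")
      case False
      then have yp: "y > 0" using that by simp
    have "(y powr r) powr (1 / r) * (m powr r) powr (1 - 1 / r) \<le> 1 / r * y powr r + (1 - 1 / r) * m powr r"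
      using r yp mp by (intro Youngs_inequality_0) auto
    also have "(y powr r) powr (1 / r) = y" using that r by (simp add: powr_powr)
    also have "(m powr r) powr (1 - 1 / r) = m powr (r - 1)" using r by (simp add: powr_powr algebra_simps)
    finally have "r * (y * m powr (r - 1)) \<le> r * (1 / r * y powr r + (1 - 1 / r) * m powr r)"
      using r by (intro mult_left_mono) auto
    then show ?thesis using r by (simp add: algebra_simps)
    qed (use r in simp)
  qed
  have "n * m powr r = r * (m powr (r - 1) * (n * m)) - n * ((r - 1) * m powr r)"
  proof -
    have "m powr (r - 1) * m = m powr r"
      using m0 by (cases "m = 0") (auto simp: powr_diff)
    then have "r * (m powr (r - 1) * (n * m)) = r * n * m powr r" by (metis mult.assoc mult.commute)
    then show ?thesis by (simp only:) (simp add: algebra_simps)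
  qed
  also have "\<dots> = (\<Sum>y\<in>X. r * (m powr (r - 1) * F y) - (r - 1) * m powr r)"
    by (simp add: sum_subtractf n_def S[symmetric, unfolded n_def] sum_distrib_left)
  also have "\<dots> \<le> (\<Sum>y\<in>X. F y powr r)"
    using F by (intro sum_mono tangent) auto
  finally have "n powr (r - 1) * (n * m powr r) \<le> n powr (r - 1) * (\<Sum>y\<in>X. F y powr r)"
    by (intro mult_left_mono) auto
  moreover have "n powr (r - 1) * (n * m powr r) = (n * m) powr r"
    using n m0 by (simp add: powr_mult powr_diff)
  ultimately show ?thesis by (simp add: S n_def)
qed

text \<open>
  The gain \<open>\<eta> ^ 3 / 512\<close> of \<open>energy_spread\<close> at \<open>\<eta> = 1 / 22 ^ 4\<close>; for smaller \<open>\<eta>\<close> the bound of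
  \<open>energy_concentrated\<close> suffices.
\<close>

definition c_energy :: real where "c_energy = (1 / 22 ^ 4) ^ 3 / 512"

lemma c_energy_bounds: "0 < c_energy" "c_energy \<le> 1 / 4"
proof -
  have "(1 / 22 ^ 4 :: real) ^ 3 \<le> 1" by (intro power_le_one) auto
  then show "c_energy \<le> 1 / 4" by (simp add: c_energy_def)
qed (simp add: c_energy_def)

text \<open>Passing from exponent 1 to \<open>r = 3 / t\<close> costs at most
  \<open>real n powr (3 - t) = 2 powr c_energy\<close>. For spread weights the gain
  \<open>1 - c_energy\<close> absorbs this. For a nearly point-like weight the right side gains the
  remainder \<open>B\<close>, of order at least \<open>\<eta> powr (5 / 4)\<close>, against an error
  of order \<open>\<eta> powr (3 / 2)\<close>.\<close>

lemma energy_prob_ineq: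
  fixes F :: "int \<Rightarrow> real" and n :: nat
  assumes n: "n \<ge> 2" and F0: "\<And>y. 0 \<le> F y" and FX: "\<And>y. y \<notin> {0..<int n} \<Longrightarrow> F y = 0"
    and F1: "(\<Sum>y\<in>{0..<int n}. F y) = 1"
  defines "t \<equiv> 3 - c_energy / log 2 n"
  shows "(\<Sum>a\<in>{0..<int n}. \<Sum>b\<in>{0..<int n}. \<Sum>c\<in>{0..<int n}. (F a * F b * F c * F (b + c - a)) powr (3 / 4))
    \<le> (\<Sum>y\<in>{0..<int n}. F y powr (3 / t)) powr t"
proof -
  define X where "X = {0..<int n}"
  have X: "finite X" "card X = n" "X \<noteq> {}" using n by (auto simp: X_def)
  define l where "l = log 2 n"
  have l: "l \<ge> 1" using n by (simp add: l_def le_log_iff)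
  have "c_energy / l \<le> c_energy" using l c_energy_bounds by (simp add: divide_le_eq)
  then have t: "11 / 4 \<le> t" "t < 3" "3 - t = c_energy / l"
    using c_energy_bounds l by (auto simp: t_def l_def)
  define r where "r = 3 / t"
  have r: "1 \<le> r" "r \<le> 5 / 4" "(r - 1) * t = 3 - t"
    using t by (auto simp: r_def field_simps)
  have npow: "real n powr (3 - t) = 2 powr c_energy"
  proof -
    have "real n = 2 powr l" using n by (simp add: l_def)
    then show ?thesis using l by (simp add: powr_powr t(3))
  qed
  define S where "S = (\<Sum>y\<in>X. F y powr r)"
  define E where "E = (\<Sum>a\<in>X. \<Sum>b\<in>X. \<Sum>c\<in>X. (F a * F b * F c * F (b + c - a)) powr (3 / 4))"
  note ctx = X(1) F0 FX[folded X_def] F1[folded X_def]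
  define \<eta>0 :: real where "\<eta>0 = 1 / 22 ^ 4"
  have "E \<le> S powr t"
  proof (cases "\<forall>y. F y \<le> 1 - \<eta>0")
    case True
    have "E \<le> 1 - \<eta>0 ^ 3 / 512"
      unfolding E_def using True by (intro energy_spread ctx) (auto simp: \<eta>0_def)
    also have "\<dots> = 1 + (- c_energy)" by (simp add: c_energy_def \<eta>0_def)
    also have "\<dots> \<le> exp (- c_energy)" by (rule exp_ge_add_one_self)
    also have "\<dots> \<le> exp (- (c_energy * ln 2))"
      using c_energy_bounds ln_2_less_1 by (simp add: mult_le_cancel_left1)
    also have "\<dots> = (real n powr (3 - t)) powr (- 1)" unfolding npow by (simp add: powr_def mult.commute)
    also have "\<dots> = (real n powr (1 - r)) powr t"
      unfolding powr_powr r(3)[symmetric] by (simp add: algebra_simps)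
    also have "\<dots> \<le> S powr t"
    proof (rule powr_mono2)
      have "1 \<le> real n powr (r - 1) * S"
        using powr_sum_le_card_powr[OF X(1,3), of F r] F0 r F1 by (simp add: S_def X(2) X_def)
      then have "real n powr (1 - r) * 1 \<le> real n powr (1 - r) * (real n powr (r - 1) * S)"
        by (intro mult_left_mono) auto
      also have "\<dots> = S" using n by (simp flip: mult.assoc powr_add)
      finally show "real n powr (1 - r) \<le> S" by simp
    qed (use t in auto)
    finally show ?thesis .
  next
    case False
    then obtain z where z: "1 - \<eta>0 < F z" by (auto simp: not_le)
    then have zX: "z \<in> X" using FX[of z] by (auto simp: X_def \<eta>0_def)
    define \<eta> where "\<eta> = 1 - F z"
    have z\<eta>: "F z = 1 - \<eta>" by (simp add: \<eta>_def)
    have rest: "(\<Sum>y\<in>X - {z}. F y) = \<eta>"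
      using F1 zX X by (simp add: \<eta>_def X_def sum_diff1)
    have \<eta>: "0 \<le> \<eta>" "\<eta> \<le> \<eta>0" "\<eta> \<le> 1"
      using z F0 sum_nonneg[of "X - {z}" F] rest by (auto simp: \<eta>_def \<eta>0_def)
    define B where "B = (\<Sum>y\<in>X - {z}. F y powr r)"
    define A where "A = (1 - \<eta>) powr r"
    have SAB: "S = A + B"
      unfolding S_def A_def B_def using X zX z\<eta> by (simp add: sum.remove)
    have B0: "0 \<le> B" unfolding B_def by (intro sum_nonneg) auto
    \<comment> \<open>The power mean inequality over the points other than \<open>z\<close> loses at
      most a factor 2, because of \<open>npow\<close>.\<close>
    have Bge: "\<eta> powr (5 / 4) / 2 \<le> B"
    proof (cases "\<eta> = 0")
      case False
      have ne: "X - {z} \<noteq> {}" using rest False by (metis sum.empty)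
      have "\<eta> powr r \<le> real (card (X - {z})) powr (r - 1) * B"
        unfolding B_def rest[symmetric] using X F0 r ne by (intro powr_sum_le_card_powr) auto
      also have "\<dots> \<le> real n powr (r - 1) * B"
        using X zX r B0 by (intro mult_right_mono powr_mono2) auto
      also have "real n powr (r - 1) = (real n powr (3 - t)) powr (1 / t)"
      proof -
        have "(3 - t) * (1 / t) = (r - 1) * t * (1 / t)" unfolding r(3) ..
        also have "\<dots> = r - 1" using t(1) by simp
        finally have "r - 1 = (3 - t) * (1 / t)" by (rule sym)
        then show ?thesis unfolding powr_powr by (rule arg_cong)
      qed
      also have "\<dots> = 2 powr (c_energy / t)" unfolding npow by (simp add: powr_powr)
      also have "\<dots> \<le> 2 powr 1"
        using t c_energy_bounds by (intro powr_mono) (auto simp: field_simps)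
      finally have "\<eta> powr r \<le> 2 * B" using B0 by (simp add: mult_right_mono)
      moreover have "\<eta> powr (5 / 4) \<le> \<eta> powr r"
        using \<eta> r False by (intro powr_mono') auto
      ultimately show ?thesis by simp
    qed (use B0 in simp)
    \<comment> \<open>This determines the size of \<open>\<eta>0\<close>: the factor
      \<open>\<eta> powr (1 / 4)\<close> is at most \<open>1 / 22\<close>, and \<open>6 / 22\<close>
      is below \<open>1 / 2\<close>.\<close>
    have "6 * \<eta> powr (3 / 2) \<le> \<eta> powr (5 / 4) / 2"
    proof -
      have "\<eta> powr (1 / 4) \<le> \<eta>0 powr (1 / 4)" using \<eta> by (intro powr_mono2) auto
      also have "\<eta>0 = (1 / 22) powr 4" by (simp add: \<eta>0_def power_divide)
      also have "\<dots> powr (1 / 4) = 1 / 22" by (simp only: powr_powr) simp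
      finally have "\<eta> powr (5 / 4) * \<eta> powr (1 / 4) \<le> \<eta> powr (5 / 4) * (1 / 22)"
        by (intro mult_left_mono) auto
      then have "\<eta> powr (3 / 2) * 22 \<le> \<eta> powr (5 / 4)" by (simp flip: powr_add)
      then show ?thesis using powr_ge_zero[of \<eta> "3 / 2"] by linarith
    qed
    then have "E \<le> (1 - \<eta>) ^ 3 + B"
      using energy_concentrated[OF ctx zX z\<eta>] Bge by (simp add: E_def)
    also have "\<dots> \<le> (A + B) powr t"
    proof -
      have \<eta>s: "1 - \<eta> > 0" using \<eta> by (simp add: \<eta>0_def)
      then have A: "A > 0" "A powr t = (1 - \<eta>) ^ 3"
        using t by (auto simp: A_def powr_powr r_def powr_numeral)
      \<comment> \<open>Bernoulli's inequality, derived from Young's with weights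
        \<open>1 / t\<close> and \<open>1 - 1 / t\<close>. As \<open>t\<close> is close to 3 and
        \<open>\<eta>\<close> tiny, the linear gain exceeds \<open>B\<close>.\<close>
      have "1 + t * (B / A) \<le> (1 + B / A) powr t"
      proof -
        have "0 < 1 + B / A" using B0 A by (simp add: add_pos_nonneg)
        then
        have "(1 + B / A) * 1 \<le> ((1 + B / A) powr t) * (1 / t) + 1 * (1 - 1 / t)"
          using Youngs_inequality_0[of "1 / t" "1 - 1 / t" "(1 + B / A) powr t" 1] t B0 A
          by (simp add: powr_powr mult.commute add_nonneg_nonneg)
        then have "t * ((1 + B / A) * 1) \<le> t * (((1 + B / A) powr t) * (1 / t) + 1 * (1 - 1 / t))"
          using t by (intro mult_left_mono) auto
        also have "\<dots> = (1 + B / A) powr t + t - 1" using t by (simp add: algebra_simps)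
        finally show ?thesis by (simp add: algebra_simps)
      qed
      then have "(1 - \<eta>) ^ 3 * (1 + t * (B / A)) \<le> A powr t * (1 + B / A) powr t"
        unfolding A(2) using \<eta>s by (intro mult_left_mono) auto
      also have "\<dots> = (A * (1 + B / A)) powr t" by (rule powr_mult[symmetric])
      also have "A * (1 + B / A) = A + B" using A by (simp add: field_simps)
      also have "(1 - \<eta>) ^ 3 + B \<le> (1 - \<eta>) ^ 3 * (1 + t * (B / A))"
      proof -
        have "A \<le> 1" unfolding A_def using \<eta> r by (intro powr_le1) auto
        then have "B \<le> B / A" using A B0 by (simp add: le_divide_eq mult_left_le)
        moreover have "1 \<le> (1 - \<eta>) ^ 3 * t"
        proof -
          have "(1 - 1 / 22 ^ 4) ^ 3 \<le> (1 - \<eta>) ^ 3" using \<eta> by (intro power_mono) (auto simp: \<eta>0_def)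
          then have "(1 - 1 / 22 ^ 4) ^ 3 * (11 / 4) \<le> (1 - \<eta>) ^ 3 * t"
            using t \<eta>s by (intro mult_mono) auto
          moreover have "(1::real) \<le> (1 - 1 / 22 ^ 4) ^ 3 * (11 / 4)" by (simp add: power3_eq_cube)
          ultimately show ?thesis by linarith
        qed
        then have "1 * (B / A) \<le> (1 - \<eta>) ^ 3 * t * (B / A)"
          using A B0 by (intro mult_right_mono) auto
        ultimately show ?thesis by (simp add: algebra_simps)
      qed
      finally show ?thesis .
    qed
    finally show ?thesis unfolding SAB .
  qed
  then show ?thesis by (simp add: E_def S_def X_def r_def)
qed

text \<open>By homogeneity it suffices to treat the probability weight
  \<open>f powr (4 / 3) / M\<close>; \<open>4 / 3\<close> is the exponent of Young's inequality,
  which corresponds to \<open>t = 3\<close>.\<close>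

lemma interval_ineq_energy:
  assumes n: "n \<ge> 2"
  shows "interval_ineq 2 1 n (3 - c_energy / log 2 n)"
  unfolding interval_ineq_def
proof (intro allI impI)
  fix f :: "int \<Rightarrow> real"
  assume f: "\<forall>x. 0 \<le> f x" "\<forall>x. x \<notin> {0..<int n} \<longrightarrow> f x = 0"
  define t where "t = 3 - c_energy / log 2 n"
  define X where "X = {0..<int n}"
  have "log 2 n \<ge> 1" using n by (simp add: le_log_iff)
  then have "c_energy / log 2 n \<le> c_energy" using c_energy_bounds by (simp add: divide_le_eq)
  then have t: "t > 0" using c_energy_bounds by (simp add: t_def)
  define M where "M = (\<Sum>y\<in>X. f y powr (4 / 3))"
  have M0: "M \<ge> 0" unfolding M_def by (intro sum_nonneg) auto
  have form: "interval_form n 1 2 (\<lambda>_ _. f) = (\<Sum>a\<in>X. \<Sum>b\<in>X. \<Sum>c\<in>X. f a * f b * f c * f (b + c - a))"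
    unfolding X_def using f by (intro interval_form_parallelogram) auto
  have goal: "(\<Sum>a\<in>X. \<Sum>b\<in>X. \<Sum>c\<in>X. f a * f b * f c * f (b + c - a)) \<le> (\<Sum>y\<in>X. f y powr (4 / t)) powr t"
  proof (cases "M = 0")
    case True
    then have "\<forall>y\<in>X. f y powr (4 / 3) = 0" by (simp add: M_def X_def sum_nonneg_eq_0_iff)
    then have "\<forall>y\<in>X. f y = 0" by simp
    then show ?thesis by simp
  next
    case False
    then have M: "M > 0" using M0 by simp
    define F where "F y = f y powr (4 / 3) / M" for y
    have Ff: "f y = M powr (3 / 4) * F y powr (3 / 4)" for y
    proof -
      have "M powr (3 / 4) * F y powr (3 / 4) = (f y powr (4 / 3)) powr (3 / 4)"
        using M by (simp add: F_def flip: powr_mult)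
      also have "\<dots> = f y" using f by (simp add: powr_powr)
      finally show ?thesis by simp
    qed
    have M3: "M powr (3 / 4) * M powr (3 / 4) * M powr (3 / 4) * M powr (3 / 4) = M powr 3"
      using M by (simp flip: powr_add)
    have "(\<Sum>a\<in>X. \<Sum>b\<in>X. \<Sum>c\<in>X. f a * f b * f c * f (b + c - a))
      = (\<Sum>a\<in>X. \<Sum>b\<in>X. \<Sum>c\<in>X. M powr 3 * (F a * F b * F c * F (b + c - a)) powr (3 / 4))"
      unfolding Ff M3[symmetric] powr_mult by (simp only: mult_ac)
    also have "\<dots> = M powr 3 * (\<Sum>a\<in>X. \<Sum>b\<in>X. \<Sum>c\<in>X. (F a * F b * F c * F (b + c - a)) powr (3 / 4))"
      by (simp only: sum_distrib_left)
    also have "\<dots> \<le> M powr 3 * (\<Sum>y\<in>X. F y powr (3 / t)) powr t"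
    proof (rule mult_left_mono)
      have "(\<Sum>y\<in>X. F y) = 1" using M by (simp add: F_def M_def flip: sum_divide_distrib)
      then show "(\<Sum>a\<in>X. \<Sum>b\<in>X. \<Sum>c\<in>X. (F a * F b * F c * F (b + c - a)) powr (3 / 4))
        \<le> (\<Sum>y\<in>X. F y powr (3 / t)) powr t"
        unfolding t_def X_def using f M by (intro energy_prob_ineq n) (auto simp: F_def)
    qed simp
    also have "\<dots> = (\<Sum>y\<in>X. M powr (3 / t) * F y powr (3 / t)) powr t"
      using M t by (simp add: powr_mult powr_powr flip: sum_distrib_left)
    also have "(\<Sum>y\<in>X. M powr (3 / t) * F y powr (3 / t)) = (\<Sum>y\<in>X. f y powr (4 / t))"
    proof (rule sum.cong[OF refl])
      fix y
      have "M powr (3 / t) * F y powr (3 / t) = (f y powr (4 / 3)) powr (3 / t)"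
        using M by (simp add: F_def flip: powr_mult)
      then show "M powr (3 / t) * F y powr (3 / t) = f y powr (4 / t)" by (simp add: powr_powr)
    qed
    finally show ?thesis .
  qed
  then show "interval_form n 1 2 (\<lambda>_ _. f)
    \<le> (\<Sum>y\<in>{0..<int n}. f y powr (real (1 * 2\<^sup>2) / (3 - c_energy / log 2 n))) powr (3 - c_energy / log 2 n)"
    unfolding form by (simp add: X_def t_def)
qed

theorem t_admissible_upper:
  assumes d: "d \<ge> 2" and p: "p \<ge> 1" and n: "n \<ge> 2"
  shows "t_admissible d p n (real d + real p - c_energy / log 2 n)"
proof -
  have "log 2 n \<ge> 1" using n by (simp add: le_log_iff)
  then have "c_energy / log 2 n \<le> c_energy" using c_energy_bounds by (simp add: divide_le_eq)
  then have "t_admissible 2 1 n (3 - c_energy / log 2 n)"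
    using c_energy_bounds n by (intro t_admissible_of_interval_ineq interval_ineq_energy) auto
  from t_admissible_of_additive_energy[OF d p this] show ?thesis by (simp add: algebra_simps)
qed

section \<open>Gaussian test functions\<close>
definition gauss_integral :: "real \<Rightarrow> real" where
  "gauss_integral x = integral {0..x} (\<lambda>z. exp (- z\<^sup>2))"

lemma gauss_integral_diff:
  assumes "0 \<le> x" "x \<le> y"
  shows "(y - x) * exp (- y\<^sup>2) \<le> gauss_integral y - gauss_integral x"
    and "gauss_integral y - gauss_integral x \<le> (y - x) * exp (- x\<^sup>2)"
proof -
  have int: "(\<lambda>z. exp (- z\<^sup>2)) integrable_on {u..v}" for u v :: real
    by (intro integrable_continuous_interval continuous_intros)
  have "gauss_integral y - gauss_integral x = integral {x..y} (\<lambda>z. exp (- z\<^sup>2))"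
    using Henstock_Kurzweil_Integration.integral_combine[of 0 x y "\<lambda>z. exp (- z\<^sup>2)"] assms int
    by (simp add: gauss_integral_def)
  moreover have "integral {x..y} (\<lambda>_. exp (- y\<^sup>2)) \<le> integral {x..y} (\<lambda>z. exp (- z\<^sup>2))"
    using assms by (intro integral_le int) (auto intro!: power_mono)
  moreover have "integral {x..y} (\<lambda>z. exp (- z\<^sup>2)) \<le> integral {x..y} (\<lambda>_. exp (- x\<^sup>2))"
    using assms by (intro integral_le int) (auto intro!: power_mono)
  ultimately show "(y - x) * exp (- y\<^sup>2) \<le> gauss_integral y - gauss_integral x"
    "gauss_integral y - gauss_integral x \<le> (y - x) * exp (- x\<^sup>2)"
    using assms by simp_all
qed

lemma gauss_integral_0 [simp]: "gauss_integral 0 = 0"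
  by (simp add: gauss_integral_def)

lemma gauss_integral_mono:
  assumes "0 \<le> x" "x \<le> y"
  shows "gauss_integral x \<le> gauss_integral y"
proof -
  have "0 \<le> (y - x) * exp (- y\<^sup>2)" using assms by simp
  also note gauss_integral_diff(1)[OF assms]
  finally show ?thesis by simp
qed

lemma gauss_integral_le_self: "0 \<le> x \<Longrightarrow> gauss_integral x \<le> x"
  using gauss_integral_diff(2)[of 0 x] by simp

lemma gauss_integral_le_arctan:
  assumes "0 \<le> x"
  shows "gauss_integral x \<le> arctan x"
proof -
  have "((\<lambda>z. 1 / (1 + z\<^sup>2)) has_integral (arctan x - arctan 0)) {0..x}"
    using assms
    by (intro fundamental_theorem_of_calculus)
      (auto intro!: derivative_eq_intros simp: has_real_derivative_iff_has_vector_derivative[symmetric]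
        inverse_eq_divide)
  then have i: "(\<lambda>z. 1 / (1 + z\<^sup>2)) integrable_on {0..x}" "integral {0..x} (\<lambda>z. 1 / (1 + z\<^sup>2)) = arctan x"
    by (auto simp: has_integral_iff)
  have le: "exp (- z\<^sup>2) \<le> 1 / (1 + z\<^sup>2)" for z :: real
  proof -
    have "1 + z\<^sup>2 \<le> exp (z\<^sup>2)" by (rule exp_ge_add_one_self)
    moreover have "0 < 1 + z\<^sup>2" by (simp add: add_pos_nonneg)
    ultimately have "inverse (exp (z\<^sup>2)) \<le> inverse (1 + z\<^sup>2)" by (rule le_imp_inverse_le)
    then show ?thesis by (simp add: exp_minus inverse_eq_divide)
  qed
  have "gauss_integral x \<le> integral {0..x} (\<lambda>z. 1 / (1 + z\<^sup>2))"
    unfolding gauss_integral_def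
    by (intro integral_le i(1) le integrable_continuous_interval continuous_intros)
  then show ?thesis using i by simp
qed

text \<open>Existence and positivity of the limit are enough: in the comparison for the lower bound,
  \<open>G\<close> occurs to the power \<open>d + p\<close> on both sides and cancels.\<close>

lemma gauss_integral_limit:
  obtains G where "G > 0" "(gauss_integral \<longlongrightarrow> G) at_top" "\<And>x. 0 \<le> x \<Longrightarrow> gauss_integral x \<le> G"
proof -
  define G where "G = (SUP x\<in>{0..}. gauss_integral x)"
  have bdd: "bdd_above (gauss_integral ` {0..})"
  proof (rule bdd_aboveI2)
    fix x :: real assume "x \<in> {0..}"
    then have "gauss_integral x \<le> arctan x" by (intro gauss_integral_le_arctan) auto
    also have "\<dots> \<le> pi / 2" using arctan_ubound[of x] by simp
    finally show "gauss_integral x \<le> pi / 2" .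
  qed
  have up: "gauss_integral x \<le> G" if "0 \<le> x" for x
    unfolding G_def using that bdd by (intro cSUP_upper) auto
  have "0 < 1 * exp (- 1 :: real)" by simp
  also have "\<dots> \<le> gauss_integral 1" using gauss_integral_diff(1)[of 0 1] by simp
  also have "\<dots> \<le> G" by (rule up) simp
  finally have "G > 0" .
  moreover have "(gauss_integral \<longlongrightarrow> G) at_top"
  proof (rule order_tendstoI)
    fix y assume "y < G"
    then obtain x where x: "0 \<le> x" "y < gauss_integral x"
      unfolding G_def using bdd by (subst (asm) less_cSUP_iff) auto
    show "\<forall>\<^sub>F z in at_top. y < gauss_integral z"
      using eventually_ge_at_top[of x] by eventually_elim (use x gauss_integral_mono in force)
  next
    fix y assume "G < y"
    show "\<forall>\<^sub>F z in at_top. gauss_integral z < y"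
      using eventually_ge_at_top[of 0] by eventually_elim (use up \<open>G < y\<close> in force)
  qed
  ultimately show ?thesis using up that by blast
qed

text \<open>To the right of \<open>\<theta>\<close> the Gaussian decreases, so each step of the
  integral is at most \<open>\<beta>\<close> times the value at its left end, and the steps
  telescope. The lost \<open>\<beta>\<close> covers the gap between \<open>\<theta>\<close> and the
  first integer \<open>k\<close>.\<close>

lemma half_gauss_sum_lower:
  fixes \<beta> \<theta> W :: real and k :: int
  assumes \<beta>: "\<beta> > 0" and k: "0 \<le> k - \<theta>" "k - \<theta> \<le> 1" and W: "0 \<le> W"
  shows "(gauss_integral (\<beta> * W) - \<beta>) / \<beta> \<le> (\<Sum>x\<in>{k..\<lfloor>\<theta> + W\<rfloor>}. exp (- (\<beta> * (x - \<theta>))\<^sup>2))"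
proof -
  define K where "K = \<lfloor>\<theta> + W\<rfloor>"
  have K: "\<theta> + W < K + 1" unfolding K_def by linarith
  have tel: "(gauss_integral (\<beta> * (k + real m - \<theta>)) - gauss_integral (\<beta> * (k - \<theta>))) / \<beta>
    \<le> (\<Sum>x\<in>{k..<k + int m}. exp (- (\<beta> * (x - \<theta>))\<^sup>2))" for m
  proof (induction m)
    case (Suc m)
    have "(gauss_integral (\<beta> * (k + real m + 1 - \<theta>)) - gauss_integral (\<beta> * (k + real m - \<theta>)))
      \<le> (\<beta> * (k + real m + 1 - \<theta>) - \<beta> * (k + real m - \<theta>)) * exp (- (\<beta> * (k + real m - \<theta>))\<^sup>2)"
      using \<beta> k by (intro gauss_integral_diff(2) mult_nonneg_nonneg mult_left_mono) auto
    also have "\<beta> * (k + real m + 1 - \<theta>) - \<beta> * (k + real m - \<theta>) = \<beta>" by (simp add: algebra_simps)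
    finally have "(gauss_integral (\<beta> * (k + real m + 1 - \<theta>)) - gauss_integral (\<beta> * (k + real m - \<theta>)))
      \<le> \<beta> * exp (- (\<beta> * (k + real m - \<theta>))\<^sup>2)" .
    then have "(gauss_integral (\<beta> * (k + real m + 1 - \<theta>)) - gauss_integral (\<beta> * (k + real m - \<theta>))) / \<beta>
      \<le> exp (- (\<beta> * (k + real m - \<theta>))\<^sup>2)"
      using \<beta> by (simp add: divide_le_eq mult.commute)
    moreover have "{k..<k + int (Suc m)} = insert (k + int m) {k..<k + int m}" by auto
    ultimately show ?case using Suc by (simp add: diff_divide_distrib add_ac)
  qed simp
  define m where "m = nat (K + 1 - k)"
  have m: "real m \<ge> K + 1 - k" "k + int m = K + 1 \<or> K + 1 < k" by (auto simp: m_def)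
  have kK: "\<not> K + 1 < k"
  proof
    assume "K + 1 < k"
    then have "real_of_int K + 2 \<le> k" by linarith
    then show False using K k W by linarith
  qed
  then have iv: "{k..<k + int m} = {k..K}" using m by auto
  have "gauss_integral (\<beta> * W) \<le> gauss_integral (\<beta> * (k + real m - \<theta>))"
    using \<beta> W K m by (intro gauss_integral_mono mult_left_mono) auto
  moreover have "gauss_integral (\<beta> * (k - \<theta>)) \<le> \<beta>"
  proof -
    have "gauss_integral (\<beta> * (k - \<theta>)) \<le> \<beta> * (k - \<theta>)" using \<beta> k by (intro gauss_integral_le_self) auto
    also have "\<dots> \<le> \<beta>" using \<beta> k by (intro mult_left_le) auto
    finally show ?thesis .
  qed
  ultimately have "(gauss_integral (\<beta> * W) - \<beta>) / \<beta>
    \<le> (gauss_integral (\<beta> * (k + real m - \<theta>)) - gauss_integral (\<beta> * (k - \<theta>))) / \<beta>"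
    using \<beta> by (intro divide_right_mono) auto
  also note tel[of m]
  finally show ?thesis unfolding iv K_def .
qed

lemma finite_int_interval: "finite {x::int. \<bar>real_of_int x - \<theta>\<bar> \<le> W}"
  by (rule finite_subset[of _ "{\<lfloor>\<theta> - W\<rfloor>..\<lceil>\<theta> + W\<rceil>}"]) (auto simp: abs_le_iff, linarith+)

text \<open>The integers to the left of \<open>\<theta>\<close> are reflected into the previous
  lemma. The centre is arbitrary because the centre of a cube moves with its directions.\<close>

lemma gauss_sum_lower:
  fixes \<beta> \<theta> W :: real
  assumes \<beta>: "\<beta> > 0" and W: "0 \<le> W"
  shows "2 * (gauss_integral (\<beta> * W) - \<beta>) / \<beta> \<le> (\<Sum>x\<in>{x::int. \<bar>x - \<theta>\<bar> \<le> W}. exp (- (\<beta> * (x - \<theta>))\<^sup>2))"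
proof -
  define k where "k = \<lceil>\<theta>\<rceil>"
  have k: "0 \<le> k - \<theta>" "k - \<theta> < 1" unfolding k_def by linarith+
  define R where "R = {k..\<lfloor>\<theta> + W\<rfloor>}"
  define L where "L = {1 - k..\<lfloor>- \<theta> + W\<rfloor>}"
  have "(gauss_integral (\<beta> * W) - \<beta>) / \<beta> \<le> (\<Sum>x\<in>R. exp (- (\<beta> * (x - \<theta>))\<^sup>2))"
    unfolding R_def using k by (intro half_gauss_sum_lower \<beta> W) auto
  moreover have "(gauss_integral (\<beta> * W) - \<beta>) / \<beta> \<le> (\<Sum>x\<in>L. exp (- (\<beta> * (x - (- \<theta>)))\<^sup>2))"
    unfolding L_def using k by (intro half_gauss_sum_lower \<beta> W) auto
  moreover have sq: "(\<beta> * (real_of_int (- x) - \<theta>))\<^sup>2 = (\<beta> * (x - (- \<theta>)))\<^sup>2" for x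
    by (simp add: power2_eq_square algebra_simps)
  have "(\<Sum>x\<in>L. exp (- (\<beta> * (x - (- \<theta>)))\<^sup>2)) = (\<Sum>x\<in>uminus ` L. exp (- (\<beta> * (x - \<theta>))\<^sup>2))"
    by (subst sum.reindex) (simp add: inj_on_def, simp only: o_def sq)
  moreover have "(\<Sum>x\<in>R. exp (- (\<beta> * (x - \<theta>))\<^sup>2)) + (\<Sum>x\<in>uminus ` L. exp (- (\<beta> * (x - \<theta>))\<^sup>2))
    = (\<Sum>x\<in>R \<union> uminus ` L. exp (- (\<beta> * (x - \<theta>))\<^sup>2))"
    by (intro sum.union_disjoint[symmetric]) (auto simp: R_def L_def)
  moreover have "\<dots> \<le> (\<Sum>x\<in>{x::int. \<bar>x - \<theta>\<bar> \<le> W}. exp (- (\<beta> * (x - \<theta>))\<^sup>2))"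
  proof (rule sum_mono2)
    show "R \<union> uminus ` L \<subseteq> {x::int. \<bar>x - \<theta>\<bar> \<le> W}"
    proof
      fix x assume "x \<in> R \<union> uminus ` L"
      then consider "k \<le> x" "x \<le> \<lfloor>\<theta> + W\<rfloor>" | "1 - k \<le> - x" "- x \<le> \<lfloor>- \<theta> + W\<rfloor>"
        by (auto simp: R_def L_def)
      then show "x \<in> {x. \<bar>x - \<theta>\<bar> \<le> W}"
      proof cases
        case 1
        then have "\<theta> \<le> x" "x \<le> \<theta> + W" using k by linarith+
        then show ?thesis by auto
      next
        case 2
        then have "real_of_int x \<le> k - 1" "- x \<le> - \<theta> + W" by linarith+
        then show ?thesis using k W by auto
      qed
    qed
  qed (auto simp: finite_int_interval)
  moreover have "2 * (gauss_integral (\<beta> * W) - \<beta>) / \<beta>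
    = (gauss_integral (\<beta> * W) - \<beta>) / \<beta> + (gauss_integral (\<beta> * W) - \<beta>) / \<beta>" by simp
  ultimately show ?thesis by linarith
qed

text \<open>Right endpoints replace left ones; the first term has no step of the integral before it
  and is bounded by 1.\<close>

lemma half_gauss_sum_upper:
  fixes \<beta> \<theta> :: real and k :: int
  assumes \<beta>: "\<beta> > 0" and k: "\<theta> \<le> k"
  shows "(\<Sum>x\<in>{k..<k + int m}. exp (- (\<beta> * (x - \<theta>))\<^sup>2)) \<le> 1 + gauss_integral (\<beta> * (k + real m - \<theta>)) / \<beta>"
proof -
  have "(\<Sum>x\<in>{k..<k + int (Suc m)}. exp (- (\<beta> * (x - \<theta>))\<^sup>2)) \<le> 1 + gauss_integral (\<beta> * (k + real m - \<theta>)) / \<beta>" for m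
  proof (induction m)
    case 0
    have "{k..<k + int (Suc 0)} = {k}" by auto
    moreover have "0 \<le> gauss_integral (\<beta> * (k - \<theta>))" using gauss_integral_mono[of 0 "\<beta> * (k - \<theta>)"] \<beta> k by simp
    ultimately show ?case using \<beta> by (simp add: add_increasing2)
  next
    case (Suc m)
    have "\<beta> = \<beta> * (k + real m + 1 - \<theta>) - \<beta> * (k + real m - \<theta>)" by (simp add: algebra_simps)
    then have "\<beta> * exp (- (\<beta> * (k + real m + 1 - \<theta>))\<^sup>2)
      = (\<beta> * (k + real m + 1 - \<theta>) - \<beta> * (k + real m - \<theta>)) * exp (- (\<beta> * (k + real m + 1 - \<theta>))\<^sup>2)"
      by (rule arg_cong)
    also have "\<dots> \<le> gauss_integral (\<beta> * (k + real m + 1 - \<theta>)) - gauss_integral (\<beta> * (k + real m - \<theta>))"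
      using \<beta> k by (intro gauss_integral_diff(1) mult_nonneg_nonneg mult_left_mono) auto
    finally have "exp (- (\<beta> * (k + real m + 1 - \<theta>))\<^sup>2)
      \<le> (gauss_integral (\<beta> * (k + real m + 1 - \<theta>)) - gauss_integral (\<beta> * (k + real m - \<theta>))) / \<beta>"
      using \<beta> by (simp add: le_divide_eq mult.commute)
    moreover have "{k..<k + int (Suc (Suc m))} = insert (k + int (Suc m)) {k..<k + int (Suc m)}" by auto
    ultimately show ?case using Suc by (simp add: diff_divide_distrib add_ac)
  qed
  from this[of m] have "(\<Sum>x\<in>{k..<k + int (Suc m)}. exp (- (\<beta> * (x - \<theta>))\<^sup>2)) \<le> 1 + gauss_integral (\<beta> * (k + real m - \<theta>)) / \<beta>" .
  moreover have "(\<Sum>x\<in>{k..<k + int m}. exp (- (\<beta> * (x - \<theta>))\<^sup>2)) \<le> (\<Sum>x\<in>{k..<k + int (Suc m)}. exp (- (\<beta> * (x - \<theta>))\<^sup>2))"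
    by (intro sum_mono2) auto
  ultimately show ?thesis by linarith
qed

lemma gauss_sum_upper:
  fixes \<beta> G :: real
  assumes \<beta>: "\<beta> > 0" and G: "\<And>x. 0 \<le> x \<Longrightarrow> gauss_integral x \<le> G"
  shows "(\<Sum>x\<in>{0..<int n}. exp (- (\<beta> * (x - (real n - 1) / 2))\<^sup>2)) \<le> 2 + 2 * G / \<beta>"
proof -
  define \<theta> where "\<theta> = (real n - 1) / 2"
  define k where "k = \<lceil>\<theta>\<rceil>"
  have k: "0 \<le> k - \<theta>" "k - \<theta> < 1" unfolding k_def by linarith+
  have half: "(\<Sum>x\<in>{j..<j + int n}. exp (- (\<beta> * (x - \<theta>'))\<^sup>2)) \<le> 1 + G / \<beta>" if "\<theta>' \<le> j" for j :: int and \<theta>' :: real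
  proof -
    have "gauss_integral (\<beta> * (j + real n - \<theta>')) \<le> G" using \<beta> that by (intro G) auto
    then have "gauss_integral (\<beta> * (j + real n - \<theta>')) / \<beta> \<le> G / \<beta>" using \<beta> by (intro divide_right_mono) auto
    then show ?thesis using half_gauss_sum_upper[OF \<beta> that, of n] by linarith
  qed
  have "(\<Sum>x\<in>{0..<int n}. exp (- (\<beta> * (x - \<theta>))\<^sup>2))
    \<le> (\<Sum>x\<in>{k..<k + int n} \<union> uminus ` {1 - k..<1 - k + int n}. exp (- (\<beta> * (x - \<theta>))\<^sup>2))"
  proof (rule sum_mono2)
    have aux: "x < N" if "x - (N - 1) / 2 < 1" "1 \<le> N" for x N :: real
      using that by (simp add: field_simps)
    have "real_of_int k < real n \<or> n = 0"
      using aux[of k "real n"] k(2) unfolding \<theta>_def by (cases "n = 0") auto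
    moreover have "- 1 < real_of_int k" using k unfolding \<theta>_def by auto
    ultimately have n: "k < int n \<or> n = 0" "- 1 < k" by linarith+
    show "{0..<int n} \<subseteq> {k..<k + int n} \<union> uminus ` {1 - k..<1 - k + int n}"
    proof
      fix x assume x: "x \<in> {0..<int n}"
      show "x \<in> {k..<k + int n} \<union> uminus ` {1 - k..<1 - k + int n}"
      proof (cases "k \<le> x")
        case True
        then show ?thesis using x n by auto
      next
        case False
        have "- x \<in> {1 - k..<1 - k + int n}" using x n False by auto
        then show ?thesis by (metis UnCI image_eqI minus_minus)
      qed
    qed
  qed auto
  also have "\<dots> = (\<Sum>x\<in>{k..<k + int n}. exp (- (\<beta> * (x - \<theta>))\<^sup>2))
    + (\<Sum>x\<in>uminus ` {1 - k..<1 - k + int n}. exp (- (\<beta> * (x - \<theta>))\<^sup>2))"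
    by (intro sum.union_disjoint) auto
  also have "(\<Sum>x\<in>uminus ` {1 - k..<1 - k + int n}. exp (- (\<beta> * (x - \<theta>))\<^sup>2))
    = (\<Sum>x\<in>{1 - k..<1 - k + int n}. exp (- (\<beta> * (x - (- \<theta>)))\<^sup>2))"
  proof -
    have sq: "(\<beta> * (real_of_int (- x) - \<theta>))\<^sup>2 = (\<beta> * (x - (- \<theta>)))\<^sup>2" for x
      by (simp add: power2_eq_square algebra_simps)
    show ?thesis by (subst sum.reindex) (simp add: inj_on_def, simp only: o_def sq)
  qed
  also have "(\<Sum>x\<in>{k..<k + int n}. exp (- (\<beta> * (x - \<theta>))\<^sup>2)) + \<dots> \<le> (1 + G / \<beta>) + (1 + G / \<beta>)"
    using k by (intro add_mono half) auto
  finally show ?thesis by (simp add: \<theta>_def)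
qed

text \<open>A uniformly random subset sum has mean half the total of \<open>h\<close> and variance a
  quarter of the sum of squares. Hence the second moment over the vertices splits, and the Gaussian
  of a cube factors into one for its centre and one for each direction.\<close>

lemma prod_Pow_gauss:
  fixes x \<alpha> :: real and h :: "nat \<Rightarrow> real"
  shows "(\<Prod>S\<in>Pow {..<d}. exp (- \<alpha> * (x + (\<Sum>j\<in>S. h j))\<^sup>2))
    = exp (- \<alpha> * (2 ^ d * (x + (\<Sum>j<d. h j) / 2)\<^sup>2 + 2 ^ d / 4 * (\<Sum>j<d. (h j)\<^sup>2)))"
proof (induction d arbitrary: x)
  case (Suc d)
  have "(\<Sum>j\<in>insert d S. h j) = h d + (\<Sum>j\<in>S. h j)" if "S \<in> Pow {..<d}" for S
    using that finite_subset[of S "{..<d}"] by (subst sum.insert) auto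
  then have "(\<Prod>S\<in>Pow {..<Suc d}. exp (- \<alpha> * (x + (\<Sum>j\<in>S. h j))\<^sup>2))
    = (\<Prod>S\<in>Pow {..<d}. exp (- \<alpha> * (x + (\<Sum>j\<in>S. h j))\<^sup>2))
      * (\<Prod>S\<in>Pow {..<d}. exp (- \<alpha> * ((x + h d) + (\<Sum>j\<in>S. h j))\<^sup>2))"
    unfolding prod_Pow_lessThan_Suc prod.distrib by (intro arg_cong2[where f = times] prod.cong) (auto simp: add_ac)
  also have "\<dots> = exp (- \<alpha> * (2 ^ Suc d * (x + (\<Sum>j<Suc d. h j) / 2)\<^sup>2 + 2 ^ Suc d / 4 * (\<Sum>j<Suc d. (h j)\<^sup>2)))"
    unfolding Suc.IH exp_add[symmetric]
    by (rule arg_cong[where f = exp]) (simp add: field_simps power2_eq_square)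
  finally show ?case .
qed simp

text \<open>Only cubes with directions at most \<open>M\<close> and base point within
  \<open>W\<close> of \<open>\<theta> h\<close> are kept. Their vertices all lie in the interval, so
  the truncation of \<open>g\<close> is invisible and the sums factor.\<close>

lemma interval_form_gauss_lower:
  fixes a M W c x0 :: real and n d p :: nat
  assumes p: "p \<ge> 1" and M: "0 \<le> M" and W: "0 \<le> W" and MW: "d * M / 2 + W \<le> (real n - 1) / 2"
    and d: "d \<ge> 1" and Mn: "M < n"
    and x0: "0 \<le> x0" "\<And>\<theta> :: real. x0 \<le> (\<Sum>x\<in>{x::int. \<bar>x - \<theta>\<bar> \<le> W}. exp (- (a * sqrt (2 ^ d) * (x - \<theta>))\<^sup>2))"
  defines "c \<equiv> (real n - 1) / 2"
  defines "g \<equiv> \<lambda>y::int. if y \<in> {0..<int n} then exp (- a\<^sup>2 * (y - c)\<^sup>2) else 0"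
  shows "(\<Sum>h\<in>{h::int. \<bar>real_of_int h - 0\<bar> \<le> M}. exp (- (a * sqrt (p * (2 ^ d / 4)) * (real_of_int h - 0))\<^sup>2)) ^ d * x0 ^ p
    \<le> interval_form n p d (\<lambda>_ _. g)"
proof -
  define H where "H = {h::int. \<bar>real_of_int h - 0\<bar> \<le> M}"
  define \<theta> where "\<theta> h = c - (\<Sum>j<d. real_of_int (h j)) / 2" for h :: "nat \<Rightarrow> int"
  define I where "I h = {x::int. \<bar>x - \<theta> h\<bar> \<le> W}" for h
  define Q where "Q h = exp (- a\<^sup>2 * (2 ^ d / 4 * (\<Sum>j<d. (real_of_int (h j))\<^sup>2)))" for h :: "nat \<Rightarrow> int"
  have finH: "finite H" unfolding H_def by (rule finite_int_interval)
  have HD: "H \<subseteq> {-int n<..<int n}" using Mn by (auto simp: H_def abs_le_iff)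
  have g0: "0 \<le> g y" for y by (simp add: g_def)
  have pt: "(\<Prod>S\<in>Pow {..<d}. g (x + (\<Sum>j\<in>S. h j))) = exp (- (a * sqrt (2 ^ d) * (x - \<theta> h))\<^sup>2) * Q h"
    and xin: "x \<in> {0..<int n}"
    if h: "h \<in> {..<d} \<rightarrow>\<^sub>E H" and x: "x \<in> I h" for h x
  proof -
    have hj: "\<bar>real_of_int (h j)\<bar> \<le> M" if "j < d" for j using h that by (auto simp: H_def PiE_iff)
    \<comment> \<open>Relative to \<open>c\<close>, a vertex is \<open>x - \<theta> h\<close> plus
      half a signed sum of all directions, so its distance to \<open>c\<close> is at most
      \<open>W + d * M / 2\<close>.\<close>
    have inn: "x + (\<Sum>j\<in>S. h j) \<in> {0..<int n}" if S: "S \<in> Pow {..<d}" for S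
    proof -
      have fS: "finite S" "finite ({..<d} - S)" using S by (auto intro: finite_subset)
      have "(\<Sum>j<d. real_of_int (h j)) = (\<Sum>j\<in>S. real_of_int (h j)) + (\<Sum>j\<in>{..<d} - S. real_of_int (h j))"
        using S by (metis PowD add.commute finite_lessThan sum.subset_diff)
      then have e: "x + (\<Sum>j\<in>S. real_of_int (h j)) - c = (x - \<theta> h)
        + ((\<Sum>j\<in>S. real_of_int (h j)) - (\<Sum>j\<in>{..<d} - S. real_of_int (h j))) / 2"
        by (simp add: \<theta>_def field_simps)
      have "\<bar>(\<Sum>j\<in>S. real_of_int (h j)) - (\<Sum>j\<in>{..<d} - S. real_of_int (h j))\<bar>
        \<le> (\<Sum>j\<in>S. \<bar>real_of_int (h j)\<bar>) + (\<Sum>j\<in>{..<d} - S. \<bar>real_of_int (h j)\<bar>)"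
        by (intro order_trans[OF abs_triangle_ineq4] add_mono sum_abs)
      also have "\<dots> = (\<Sum>j<d. \<bar>real_of_int (h j)\<bar>)"
        using S by (metis PowD add.commute finite_lessThan sum.subset_diff)
      also have "\<dots> \<le> (\<Sum>j<d. M)" using hj by (intro sum_mono) auto
      also have "\<dots> = d * M" by simp
      finally have "\<bar>x + (\<Sum>j\<in>S. real_of_int (h j)) - c\<bar> \<le> (real n - 1) / 2"
      proof -
        assume v: "\<bar>(\<Sum>j\<in>S. real_of_int (h j)) - (\<Sum>j\<in>{..<d} - S. real_of_int (h j))\<bar> \<le> d * M"
        have aux: "\<bar>u + v / 2\<bar> \<le> N" if "\<bar>u\<bar> \<le> W" "\<bar>v\<bar> \<le> m" "m / 2 + W \<le> N" for u v m N :: real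
          using that by linarith
        show ?thesis unfolding e using x v MW by (intro aux) (auto simp: I_def)
      qed
      moreover have aux: "0 \<le> y \<and> y < N" if "\<bar>y - (N - 1) / 2\<bar> \<le> (N - 1) / 2" for y N :: real
        using that by (auto simp: abs_le_iff field_simps)
      ultimately have "0 \<le> real_of_int (x + (\<Sum>j\<in>S. h j)) \<and> real_of_int (x + (\<Sum>j\<in>S. h j)) < real n"
        unfolding c_def by (intro aux) simp
      then have "0 \<le> x + (\<Sum>j\<in>S. h j)" "x + (\<Sum>j\<in>S. h j) < int n"
        by (metis of_int_0_le_iff, metis of_int_less_iff of_int_of_nat_eq)
      then show ?thesis by simp
    qed
    from inn[of "{}"] show "x \<in> {0..<int n}" by simp
    have "(\<Prod>S\<in>Pow {..<d}. g (x + (\<Sum>j\<in>S. h j)))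
      = (\<Prod>S\<in>Pow {..<d}. exp (- a\<^sup>2 * ((x - c) + (\<Sum>j\<in>S. real_of_int (h j)))\<^sup>2))"
      using inn by (intro prod.cong refl) (auto simp: g_def algebra_simps)
    also have "\<dots> = exp (- a\<^sup>2 * (2 ^ d * ((x - c) + (\<Sum>j<d. real_of_int (h j)) / 2)\<^sup>2)) * Q h"
      unfolding prod_Pow_gauss Q_def by (simp add: algebra_simps flip: exp_add)
    also have "- a\<^sup>2 * (2 ^ d * ((x - c) + (\<Sum>j<d. real_of_int (h j)) / 2)\<^sup>2) = - (a * sqrt (2 ^ d) * (x - \<theta> h))\<^sup>2"
    proof -
      have e: "real_of_int x - \<theta> h = (x - c) + (\<Sum>j<d. real_of_int (h j)) / 2" by (simp add: \<theta>_def)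
      show ?thesis unfolding e power_mult_distrib by simp
    qed
    finally show "(\<Prod>S\<in>Pow {..<d}. g (x + (\<Sum>j\<in>S. h j))) = exp (- (a * sqrt (2 ^ d) * (x - \<theta> h))\<^sup>2) * Q h" .
  qed
  have "(\<Sum>h\<in>H. exp (- (a * sqrt (p * (2 ^ d / 4)) * (real_of_int h - 0))\<^sup>2)) ^ d * x0 ^ p
    = (\<Prod>j<d. \<Sum>h\<in>H. exp (- (a * sqrt (p * (2 ^ d / 4)) * (real_of_int h - 0))\<^sup>2)) * x0 ^ p" by simp
  also have "(\<Prod>j<d. \<Sum>h\<in>H. exp (- (a * sqrt (p * (2 ^ d / 4)) * (real_of_int h - 0))\<^sup>2))
    = (\<Sum>h\<in>{..<d} \<rightarrow>\<^sub>E H. \<Prod>j<d. exp (- (a * sqrt (p * (2 ^ d / 4)) * (real_of_int (h j) - 0))\<^sup>2))"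
    using finH by (intro prod_sum_PiE) auto
  also have "\<dots> = (\<Sum>h\<in>{..<d} \<rightarrow>\<^sub>E H. Q h ^ p)"
    by (intro sum.cong refl)
      (simp add: Q_def power_mult_distrib sum_negf sum_distrib_left algebra_simps flip: exp_sum exp_of_nat_mult)
  also have "\<dots> * x0 ^ p = (\<Sum>h\<in>{..<d} \<rightarrow>\<^sub>E H. (x0 * Q h) ^ p)"
    by (simp add: power_mult_distrib sum_distrib_left mult.commute)
  also have "\<dots> \<le> (\<Sum>h\<in>{..<d} \<rightarrow>\<^sub>E H. (\<Sum>x\<in>{0..<int n}. \<Prod>S\<in>Pow {..<d}. g (x + (\<Sum>j\<in>S. h j))) ^ p)"
  proof (intro sum_mono power_mono)
    fix h assume h: "h \<in> {..<d} \<rightarrow>\<^sub>E H"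
    have "x0 * Q h \<le> (\<Sum>x\<in>I h. exp (- (a * sqrt (2 ^ d) * (x - \<theta> h))\<^sup>2)) * Q h"
      unfolding I_def by (rule mult_right_mono[OF x0(2)]) (simp add: Q_def)
    also have "\<dots> = (\<Sum>x\<in>I h. \<Prod>S\<in>Pow {..<d}. g (x + (\<Sum>j\<in>S. h j)))"
      unfolding sum_distrib_right using pt h by (intro sum.cong refl) simp
    also have "\<dots> \<le> (\<Sum>x\<in>{0..<int n}. \<Prod>S\<in>Pow {..<d}. g (x + (\<Sum>j\<in>S. h j)))"
      using xin h g0 by (intro sum_mono2) (auto intro: prod_nonneg)
    finally show "x0 * Q h \<le> (\<Sum>x\<in>{0..<int n}. \<Prod>S\<in>Pow {..<d}. g (x + (\<Sum>j\<in>S. h j)))" .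
    show "0 \<le> x0 * Q h" using x0 by (simp add: Q_def)
  qed
  also have "\<dots> \<le> (\<Sum>h\<in>{..<d} \<rightarrow>\<^sub>E {-int n<..<int n}. (\<Sum>x\<in>{0..<int n}. \<Prod>S\<in>Pow {..<d}. g (x + (\<Sum>j\<in>S. h j))) ^ p)"
    using HD g0 by (intro sum_mono2 finite_PiE PiE_mono) (auto intro!: zero_le_power sum_nonneg prod_nonneg)
  also have "\<dots> = interval_form n p d (\<lambda>_ _. g)"
    by (simp add: cube_form_def)
  finally show ?thesis by (simp only: H_def)
qed

text \<open>Each of the \<open>d + p\<close> sums on the left scales like \<open>1 / a\<close>, as
  does the one sum on the right, which is raised to the power \<open>t\<close>; this explains the
  factor \<open>a powr (d + p - t)\<close>.\<close>

lemma gauss_test: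
  fixes a t G :: real and n d p :: nat
  assumes d: "d \<ge> 2" and p: "p \<ge> 1" and n: "n \<ge> 2" and a: "a > 0" and t: "t > 0"
    and ineq: "interval_ineq d p n t" and G: "\<And>x. 0 \<le> x \<Longrightarrow> gauss_integral x \<le> G"
  defines "\<sigma>h \<equiv> sqrt (p * (2 ^ d / 4))" and "\<sigma>x \<equiv> sqrt (2 ^ d)"
  defines "Yh \<equiv> 2 * (gauss_integral (a * \<sigma>h * ((real n - 1) / (2 * d))) - a * \<sigma>h) / \<sigma>h"
    and "Yx \<equiv> 2 * (gauss_integral (a * \<sigma>x * ((real n - 1) / 4)) - a * \<sigma>x) / \<sigma>x"
  assumes Y: "Yh > 0" "Yx > 0"
  shows "Yh ^ d * Yx ^ p \<le> a powr (real (d + p) - t) * (2 * a + 2 * G / sqrt (real (p * 2 ^ d) / t)) powr t"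
proof -
  define q where "q = real (p * 2 ^ d) / t"
  define c where "c = (real n - 1) / 2"
  \<comment> \<open>The distance \<open>(n - 1) / 2\<close> available around the centre is shared
    equally: \<open>d * M / 2\<close> and \<open>W\<close> are both
    \<open>(n - 1) / 4\<close>.\<close>
  define M where "M = (real n - 1) / (2 * d)"
  define W where "W = (real n - 1) / 4"
  define g where "g = (\<lambda>y::int. if y \<in> {0..<int n} then exp (- a\<^sup>2 * (y - c)\<^sup>2) else 0)"
  have q: "q > 0" using p t by (simp add: q_def)
  have \<sigma>: "\<sigma>h > 0" "\<sigma>x > 0" using p by (auto simp: \<sigma>h_def \<sigma>x_def)
  have G0: "G \<ge> 0" using G[of 0] by simp
  have MW: "0 \<le> M" "0 \<le> W" "d * M / 2 + W \<le> (real n - 1) / 2" using n d by (auto simp: M_def W_def field_simps)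
  have Mn: "M < n"
  proof -
    have "M \<le> (real n - 1) / 1" unfolding M_def using n d by (intro divide_left_mono) auto
    then show ?thesis by simp
  qed
  have "(Yh / a) ^ d * (Yx / a) ^ p
    \<le> (\<Sum>h\<in>{h::int. \<bar>real_of_int h - 0\<bar> \<le> M}. exp (- (a * \<sigma>h * (real_of_int h - 0))\<^sup>2)) ^ d * (Yx / a) ^ p"
  proof (intro mult_right_mono power_mono)
    show "Yh / a \<le> (\<Sum>h\<in>{h::int. \<bar>real_of_int h - 0\<bar> \<le> M}. exp (- (a * \<sigma>h * (real_of_int h - 0))\<^sup>2))"
      using gauss_sum_lower[of "a * \<sigma>h" M 0] a \<sigma> MW by (simp add: Yh_def M_def mult.commute)
  qed (use Y a in auto)
  also have "\<dots> \<le> interval_form n p d (\<lambda>_ _. g)"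
    unfolding \<sigma>h_def g_def c_def
  proof (rule interval_form_gauss_lower[OF p MW])
    fix \<theta> :: real
    show "Yx / a \<le> (\<Sum>x\<in>{x::int. \<bar>x - \<theta>\<bar> \<le> W}. exp (- (a * sqrt (2 ^ d) * (x - \<theta>))\<^sup>2))"
      using gauss_sum_lower[of "a * \<sigma>x" W \<theta>] a \<sigma> MW unfolding \<sigma>x_def[symmetric]
      by (simp add: Yx_def W_def mult.commute)
  qed (use d Mn Y a in auto)
  also have "\<dots> \<le> (\<Sum>y\<in>{0..<int n}. g y powr q) powr t"
  proof -
    have "\<forall>x. 0 \<le> g x" "\<forall>x. x \<notin> {0..<int n} \<longrightarrow> g x = 0" by (auto simp: g_def)
    then show ?thesis using ineq unfolding interval_ineq_def q_def by blast
  qed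
  also have "(\<Sum>y\<in>{0..<int n}. g y powr q) = (\<Sum>y\<in>{0..<int n}. exp (- (a * sqrt q * (y - (real n - 1) / 2))\<^sup>2))"
    using q by (intro sum.cong refl) (simp add: g_def c_def powr_def power_mult_distrib mult_ac)
  also have "\<dots> powr t \<le> (2 + 2 * G / (a * sqrt q)) powr t"
    using a q t G by (intro powr_mono2 gauss_sum_upper) (auto intro: sum_nonneg)
  also have "2 + 2 * G / (a * sqrt q) = (2 * a + 2 * G / sqrt q) / a"
    using a q by (simp add: field_simps)
  also have "\<dots> powr t = (2 * a + 2 * G / sqrt q) powr t / a powr t"
    by (rule powr_divide)
  finally have "a ^ (d + p) * ((Yh / a) ^ d * (Yx / a) ^ p) \<le> a ^ (d + p) * ((2 * a + 2 * G / sqrt q) powr t / a powr t)"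
    using a by (intro mult_left_mono) auto
  moreover have "a ^ (d + p) * ((Yh / a) ^ d * (Yx / a) ^ p) = Yh ^ d * Yx ^ p"
    using a by (simp add: power_add power_divide)
  moreover have "a ^ (d + p) = a powr real (d + p)" by (rule powr_realpow[OF a, symmetric])
  ultimately show ?thesis by (simp add: powr_diff q_def)
qed

theorem t_exp_lower:
  fixes \<kappa> :: real
  assumes d: "d \<ge> 2" and p: "p \<ge> 1"
    and \<kappa>: "(real (d + p) * log 2 (real (d + p)) - real p * log 2 (real p) - 2 * real d) / 2 < \<kappa>"
  shows "\<forall>\<^sub>F n in sequentially. real d + real p - \<kappa> / log 2 n \<le> t_exp d p n"
proof -
  obtain G where G: "G > 0" "(gauss_integral \<longlongrightarrow> G) at_top" "\<And>x. 0 \<le> x \<Longrightarrow> gauss_integral x \<le> G"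
    by (rule gauss_integral_limit) blast
  define \<sigma>h where "\<sigma>h = sqrt (p * (2 ^ d / 4))"
  define \<sigma>x where "\<sigma>x = sqrt (2 ^ d)"
  have \<sigma>: "\<sigma>h > 0" "\<sigma>x > 0" using p by (auto simp: \<sigma>h_def \<sigma>x_def)
  \<comment> \<open>Here \<open>a n\<close> tends to 0 while \<open>a n * n\<close> diverges, so all
    sums converge to full Gaussian integrals; since \<open>ln (a n)\<close> is asymptotic to
    \<open>- ln n\<close>, the factor \<open>a n powr (\<kappa> / log 2 n)\<close> tends to
    \<open>2 powr (- \<kappa>)\<close>.\<close>
  define a where "a n = ln (real n) / real n" for n :: nat
  define t where "t n = real (d + p) - \<kappa> / log 2 (real n)" for n :: nat
  define Yh where "Yh n = 2 * (gauss_integral (a n * \<sigma>h * ((real n - 1) / (2 * d))) - a n * \<sigma>h) / \<sigma>h" for n :: nat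
  define Yx where "Yx n = 2 * (gauss_integral (a n * \<sigma>x * ((real n - 1) / 4)) - a n * \<sigma>x) / \<sigma>x" for n :: nat
  define Z where "Z n = a n powr (real (d + p) - t n) * (2 * a n + 2 * G / sqrt (real (p * 2 ^ d) / t n)) powr t n" for n
  have a0: "a \<longlonglongrightarrow> 0" unfolding a_def by real_asymp
  have an: "filterlim (\<lambda>n. a n * (real n - 1)) at_top sequentially" unfolding a_def by real_asymp
  have lim_\<Phi>: "(\<lambda>n. gauss_integral (a n * \<sigma> * ((real n - 1) / s))) \<longlonglongrightarrow> G" if "\<sigma> > 0" "s > 0" for \<sigma> s
  proof -
    have "filterlim (\<lambda>n. \<sigma> / s * (a n * (real n - 1))) at_top sequentially"
      using that by (intro filterlim_tendsto_pos_mult_at_top[OF tendsto_const _ an]) auto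
    then have "filterlim (\<lambda>n. a n * \<sigma> * ((real n - 1) / s)) at_top sequentially"
      by (simp add: mult_ac)
    then show ?thesis by (rule filterlim_compose[OF G(2)])
  qed
  have Yh: "Yh \<longlonglongrightarrow> 2 * (G - 0 * \<sigma>h) / \<sigma>h"
    unfolding Yh_def using \<sigma> d by (intro tendsto_intros lim_\<Phi> a0) auto
  have Yx: "Yx \<longlonglongrightarrow> 2 * (G - 0 * \<sigma>x) / \<sigma>x"
    unfolding Yx_def using \<sigma> by (intro tendsto_intros lim_\<Phi> a0) auto
  have "(\<lambda>n. 1 / log 2 (real n)) \<longlonglongrightarrow> 0" by real_asymp
  then have "(\<lambda>n. real (d + p) - \<kappa> * (1 / log 2 (real n))) \<longlonglongrightarrow> real (d + p) - \<kappa> * 0"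
    by (intro tendsto_intros)
  then have t: "t \<longlonglongrightarrow> real (d + p)" by (simp add: t_def[abs_def])
  have dp: "real (d + p) > 0" using d by simp
  define Q where "Q = real (p * 2 ^ d) / real (d + p)"
  have Q: "Q > 0" using p dp by (simp add: Q_def)
  have base: "(\<lambda>n. 2 * a n + 2 * G / sqrt (real (p * 2 ^ d) / t n)) \<longlonglongrightarrow> 2 * 0 + 2 * G / sqrt Q"
    unfolding Q_def using dp p by (intro tendsto_intros a0 t) auto
  have apow: "(\<lambda>n. a n powr (real (d + p) - t n)) \<longlonglongrightarrow> 2 powr (- \<kappa>)"
  proof -
    have "(\<lambda>n. ln (a n) / log 2 (real n)) \<longlonglongrightarrow> - ln 2" unfolding a_def by real_asymp
    then have "(\<lambda>n. exp (\<kappa> * (ln (a n) / log 2 (real n)))) \<longlonglongrightarrow> exp (\<kappa> * - ln 2)"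
      by (intro tendsto_intros)
    moreover have "\<forall>\<^sub>F n in sequentially. exp (\<kappa> * (ln (a n) / log 2 (real n))) = a n powr (real (d + p) - t n)"
      using eventually_ge_at_top[of 2]
    proof eventually_elim
      case (elim n)
      then have "a n > 0" by (simp add: a_def)
      then show ?case by (simp add: t_def powr_def)
    qed
    ultimately have "(\<lambda>n. a n powr (real (d + p) - t n)) \<longlonglongrightarrow> exp (\<kappa> * - ln 2)"
      by (rule Lim_transform_eventually)
    then show ?thesis by (simp add: powr_def)
  qed
  have Z: "Z \<longlonglongrightarrow> 2 powr (- \<kappa>) * (2 * 0 + 2 * G / sqrt Q) powr real (d + p)"
    unfolding Z_def[abs_def] using G(1) Q by (intro tendsto_mult apow tendsto_powr base t) auto
  have Y: "(\<lambda>n. Yh n ^ d * Yx n ^ p) \<longlonglongrightarrow> (2 * G / \<sigma>h) ^ d * (2 * G / \<sigma>x) ^ p"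
    using Yh Yx by (intro tendsto_intros) simp_all
  have strict: "2 powr (- \<kappa>) * (2 * 0 + 2 * G / sqrt Q) powr real (d + p) < (2 * G / \<sigma>h) ^ d * (2 * G / \<sigma>x) ^ p"
  proof -
    \<comment> \<open>In base-2 logarithms the two limits differ by \<open>K / 2 - \<kappa>\<close>,
      which is how the coefficient arises.\<close>
    define K where "K = real (d + p) * log 2 (real (d + p)) - real p * log 2 (real p) - 2 * real d"
    have log_sqrt: "log 2 (sqrt x) = log 2 x / 2" if "x > 0" for x
      using that by (simp add: log_def ln_sqrt)
    have lsh: "log 2 \<sigma>h = (log 2 p + d - 2) / 2"
    proof -
      have "(2::real) ^ d / 4 = 2 powr (real d - 2)" by (simp add: powr_diff powr_realpow)
      then show ?thesis using p by (simp add: \<sigma>h_def log_sqrt log_mult)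
    qed
    have lsx: "log 2 \<sigma>x = d / 2" by (simp add: \<sigma>x_def log_sqrt log_nat_power)
    have lQ: "log 2 (sqrt Q) = (log 2 p + d - log 2 (d + p)) / 2"
      using p dp Q by (simp add: Q_def log_sqrt log_divide log_mult log_nat_power)
    have G2: "log 2 (2 * G / s) = log 2 (2 * G) - log 2 s" if "s > 0" for s
      using that G(1) by (simp add: log_divide)
    have "log 2 (2 powr (- \<kappa>) * (2 * G / sqrt Q) powr real (d + p))
      = - \<kappa> + real (d + p) * log 2 (2 * G / sqrt Q)"
      using G(1) Q dp by (subst log_mult) (auto simp: log_powr)
    also have "\<dots> = - \<kappa> + real (d + p) * (log 2 (2 * G) - (log 2 p + d - log 2 (d + p)) / 2)"
      using Q by (simp only: G2 real_sqrt_gt_zero lQ)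
    also have "\<dots> = - \<kappa> + K / 2 + (d * (log 2 (2 * G) - (log 2 p + d - 2) / 2) + p * (log 2 (2 * G) - d / 2))"
      by (simp add: K_def field_simps)
    also have "\<dots> < 0 + (d * (log 2 (2 * G) - (log 2 p + d - 2) / 2) + p * (log 2 (2 * G) - d / 2))"
      using \<kappa> by (intro add_strict_right_mono) (simp add: K_def)
    also have "\<dots> = log 2 ((2 * G / \<sigma>h) ^ d * (2 * G / \<sigma>x) ^ p)"
      using G(1) \<sigma> by (simp add: log_mult log_nat_power G2 lsh lsx)
    finally have "log 2 (2 powr (- \<kappa>) * (2 * G / sqrt Q) powr real (d + p)) < log 2 ((2 * G / \<sigma>h) ^ d * (2 * G / \<sigma>x) ^ p)" .
    then show ?thesis using G(1) \<sigma> Q by (subst (asm) log_less_cancel_iff) auto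
  qed
  have "\<forall>\<^sub>F n in sequentially. Z n < Yh n ^ d * Yx n ^ p"
  proof -
    have "(\<lambda>n. Yh n ^ d * Yx n ^ p - Z n) \<longlonglongrightarrow> (2 * G / \<sigma>h) ^ d * (2 * G / \<sigma>x) ^ p
      - 2 powr (- \<kappa>) * (2 * 0 + 2 * G / sqrt Q) powr real (d + p)"
      by (intro tendsto_diff Y Z)
    then have "\<forall>\<^sub>F n in sequentially. 0 < Yh n ^ d * Yx n ^ p - Z n"
      by (rule order_tendstoD) (use strict in simp)
    then show ?thesis by simp
  qed
  moreover have "\<forall>\<^sub>F n in sequentially. 0 < Yh n" "\<forall>\<^sub>F n in sequentially. 0 < Yx n" "\<forall>\<^sub>F n in sequentially. 0 < t n"
    using order_tendstoD(1)[OF Yh, of 0] order_tendstoD(1)[OF Yx, of 0] order_tendstoD(1)[OF t, of 0] G(1) \<sigma> dp by auto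
  ultimately show ?thesis
    using eventually_ge_at_top[of 2]
  proof eventually_elim
    case (elim n)
    show ?case
    proof (rule ccontr)
      assume "\<not> ?case"
      then have "t_exp d p n < t n" by (simp add: t_def)
      then have "t_admissible d p n (t n)"
        using t_admissible_upper[OF d p elim(5)] by (rule t_admissible_of_lt)
      then have "interval_ineq d p n (t n)" by (rule interval_ineq_of_t_admissible[OF p])
      then have "Yh n ^ d * Yx n ^ p \<le> Z n"
        unfolding Yh_def Yx_def Z_def \<sigma>h_def \<sigma>x_def
        using elim by (intro gauss_test d p G(3)) (auto simp: a_def Yh_def Yx_def \<sigma>h_def \<sigma>x_def)
      then show False using elim(1) by simp
    qed
  qed
qed

theorem t_exp_lower_asymp:
  assumes d: "d \<ge> 2" and p: "p \<ge> 1"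
  shows "\<exists>\<epsilon> :: nat \<Rightarrow> real. \<epsilon> \<longlonglongrightarrow> 0 \<and> (\<forall>n\<ge>2.
    real d + real p - (1 + \<epsilon> n) *
      ((real (d + p) * log 2 (real (d + p)) - real p * log 2 (real p) - 2 * real d) / (2 * log 2 (real n)))
    \<le> t_exp d p n)"
proof -
  define K where "K = real (d + p) * log 2 (real (d + p)) - real p * log 2 (real p) - 2 * real d"
  \<comment> \<open>If \<open>d + p \<ge> 4\<close>, then \<open>log 2 (d + p) \<ge> 2\<close> pays
    for the term \<open>2 * d\<close>; only \<open>d = 2\<close>, \<open>p = 1\<close> falls below
    this and needs \<open>3 powr 3 > 2 powr 4\<close>.\<close>
  have K: "K > 0"
  proof (cases "d + p = 3")
    case True
    then have "d = 2" "p = 1" using d p by auto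
    moreover have "4 < 3 * log 2 (3::real)"
    proof -
      have "(4::real) = log 2 (2 powr 4)" by (rule log_powr_cancel[symmetric]) auto
      also have "\<dots> < log 2 ((3::real) powr 3)" by (subst log_less_cancel_iff) auto
      also have "\<dots> = 3 * log 2 3" by (rule log_powr)
      finally show ?thesis .
    qed
    ultimately show ?thesis by (simp add: K_def)
  next
    case False
    then have "(2::real) powr 2 \<le> real (d + p)" using d p by simp
    then have "2 \<le> log 2 (real (d + p))" by (subst le_log_iff) (use d in auto)
    then have "real d * 2 \<le> real d * log 2 (real (d + p))" by (intro mult_left_mono) auto
    moreover have "log 2 (real p) < log 2 (real (d + p))" using d p by (subst log_less_cancel_iff) auto
    then have "real p * log 2 (real p) < real p * log 2 (real (d + p))" using p by simp
    ultimately show ?thesis by (simp add: K_def algebra_simps)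
  qed
  \<comment> \<open>The value of the error term that turns the lower bound into an equality.
    Clipping it at 0 keeps the bound, and then only an upper estimate is left for the
    convergence.\<close>
  define \<delta> where "\<delta> n = (real d + real p - t_exp d p n) * (2 * log 2 (real n)) / K - 1" for n
  define \<epsilon> where "\<epsilon> n = max 0 (\<delta> n)" for n
  have "\<epsilon> \<longlonglongrightarrow> 0"
  proof (rule order_tendstoI)
    fix e :: real assume "e < 0"
    then show "\<forall>\<^sub>F n in sequentially. e < \<epsilon> n" by (simp add: \<epsilon>_def less_max_iff_disj)
  next
    fix e :: real assume e: "0 < e"
    have "K / 2 < (1 + e / 2) * (K / 2)" using e K by simp
    then have "\<forall>\<^sub>F n in sequentially. real d + real p - (1 + e / 2) * (K / 2) / log 2 n \<le> t_exp d p n"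
      unfolding K_def by (intro t_exp_lower d p)
    then show "\<forall>\<^sub>F n in sequentially. \<epsilon> n < e"
      using eventually_ge_at_top[of 2]
    proof eventually_elim
      case (elim n)
      define l where "l = log 2 (real n)"
      have l: "l > 0" using elim by (simp add: l_def)
      have "(real d + real p - t_exp d p n) * (2 * l) \<le> ((1 + e / 2) * (K / 2) / l) * (2 * l)"
        using elim l by (intro mult_right_mono) (auto simp: l_def)
      also have "\<dots> = (1 + e / 2) * K" using l by simp
      finally have "\<delta> n \<le> e / 2" using K by (simp add: \<delta>_def l_def divide_le_eq algebra_simps)
      then show ?case using e by (simp add: \<epsilon>_def)
    qed
  qed
  moreover have "real d + real p - (1 + \<epsilon> n) * (K / (2 * log 2 (real n))) \<le> t_exp d p n" if n: "n \<ge> 2" for n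
  proof -
    define l where "l = log 2 (real n)"
    have l: "l > 0" using n by (simp add: l_def)
    have "(1 + \<delta> n) * (K / (2 * l)) \<le> (1 + \<epsilon> n) * (K / (2 * l))"
      using K l by (intro mult_right_mono) (auto simp: \<epsilon>_def)
    moreover have "(1 + \<delta> n) * (K / (2 * l)) = real d + real p - t_exp d p n"
      using K l by (simp add: \<delta>_def l_def[symmetric])
    ultimately show ?thesis by (simp add: l_def)
  qed
  ultimately show ?thesis unfolding K_def by blast
qed

section \<open>Binomial entropy\<close>
text \<open>The LYM weight of \<open>S\<close> in \<open>J\<close> is the average, over the elements
  \<open>j\<close> of \<open>J\<close>, of its weight in \<open>J - {j}\<close>, with weight zero if
  \<open>j\<close> belongs to \<open>S\<close>.\<close>

lemma inverse_binomial_eq_sum_complement: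
  assumes J: "finite J" and S: "S \<subset> J"
  shows "1 / real (card J choose card S) = (\<Sum>j\<in>J - S. 1 / (real (card J) * real ((card J - 1) choose card S)))"
proof -
  define k where "k = card J"
  define s where "s = card S"
  have sk: "s < k" using psubset_card_mono[OF J S] by (simp add: k_def s_def)
  have "(k - s) * (k choose s) = k * ((k - 1) choose s)" by (rule binomial_absorb_comp)
  then have "real (k - s) * real (k choose s) = real k * real ((k - 1) choose s)"
    by (metis of_nat_mult)
  then have e: "real (k - s) * (1 / (real k * real ((k - 1) choose s))) = real (k - s) / (real (k - s) * real (k choose s))"
    by simp
  also have "\<dots> = 1 / real (k choose s)" using sk by simp
  finally have e: "real (k - s) * (1 / (real k * real ((k - 1) choose s))) = 1 / real (k choose s)" .
  have "card (J - S) = k - s"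
    using S J by (auto simp: k_def s_def card_Diff_subset finite_subset)
  then show ?thesis using e[symmetric] by (simp only: sum_constant) (simp add: k_def s_def)
qed

text \<open>
  The sets with a prescribed sum form an antichain, so this is an instance of the LYM inequality.
\<close>

lemma lym_subset_sums:
  fixes h :: "'a \<Rightarrow> int"
  assumes "finite J" "\<And>j. j \<in> J \<Longrightarrow> 0 < h j"
  shows "(\<Sum>S\<in>{S\<in>Pow J. (\<Sum>j\<in>S. h j) = s}. 1 / real (card J choose card S)) \<le> 1"
  using assms
proof (induction "card J" arbitrary: J)
  case 0
  then have "J = {}" by simp
  then have "{S\<in>Pow J. (\<Sum>j\<in>S. h j) = s} \<subseteq> {{}}" by auto
  then have "(\<Sum>S\<in>{S\<in>Pow J. (\<Sum>j\<in>S. h j) = s}. 1 / real (card J choose card S))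
    \<le> (\<Sum>S\<in>{{} :: 'a set}. 1 / real (card J choose card S))" by (intro sum_mono2) auto
  then show ?case using \<open>J = {}\<close> by simp
next
  case (Suc m J)
  have fJ: "finite J" by fact
  have lt: "(\<Sum>j\<in>S. h j) < (\<Sum>j\<in>J. h j)" if S: "S \<subset> J" for S
  proof -
    obtain j where j: "j \<in> J" "j \<notin> S" using S by auto
    show ?thesis
      using S j Suc.prems by (intro sum_strict_mono2[of J S j]) (auto intro: less_imp_le)
  qed
  show ?case
  proof (cases "(\<Sum>j\<in>J. h j) = s")
    case True
    have "S = J" if "S \<subseteq> J" "(\<Sum>j\<in>S. h j) = s" for S
      using lt[of S] that True by (cases "S = J") auto
    then have "{S\<in>Pow J. (\<Sum>j\<in>S. h j) = s} = {J}" using True by auto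
    then show ?thesis by simp
  next
    case False
    \<comment> \<open>No member is \<open>J\<close> itself, so the weights average over the omitted
      elements and the induction hypothesis applies to each \<open>J - {j}\<close>.\<close>
    define A where "A = {S\<in>Pow J. (\<Sum>j\<in>S. h j) = s}"
    have fA: "finite A" using fJ by (simp add: A_def)
    have "(\<Sum>S\<in>A. 1 / real (card J choose card S)) = (\<Sum>S\<in>A. \<Sum>j\<in>{j\<in>J. j \<notin> S}. 1 / (real (card J) * real (m choose card S)))"
    proof (rule sum.cong[OF refl])
      fix S assume "S \<in> A"
      then have S: "S \<subset> J" using False by (auto simp: A_def)
      have "J - S = {j\<in>J. j \<notin> S}" "card J - 1 = m" using Suc.hyps(2) by auto
      then show "1 / real (card J choose card S) = (\<Sum>j\<in>{j\<in>J. j \<notin> S}. 1 / (real (card J) * real (m choose card S)))"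
        using inverse_binomial_eq_sum_complement[OF fJ S] by simp
    qed
    also have "\<dots> = (\<Sum>j\<in>J. \<Sum>S\<in>{S\<in>A. j \<notin> S}. 1 / (real (card J) * real (m choose card S)))"
      by (rule sum.swap_restrict[OF fA fJ])
    also have "\<dots> = (\<Sum>j\<in>J. (\<Sum>S\<in>{S\<in>Pow (J - {j}). (\<Sum>j\<in>S. h j) = s}. 1 / real (m choose card S)) / real (card J))"
    proof (rule sum.cong[OF refl])
      fix j assume "j \<in> J"
      have "{S\<in>A. j \<notin> S} = {S\<in>Pow (J - {j}). (\<Sum>j\<in>S. h j) = s}" by (auto simp: A_def)
      then show "(\<Sum>S\<in>{S\<in>A. j \<notin> S}. 1 / (real (card J) * real (m choose card S)))
        = (\<Sum>S\<in>{S\<in>Pow (J - {j}). (\<Sum>j\<in>S. h j) = s}. 1 / real (m choose card S)) / real (card J)"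
        by (simp add: sum_divide_distrib mult.commute)
    qed
    also have "\<dots> \<le> (\<Sum>j\<in>J. 1 / real (card J))"
    proof (intro sum_mono divide_right_mono)
      fix j assume j: "j \<in> J"
      have "card (J - {j}) = m" using j fJ Suc.hyps(2) by simp
      then show "(\<Sum>S\<in>{S\<in>Pow (J - {j}). (\<Sum>j\<in>S. h j) = s}. 1 / real (m choose card S)) \<le> 1"
        using Suc.hyps(1)[of "J - {j}"] Suc.prems by simp
    qed simp
    also have "\<dots> = 1" using Suc.hyps(2) by auto
    finally show ?thesis by (simp add: A_def)
  qed
qed

text \<open>AM-GM for the ratios of \<open>\<gamma>\<close> to the binomial weights
  \<open>b\<close>: the number of subsets cancels the denominator of \<open>b\<close>, and grouping
  the vertices by position \<open>y\<close> leaves for each \<open>y\<close> an LYM sum, which is at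
  most 1.\<close>

lemma prod_subset_sums_le:
  fixes h :: "'a \<Rightarrow> int" and \<gamma> :: "int \<Rightarrow> real"
  assumes J: "finite J" "\<And>j. j \<in> J \<Longrightarrow> 0 < h j"
    and Y: "finite Y" and \<gamma>: "\<And>y. 0 \<le> \<gamma> y" "\<And>y. y \<notin> Y \<Longrightarrow> \<gamma> y = 0" "(\<Sum>y\<in>Y. \<gamma> y) \<le> 1"
  shows "(\<Prod>S\<in>Pow J. \<gamma> (x + (\<Sum>j\<in>S. h j))) \<le> (\<Prod>S\<in>Pow J. real (card J choose card S) / 2 ^ card J)"
proof -
  define k where "k = card J"
  define b where "b S = real (k choose card S) / 2 ^ k" for S :: "'a set"
  define s where "s S = x + (\<Sum>j\<in>S. h j)" for S
  have b0: "b S > 0" if "S \<in> Pow J" for S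
    using that J by (auto simp: b_def k_def card_mono)
  have fP: "finite (Pow J)" "Pow J \<noteq> {}" "card (Pow J) = 2 ^ k" using J by (auto simp: k_def card_Pow)
  have "(\<Prod>S\<in>Pow J. \<gamma> (s S) / b S) powr (1 / real (card (Pow J))) \<le> (\<Sum>S\<in>Pow J. \<gamma> (s S) / b S / real (card (Pow J)))"
    by (intro arith_geom_mean fP divide_nonneg_nonneg \<gamma>(1) less_imp_le[OF b0])
  also have "\<dots> = (\<Sum>S\<in>Pow J. \<gamma> (s S) / real (k choose card S))"
    unfolding fP(3) by (simp add: b_def)
  also have "\<dots> = (\<Sum>S\<in>Pow J. \<Sum>y\<in>Y. if s S = y then \<gamma> y / real (k choose card S) else 0)"
    using Y \<gamma>(2) by (intro sum.cong refl) (simp add: sum.delta)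
  also have "\<dots> = (\<Sum>y\<in>Y. \<Sum>S\<in>Pow J. if (\<Sum>j\<in>S. h j) = y - x then \<gamma> y / real (k choose card S) else 0)"
    by (subst sum.swap) (intro sum.cong refl if_cong, auto simp: s_def)
  also have "\<dots> = (\<Sum>y\<in>Y. \<gamma> y * (\<Sum>S\<in>{S\<in>Pow J. (\<Sum>j\<in>S. h j) = y - x}. 1 / real (k choose card S)))"
    using J by (simp add: sum.inter_filter[symmetric] sum_distrib_left)
  also have "\<dots> \<le> (\<Sum>y\<in>Y. \<gamma> y * 1)"
    unfolding k_def using \<gamma> J by (intro sum_mono mult_left_mono lym_subset_sums) auto
  also have "\<dots> \<le> 1" using \<gamma> by simp
  finally have le: "(\<Prod>S\<in>Pow J. \<gamma> (s S) / b S) powr (1 / real (card (Pow J))) \<le> 1" .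
  have nn: "0 \<le> (\<Prod>S\<in>Pow J. \<gamma> (s S) / b S)"
    by (intro prod_nonneg ballI divide_nonneg_nonneg \<gamma>(1) less_imp_le[OF b0])
  have "(\<Prod>S\<in>Pow J. \<gamma> (s S) / b S) \<le> 1"
  proof (rule ccontr)
    assume "\<not> ?thesis"
    then have "1 powr (1 / real (card (Pow J))) < (\<Prod>S\<in>Pow J. \<gamma> (s S) / b S) powr (1 / real (card (Pow J)))"
      using fP(3) by (intro powr_less_mono2) auto
    then show False using le by simp
  qed
  then have "(\<Prod>S\<in>Pow J. \<gamma> (s S)) \<le> (\<Prod>S\<in>Pow J. b S)"
    using prod_pos[of "Pow J" b] b0 by (simp add: prod_dividef divide_le_eq)
  then show ?thesis by (simp add: s_def b_def k_def)
qed

text \<open>Moving the base point to the lowest vertex makes all directions positive; on index sets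
  this is the symmetric difference with the set \<open>M\<close> of negative directions.\<close>

lemma prod_Pow_flip_signs:
  fixes h :: "'a \<Rightarrow> int" and u :: "int \<Rightarrow> 'b::comm_monoid_mult"
  assumes J: "finite J"
  shows "(\<Prod>S\<in>Pow J. u (x + (\<Sum>j\<in>S. h j)))
    = (\<Prod>S\<in>Pow J. u (x + (\<Sum>j\<in>{j\<in>J. h j < 0}. h j) + (\<Sum>j\<in>S. \<bar>h j\<bar>)))"
proof -
  define M where "M = {j\<in>J. h j < 0}"
  define flip where "flip S = (S - M) \<union> (M - S)" for S
  have M: "M \<subseteq> J" "finite M" using J by (auto simp: M_def)
  have key: "(\<Sum>j\<in>M. h j) + (\<Sum>j\<in>flip S. \<bar>h j\<bar>) = (\<Sum>j\<in>S. h j)" if S: "S \<in> Pow J" for S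
  proof -
    have fS: "finite S" using S J by (auto intro: finite_subset)
    have "(\<Sum>j\<in>flip S. \<bar>h j\<bar>) = (\<Sum>j\<in>S - M. \<bar>h j\<bar>) + (\<Sum>j\<in>M - S. \<bar>h j\<bar>)"
      unfolding flip_def using fS M by (intro sum.union_disjoint) auto
    also have "(\<Sum>j\<in>S - M. \<bar>h j\<bar>) = (\<Sum>j\<in>S - M. h j)" using S by (intro sum.cong) (auto simp: M_def)
    also have "(\<Sum>j\<in>M - S. \<bar>h j\<bar>) = - (\<Sum>j\<in>M - S. h j)" unfolding sum_negf[symmetric] by (intro sum.cong) (auto simp: M_def)
    finally have "(\<Sum>j\<in>flip S. \<bar>h j\<bar>) = (\<Sum>j\<in>S - M. h j) - (\<Sum>j\<in>M - S. h j)" by simp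
    moreover have "(\<Sum>j\<in>M. h j) = (\<Sum>j\<in>M - S. h j) + (\<Sum>j\<in>M \<inter> S. h j)"
      using sum.Int_Diff[OF M(2), of h S] by simp
    moreover have "(\<Sum>j\<in>S. h j) = (\<Sum>j\<in>S - M. h j) + (\<Sum>j\<in>M \<inter> S. h j)"
      using sum.Int_Diff[OF fS, of h M] by (simp add: Int_commute)
    ultimately show ?thesis by simp
  qed
  have "(\<Prod>S\<in>Pow J. u (x + (\<Sum>j\<in>S. h j))) = (\<Prod>S\<in>Pow J. u (x + (\<Sum>j\<in>M. h j) + (\<Sum>j\<in>S. \<bar>h j\<bar>)))"
  proof (rule prod.reindex_bij_witness[where i = flip and j = flip])
    fix S assume S: "S \<in> Pow J"
    show "flip (flip S) = S" by (auto simp: flip_def)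
    show "flip S \<in> Pow J" using S M by (auto simp: flip_def)
    show "flip (flip S) = S" by (auto simp: flip_def)
    show "flip S \<in> Pow J" using S M by (auto simp: flip_def)
    show "u (x + (\<Sum>j\<in>M. h j) + (\<Sum>j\<in>flip S. \<bar>h j\<bar>)) = u (x + (\<Sum>j\<in>S. h j))"
      using key[OF S] by (simp add: add.assoc)
  qed
  then show ?thesis by (simp only: M_def)
qed

lemma prod_Pow_card:
  assumes J: "finite J"
  shows "(\<Prod>S\<in>Pow J. f (card S)) = (\<Prod>j=0..card J. (f j :: real) ^ (card J choose j))"
proof -
  have "(\<Prod>S\<in>Pow J. f (card S)) = (\<Prod>j\<in>{0..card J}. \<Prod>S\<in>{S\<in>Pow J. card S = j}. f (card S))"
    using J by (intro prod.group[symmetric]) (auto intro: card_mono)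
  also have "\<dots> = (\<Prod>j\<in>{0..card J}. f j ^ (card J choose j))"
  proof (rule prod.cong[OF refl])
    fix j
    have "card {S\<in>Pow J. card S = j} = card J choose j" using n_subsets[OF J, of j] by simp
    then show "(\<Prod>S\<in>{S\<in>Pow J. card S = j}. f (card S)) = f j ^ (card J choose j)" by simp
  qed
  finally show ?thesis .
qed

lemma prod_Pow_binomial_weights:
  assumes J: "finite J"
  shows "(\<Prod>S\<in>Pow J. real (card J choose card S) / 2 ^ card J) = 2 powr (- (2 ^ card J * binomial_entropy (card J)))"
proof -
  define k where "k = card J"
  define b where "b j = real (k choose j) / 2 ^ k" for j
  have b0: "b j > 0" if "j \<in> {0..k}" for j using that by (simp add: b_def)
  have "(\<Prod>S\<in>Pow J. b (card S)) = (\<Prod>j=0..k. b j ^ (k choose j))"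
    unfolding k_def by (rule prod_Pow_card[OF J])
  also have "\<dots> = (\<Prod>j=0..k. 2 powr (real (k choose j) * log 2 (b j)))"
  proof (rule prod.cong[OF refl])
    fix j assume "j \<in> {0..k}"
    then have "b j ^ (k choose j) = (2 powr log 2 (b j)) powr real (k choose j)"
      using b0 by (simp add: powr_realpow)
    then show "b j ^ (k choose j) = 2 powr (real (k choose j) * log 2 (b j))"
      by (simp add: powr_powr mult.commute)
  qed
  also have "\<dots> = 2 powr (\<Sum>j=0..k. real (k choose j) * log 2 (b j))"
    by (rule powr_sum[symmetric]) simp_all
  also have "(\<Sum>j=0..k. real (k choose j) * log 2 (b j)) = - (2 ^ k * binomial_entropy k)"
    by (simp add: binomial_entropy_def b_def sum_distrib_left)
  finally show ?thesis by (simp add: b_def k_def)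
qed

definition binomial_log_sum :: "nat \<Rightarrow> real" where
  "binomial_log_sum k = (\<Sum>j\<le>k. real (k choose j) * ln (real (k choose j)))"

lemma binomial_entropy_eq: "binomial_entropy k = k - binomial_log_sum k / (2 ^ k * ln 2)"
proof -
  have "(\<Sum>j=0..k. real (k choose j) / 2 ^ k * log 2 (real (k choose j) / 2 ^ k))
    = (\<Sum>j=0..k. real (k choose j) * ln (real (k choose j)) / (2 ^ k * ln 2) - k * (real (k choose j) / 2 ^ k))"
  proof (rule sum.cong[OF refl])
    fix j assume "j \<in> {0..k}"
    then have l: "log 2 (real (k choose j) / 2 ^ k) = ln (real (k choose j)) / ln 2 - k"
      by (simp add: log_divide log_nat_power) (simp add: log_def)
    show "real (k choose j) / 2 ^ k * log 2 (real (k choose j) / 2 ^ k)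
      = real (k choose j) * ln (real (k choose j)) / (2 ^ k * ln 2) - k * (real (k choose j) / 2 ^ k)"
      unfolding l by (simp add: algebra_simps)
  qed
  also have "\<dots> = binomial_log_sum k / (2 ^ k * ln 2) - k * ((\<Sum>j\<le>k. real (k choose j)) / 2 ^ k)"
    by (simp add: sum_subtractf sum_divide_distrib sum_distrib_left binomial_log_sum_def atLeast0AtMost)
  also have "(\<Sum>j\<le>k. real (k choose j)) = 2 ^ k"
    using choose_row_sum[of k] by (metis of_nat_sum of_nat_power of_nat_numeral)
  finally show ?thesis by (simp add: binomial_entropy_def)
qed

section \<open>Concavity of the binomial entropy in the number of trials\<close>

lemma sum_binomial_Suc:
  fixes \<phi> :: "nat \<Rightarrow> real"
  shows "(\<Sum>j\<le>k. real (k choose j) * (\<phi> j + \<phi> (Suc j))) = (\<Sum>i\<le>Suc k. real (Suc k choose i) * \<phi> i)"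
proof -
  have "(\<Sum>i\<le>Suc k. real (Suc k choose i) * \<phi> i)
    = \<phi> 0 + (\<Sum>j\<le>k. (real (k choose j) + real (k choose Suc j)) * \<phi> (Suc j))"
    by (subst sum.atMost_Suc_shift) simp
  also have "\<dots> = \<phi> 0 + (\<Sum>j\<le>k. real (k choose Suc j) * \<phi> (Suc j)) + (\<Sum>j\<le>k. real (k choose j) * \<phi> (Suc j))"
    by (simp add: sum.distrib algebra_simps)
  also have "\<phi> 0 + (\<Sum>j\<le>k. real (k choose Suc j) * \<phi> (Suc j)) = (\<Sum>j\<le>Suc k. real (k choose j) * \<phi> j)"
    by (subst sum.atMost_Suc_shift) simp
  also have "\<dots> = (\<Sum>j\<le>k. real (k choose j) * \<phi> j)" by simp
  finally show ?thesis by (simp add: sum.distrib algebra_simps)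
qed

text \<open>Divided by \<open>2 ^ (k + 2)\<close>, this is convexity of
  \<open>binomial_log_sum k / 2 ^ k\<close>, that is, concavity of the entropy. Pascal's rule
  rewrites all three sums over row \<open>k\<close>, and \<open>ln x \<le> x - 1\<close> removes the
  logarithms.\<close>

lemma binomial_log_sum_convex: "4 * binomial_log_sum (Suc k) \<le> binomial_log_sum (Suc (Suc k)) + 4 * binomial_log_sum k"
proof -
  define a where "a j = real (k choose j)" for j
  define b where "b j = real (Suc k choose j)" for j
  define c where "c j = real (Suc (Suc k) choose j)" for j
  have pos: "a j > 0" "b j > 0" "b (Suc j) > 0" "c j > 0" "c (Suc j) > 0" "c (Suc (Suc j)) > 0" if "j \<le> k" for j
    unfolding a_def b_def c_def using that by (simp_all only: of_nat_0_less_iff zero_less_binomial_iff)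
  have 1: "4 * binomial_log_sum (Suc k) = (\<Sum>j\<le>k. a j * (4 * (ln (b j) + ln (b (Suc j)))))"
    unfolding binomial_log_sum_def b_def a_def sum_binomial_Suc[where \<phi> = "\<lambda>j. ln (real (Suc k choose j))", symmetric]
      sum_distrib_left
    by (intro sum.cong refl) (simp only: mult_ac)
  have 2: "binomial_log_sum (Suc (Suc k)) = (\<Sum>j\<le>k. a j * (ln (c j) + 2 * ln (c (Suc j)) + ln (c (Suc (Suc j)))))"
    using sum_binomial_Suc[of "Suc k" "\<lambda>j. ln (c j)"] sum_binomial_Suc[of k "\<lambda>j. ln (c j) + ln (c (Suc j))"]
    by (simp add: binomial_log_sum_def a_def c_def add_ac del: binomial_Suc_Suc sum.atMost_Suc)
  have 3: "4 * binomial_log_sum k = (\<Sum>j\<le>k. a j * (4 * ln (a j)))"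
    by (simp add: binomial_log_sum_def a_def sum_distrib_left mult_ac)
  have bracket: "a j * (4 * (ln (b j) + ln (b (Suc j)))) - a j * (ln (c j) + 2 * ln (c (Suc j)) + ln (c (Suc (Suc j)))) - a j * (4 * ln (a j))
    \<le> b j * b j / c j + 2 * (b j * b (Suc j) / c (Suc j)) + b (Suc j) * b (Suc j) / c (Suc (Suc j)) - 4 * a j" if j: "j \<le> k" for j
  proof -
    have L: "a j * (ln x + ln y - ln z - ln (a j)) \<le> x * y / z - a j" if "x > 0" "y > 0" "z > 0" for x y z
    proof -
      have "ln x + ln y - ln z - ln (a j) = ln (x * y / (z * a j))"
        using that pos[OF j] by (simp add: ln_div ln_mult)
      also have "\<dots> \<le> x * y / (z * a j) - 1" using that pos[OF j] by (intro ln_le_minus_one) simp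
      finally have "a j * (ln x + ln y - ln z - ln (a j)) \<le> a j * (x * y / (z * a j) - 1)"
        using pos[OF j] by (intro mult_left_mono) auto
      also have "\<dots> = x * y / z - a j" using that pos[OF j] by (simp add: field_simps)
      finally show ?thesis .
    qed
    have "a j * (4 * (ln (b j) + ln (b (Suc j)))) - a j * (ln (c j) + 2 * ln (c (Suc j)) + ln (c (Suc (Suc j)))) - a j * (4 * ln (a j))
      = a j * (ln (b j) + ln (b j) - ln (c j) - ln (a j))
        + 2 * (a j * (ln (b j) + ln (b (Suc j)) - ln (c (Suc j)) - ln (a j)))
        + a j * (ln (b (Suc j)) + ln (b (Suc j)) - ln (c (Suc (Suc j))) - ln (a j))"
      by (simp add: algebra_simps)
    also have "\<dots> \<le> (b j * b j / c j - a j) + 2 * (b j * b (Suc j) / c (Suc j) - a j) + (b (Suc j) * b (Suc j) / c (Suc (Suc j)) - a j)"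
      using pos[OF j] by (intro add_mono mult_left_mono L) auto
    finally show ?thesis by simp
  qed
  \<comment> \<open>\<open>b'\<close> is the row \<open>b\<close> shifted by one, so Pascal's rule
    reads \<open>c i = b i + b' i\<close>; the three families then form a complete square over
    \<open>c i\<close>, and what is left is a row sum.\<close>
  define b' where "b' i = (case i of 0 \<Rightarrow> 0 | Suc j \<Rightarrow> b j)" for i
  define T1 where "T1 i = b i * b i / c i" for i
  define T2 where "T2 i = b i * b' i / c i" for i
  define T3 where "T3 i = b' i * b' i / c i" for i
  have nn: "0 \<le> b i" "0 \<le> b' i" "0 \<le> c i" for i by (auto simp: b_def b'_def c_def split: nat.split)
  have s1: "(\<Sum>j\<le>k. T1 j) \<le> (\<Sum>i\<le>Suc (Suc k). T1 i)"
    by (intro sum_mono2) (auto simp: T1_def nn)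
  have s2: "(\<Sum>j\<le>k. T2 (Suc j)) \<le> (\<Sum>i\<le>Suc (Suc k). T2 i)"
  proof -
    have "(\<Sum>j\<le>k. T2 (Suc j)) = (\<Sum>i\<in>Suc ` {..k}. T2 i)" by (simp add: sum.reindex)
    also have "\<dots> \<le> (\<Sum>i\<le>Suc (Suc k). T2 i)" by (intro sum_mono2) (auto simp: T2_def nn)
    finally show ?thesis .
  qed
  have s3: "(\<Sum>j\<le>k. T3 (Suc (Suc j))) \<le> (\<Sum>i\<le>Suc (Suc k). T3 i)"
  proof -
    have "(\<Sum>j\<le>k. T3 (Suc (Suc j))) = (\<Sum>i\<in>(\<lambda>j. Suc (Suc j)) ` {..k}. T3 i)" by (simp add: sum.reindex inj_on_def)
    also have "\<dots> \<le> (\<Sum>i\<le>Suc (Suc k). T3 i)" by (intro sum_mono2) (auto simp: T3_def nn)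
    finally show ?thesis .
  qed
  have cb: "T1 i + 2 * T2 i + T3 i = c i" if "i \<le> Suc (Suc k)" for i
  proof -
    have "c i = b i + b' i" by (cases i) (auto simp: c_def b_def b'_def)
    moreover have "c i > 0" using that by (simp add: c_def)
    moreover have "T1 i + 2 * T2 i + T3 i = (b i + b' i) * (b i + b' i) / c i"
      by (simp add: T1_def T2_def T3_def add_divide_distrib algebra_simps)
    ultimately show ?thesis by simp
  qed
  have "4 * binomial_log_sum (Suc k) - binomial_log_sum (Suc (Suc k)) - 4 * binomial_log_sum k
    = (\<Sum>j\<le>k. a j * (4 * (ln (b j) + ln (b (Suc j)))) - a j * (ln (c j) + 2 * ln (c (Suc j)) + ln (c (Suc (Suc j)))) - a j * (4 * ln (a j)))"
    unfolding 1 2 3 by (simp add: sum_subtractf)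
  also have "\<dots> \<le> (\<Sum>j\<le>k. T1 j + 2 * T2 (Suc j) + T3 (Suc (Suc j)) - 4 * a j)"
    using bracket by (intro sum_mono) (auto simp: T1_def T2_def T3_def b'_def mult.commute)
  also have "\<dots> = (\<Sum>j\<le>k. T1 j) + 2 * (\<Sum>j\<le>k. T2 (Suc j)) + (\<Sum>j\<le>k. T3 (Suc (Suc j))) - 4 * (\<Sum>j\<le>k. a j)"
    by (simp add: sum.distrib sum_subtractf sum_distrib_left)
  also have "\<dots> \<le> (\<Sum>i\<le>Suc (Suc k). T1 i) + 2 * (\<Sum>i\<le>Suc (Suc k). T2 i) + (\<Sum>i\<le>Suc (Suc k). T3 i) - 4 * (\<Sum>j\<le>k. a j)"
    using s1 s2 s3 by linarith
  also have "\<dots> = (\<Sum>i\<le>Suc (Suc k). T1 i + 2 * T2 i + T3 i) - 4 * (\<Sum>j\<le>k. a j)"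
    by (simp only: sum.distrib sum_distrib_left)
  also have "(\<Sum>i\<le>Suc (Suc k). T1 i + 2 * T2 i + T3 i) = (\<Sum>i\<le>Suc (Suc k). c i)"
    by (intro sum.cong refl cb) simp
  also have "\<dots> = 2 ^ Suc (Suc k)"
    unfolding c_def using choose_row_sum[of "Suc (Suc k)"] by (metis of_nat_sum of_nat_power of_nat_numeral)
  also have "(\<Sum>j\<le>k. a j) = 2 ^ k"
    unfolding a_def using choose_row_sum[of k] by (metis of_nat_sum of_nat_power of_nat_numeral)
  finally show ?thesis by simp
qed

text \<open>As \<open>binomial_entropy k = k - E k / ln 2\<close>, the claim is that
  \<open>E k / k\<close> increases strictly. It does so from 1 to 2, and convexity of
  \<open>E\<close> propagates this.\<close>

lemma binomial_entropy_ratio_Suc: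
  assumes k: "k \<ge> 1"
  shows "k * binomial_entropy (Suc k) < Suc k * binomial_entropy k"
proof -
  define E where "E k = binomial_log_sum k / 2 ^ k" for k
  have conv: "E (Suc (Suc k)) - E (Suc k) \<ge> E (Suc k) - E k" for k
  proof -
    have "E (Suc (Suc k)) - E (Suc k) - (E (Suc k) - E k)
      = (binomial_log_sum (Suc (Suc k)) + 4 * binomial_log_sum k - 4 * binomial_log_sum (Suc k)) / (4 * 2 ^ k)"
      by (simp add: E_def add_divide_distrib diff_divide_distrib)
    also have "\<dots> \<ge> 0" using binomial_log_sum_convex[of k] by (intro divide_nonneg_nonneg) auto
    finally show ?thesis by simp
  qed
  have pos: "real k * E (Suc k) - real (Suc k) * E k > 0"
    using k
  proof (induction k rule: dec_induct)
    case base
    have "E 1 = 0" "E 2 = ln 2 / 2"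
      by (simp_all add: E_def binomial_log_sum_def numeral_2_eq_2)
    moreover have "(0::real) < ln 2" by simp
    ultimately show ?case unfolding numeral_2_eq_2 One_nat_def by linarith
  next
    case (step m)
    have "real (Suc m) * E (Suc (Suc m)) - real (Suc (Suc m)) * E (Suc m)
      = (real m * E (Suc m) - real (Suc m) * E m) + real (Suc m) * ((E (Suc (Suc m)) - E (Suc m)) - (E (Suc m) - E m))"
      by (simp add: algebra_simps)
    moreover have "0 \<le> real (Suc m) * ((E (Suc (Suc m)) - E (Suc m)) - (E (Suc m) - E m))"
      using conv[of m] by (intro mult_nonneg_nonneg) auto
    ultimately show ?case using step by linarith
  qed
  have H: "binomial_entropy k = k - E k / ln 2" for k
    by (simp add: binomial_entropy_eq E_def)
  have "Suc k * binomial_entropy k - k * binomial_entropy (Suc k) = (real k * E (Suc k) - real (Suc k) * E k) / ln 2"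
    unfolding H by (simp add: algebra_simps diff_divide_distrib)
  also have "\<dots> > 0" using pos by simp
  finally show ?thesis by simp
qed

lemma binomial_entropy_ratio:
  assumes k: "1 \<le> k" "k < m"
  shows "k * binomial_entropy m < m * binomial_entropy k"
proof -
  have *: "binomial_entropy (Suc j) / Suc j < binomial_entropy j / j" if "j \<ge> 1" for j
    using binomial_entropy_ratio_Suc[OF that] that by (simp add: field_simps)
  have "binomial_entropy m / m < binomial_entropy k / k"
    using k(2)
  proof (induction m)
    case (Suc m)
    then show ?case using *[of m] k(1) by (cases "k = m") auto
  qed simp
  then show ?thesis using k by (simp add: field_simps)
qed

lemma binomial_entropy_pos:
  assumes "N \<ge> 1"
  shows "binomial_entropy N > 0"
proof -
  define b where "b j = real (N choose j) / 2 ^ N" for j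
  have le: "real (N choose j) \<le> 2 ^ N" for j
    using binomial_le_pow2[of N j] by (metis of_nat_le_iff of_nat_numeral of_nat_power)
  have "0 < - (b 0 * log 2 (b 0))"
    using assms by (simp add: b_def log_divide log_nat_power)
  also have "\<dots> \<le> (\<Sum>j=0..N. - (b j * log 2 (b j)))"
  proof (rule member_le_sum)
    fix j assume "j \<in> {0..N} - {0}"
    then have "0 < b j" "b j \<le> 1" using le by (auto simp: b_def divide_le_eq)
    then show "0 \<le> - (b j * log 2 (b j))" by (simp add: mult_nonneg_nonpos)
  qed auto
  finally show ?thesis by (simp add: binomial_entropy_def b_def sum_negf)
qed

section \<open>Large dimension of the cubes\<close>
text \<open>Homogeneity allows passing to the probability weight \<open>g powr q / s\<close>, the
  form in which the entropy bounds apply.\<close>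

lemma interval_ineq_of_normalized:
  assumes t: "t > 0" and p: "p \<ge> 1"
    and norm: "\<And>\<gamma> :: int \<Rightarrow> real. (\<And>x. 0 \<le> \<gamma> x) \<Longrightarrow> (\<And>x. x \<notin> {0..<int n} \<Longrightarrow> \<gamma> x = 0) \<Longrightarrow>
      (\<Sum>y\<in>{0..<int n}. \<gamma> y) = 1 \<Longrightarrow>
      interval_form n p d (\<lambda>_ _ x. \<gamma> x powr (t / real (p * 2 ^ d))) \<le> 1"
  shows "interval_ineq d p n t"
  unfolding interval_ineq_def
proof (intro allI impI)
  fix g :: "int \<Rightarrow> real"
  assume g: "\<forall>x. 0 \<le> g x" "\<forall>x. x \<notin> {0..<int n} \<longrightarrow> g x = 0"
  define m where "m = p * 2 ^ d"
  define q where "q = real m / t"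
  have m: "m > 0" "q > 0" using p t by (auto simp: m_def q_def)
  define s where "s = (\<Sum>y\<in>{0..<int n}. g y powr q)"
  have "interval_form n p d (\<lambda>_ _. g) \<le> s powr t"
  proof (cases "s = 0")
    case True
    then have "\<forall>y\<in>{0..<int n}. g y = 0" by (simp add: s_def sum_nonneg_eq_0_iff)
    then have "g y = 0" for y using g(2) by blast
    then have "g = (\<lambda>_. 0)" by blast
    then have "interval_form n p d (\<lambda>_ _. g) = 0 ^ p * (\<Sum>h\<in>{..<d} \<rightarrow>\<^sub>E {-int n<..<int n}. 1)"
      using p by (simp add: cube_form_def power_0_left Pow_not_empty)
    then show ?thesis using p by (simp add: power_0_left)
  next
    case False
    moreover have "s \<ge> 0" unfolding s_def by (intro sum_nonneg) auto
    ultimately have s: "s > 0" by simp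
    define \<gamma> where "\<gamma> y = g y powr q / s" for y
    have gy: "g y = s powr (1 / q) * \<gamma> y powr (t / real m)" for y
    proof -
      have "s powr (1 / q) * \<gamma> y powr (1 / q) = (g y powr q) powr (1 / q)"
        using s by (simp add: \<gamma>_def flip: powr_mult)
      also have "\<dots> = g y" using g(1) m by (simp add: powr_powr)
      finally show ?thesis by (simp add: q_def)
    qed
    have "interval_form n p d (\<lambda>_ _. g)
      = interval_form n p d (\<lambda>_ _ x. s powr (1 / q) * \<gamma> x powr (t / real m))"
      using gy by (intro cube_form_cong) auto
    also have "\<dots> = (s powr (1 / q)) ^ m * interval_form n p d (\<lambda>_ _ x. \<gamma> x powr (t / real m))"
      by (simp add: cube_form_scale[where c = "\<lambda>_ _. s powr (1 / q)"] m_def card_Pow mult.commute flip: power_mult)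
    also have "\<dots> \<le> (s powr (1 / q)) ^ m * 1"
    proof (intro mult_left_mono)
      have "(\<Sum>y\<in>{0..<int n}. \<gamma> y) = 1" using s by (simp add: \<gamma>_def s_def flip: sum_divide_distrib)
      then show "interval_form n p d (\<lambda>_ _ x. \<gamma> x powr (t / real m)) \<le> 1"
        unfolding m_def using g s m by (intro norm) (auto simp: \<gamma>_def)
    qed auto
    also have "(s powr (1 / q)) ^ m * 1 = s powr t"
      using s m t by (simp add: powr_powr q_def flip: powr_realpow)
    finally show ?thesis .
  qed
  then show "interval_form n p d (\<lambda>_ _. g) \<le> (\<Sum>y\<in>{0..<int n}. g y powr (real (p * 2 ^ d) / t)) powr t"
    by (simp only: s_def q_def m_def)
qed

definition support_on :: "nat \<Rightarrow> (nat \<Rightarrow> int) \<Rightarrow> nat set" where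
  "support_on d h = {j\<in>{..<d}. h j \<noteq> 0}"

lemma card_functions_with_support:
  fixes E :: "int set"
  assumes E: "finite E" "0 \<notin> E"
  shows "card {h\<in>{..<d} \<rightarrow>\<^sub>E insert 0 E. card (support_on d h) = k} = (d choose k) * card E ^ k"
proof -
  define \<J> where "\<J> = {J. J \<subseteq> {..<d} \<and> card J = k}"
  have "card {h\<in>{..<d} \<rightarrow>\<^sub>E insert 0 E. card (support_on d h) = k} = card (Sigma \<J> (\<lambda>J. J \<rightarrow>\<^sub>E E))"
  proof (rule bij_betw_same_card[OF bij_betw_byWitness])
    define f where "f h = (support_on d h, restrict h (support_on d h))" for h :: "nat \<Rightarrow> int"
    define g where "g = (\<lambda>(J, u). \<lambda>j\<in>{..<d}. if j \<in> J then u j else (0 :: int))"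
    show "\<forall>h\<in>{h\<in>{..<d} \<rightarrow>\<^sub>E insert 0 E. card (support_on d h) = k}. g (f h) = h"
      by (auto simp: f_def g_def support_on_def fun_eq_iff PiE_iff extensional_def)
    have supp: "support_on d (g (J, u)) = J" if "J \<in> \<J>" "u \<in> J \<rightarrow>\<^sub>E E" for J u
    proof -
      have "u j \<noteq> 0" if "j \<in> J" for j using \<open>u \<in> J \<rightarrow>\<^sub>E E\<close> that E(2) by (auto simp: PiE_iff)
      then show ?thesis using that(1) by (auto simp: support_on_def g_def \<J>_def)
    qed
    show "\<forall>v\<in>Sigma \<J> (\<lambda>J. J \<rightarrow>\<^sub>E E). f (g v) = v"
    proof
      fix v assume v: "v \<in> Sigma \<J> (\<lambda>J. J \<rightarrow>\<^sub>E E)"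
      obtain J u where Ju: "v = (J, u)" by (cases v)
      have J: "J \<in> \<J>" "u \<in> J \<rightarrow>\<^sub>E E" using v Ju by auto
      have "restrict (g (J, u)) J = u"
        using J by (auto simp: g_def fun_eq_iff PiE_iff extensional_def \<J>_def)
      then show "f (g v) = v" by (simp add: Ju f_def supp[OF J])
    qed
    show "f ` {h\<in>{..<d} \<rightarrow>\<^sub>E insert 0 E. card (support_on d h) = k} \<subseteq> Sigma \<J> (\<lambda>J. J \<rightarrow>\<^sub>E E)"
    proof (intro image_subsetI)
      fix h assume h: "h \<in> {h\<in>{..<d} \<rightarrow>\<^sub>E insert 0 E. card (support_on d h) = k}"
      have J: "support_on d h \<in> \<J>" using h by (auto simp: \<J>_def support_on_def)
      have "h j \<in> E" if "j \<in> support_on d h" for j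
        using h that by (auto simp: support_on_def PiE_iff)
      then have "restrict h (support_on d h) \<in> support_on d h \<rightarrow>\<^sub>E E" by simp
      then show "f h \<in> Sigma \<J> (\<lambda>J. J \<rightarrow>\<^sub>E E)" using J by (simp add: f_def)
    qed
    show "g ` Sigma \<J> (\<lambda>J. J \<rightarrow>\<^sub>E E) \<subseteq> {h\<in>{..<d} \<rightarrow>\<^sub>E insert 0 E. card (support_on d h) = k}"
    proof (intro image_subsetI)
      fix v assume v: "v \<in> Sigma \<J> (\<lambda>J. J \<rightarrow>\<^sub>E E)"
      obtain J u where Ju: "v = (J, u)" by (cases v)
      have J: "J \<in> \<J>" "u \<in> J \<rightarrow>\<^sub>E E" using v Ju by auto
      have "g (J, u) \<in> {..<d} \<rightarrow>\<^sub>E insert 0 E" using J(2) by (auto simp: g_def PiE_iff)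
      then show "g v \<in> {h\<in>{..<d} \<rightarrow>\<^sub>E insert 0 E. card (support_on d h) = k}"
        using J(1) by (simp add: Ju supp[OF J] \<J>_def)
    qed
  qed
  also have "\<dots> = (\<Sum>J\<in>\<J>. card (J \<rightarrow>\<^sub>E E))"
  proof (rule card_SigmaI)
    show "finite \<J>" by (auto simp: \<J>_def)
    show "\<forall>J\<in>\<J>. finite (J \<rightarrow>\<^sub>E E)"
    proof
      fix J assume "J \<in> \<J>"
      then have "finite J" unfolding \<J>_def by (auto intro: finite_subset[of J "{..<d}"])
      then show "finite (J \<rightarrow>\<^sub>E E)" using E by (intro finite_PiE)
    qed
  qed
  also have "\<dots> = (\<Sum>J\<in>\<J>. card E ^ k)"
    by (intro sum.cong refl) (auto simp: \<J>_def card_PiE finite_subset)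
  also have "\<dots> = (d choose k) * card E ^ k"
    using n_subsets[of "{..<d}" k] by (simp add: \<J>_def)
  finally show ?thesis .
qed

text \<open>
  \<open>face\<close> is the product over the vertices of a nondegenerate face of the cube \<open>(x, h)\<close>; the full
  cube consists of \<open>2 ^ (d - k)\<close> copies of it, where \<open>k\<close> is the number of nonzero directions.
\<close>

definition face :: "nat \<Rightarrow> (int \<Rightarrow> real) \<Rightarrow> (nat \<Rightarrow> int) \<Rightarrow> int \<Rightarrow> real" where
  "face d \<gamma> h x = (\<Prod>S\<in>Pow (support_on d h). \<gamma> (x + (\<Sum>j\<in>S. h j)))"

lemma finite_support_on [simp]: "finite (support_on d h)"
  by (simp add: support_on_def)

lemma card_support_on_le: "card (support_on d h) \<le> d"
  using card_mono[of "{..<d}" "support_on d h"] by (auto simp: support_on_def)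

text \<open>The \<open>2 ^ (d - k)\<close> copies of each vertex turn the exponent
  \<open>t / (p * 2 ^ d)\<close> into \<open>t / (p * 2 ^ k)\<close>, in which \<open>d\<close> no
  longer appears.\<close>

lemma interval_form_eq_faces:
  assumes p: "p \<ge> 1" and \<gamma>: "\<And>x. 0 \<le> \<gamma> x"
  shows "interval_form n p d (\<lambda>_ _ x. \<gamma> x powr (t / real (p * 2 ^ d))) =
    (\<Sum>h\<in>{..<d} \<rightarrow>\<^sub>E {-int n<..<int n}.
       (\<Sum>x\<in>{0..<int n}. face d \<gamma> h x powr (t / (real p * 2 ^ card (support_on d h)))) ^ p)"
  unfolding interval_form_eq_sum_power
proof (intro sum.cong refl arg_cong[where f = "\<lambda>z. z ^ p"])
  fix h x
  define k where "k = card (support_on d h)"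
  have kd: "k \<le> d" unfolding k_def by (rule card_support_on_le)
  have face0: "face d \<gamma> h x \<ge> 0" unfolding face_def using \<gamma> by (intro prod_nonneg) auto
  have "(\<Prod>S\<in>Pow {j\<in>{..<d}. h j \<noteq> 0}. \<gamma> (x + (\<Sum>j\<in>S. h j)) powr (t / real (p * 2 ^ d))) ^ 2 ^ (d - k)
    = (face d \<gamma> h x powr (t / real (p * 2 ^ d))) ^ 2 ^ (d - k)"
    unfolding face_def support_on_def using \<gamma> by (simp add: prod_powr_distrib)
  also have "\<dots> = face d \<gamma> h x powr (t / real (p * 2 ^ d) * real (2 ^ (d - k)))"
    unfolding powr_powr[symmetric] by (rule powr_realpow'[symmetric]) auto
  also have "t / real (p * 2 ^ d) * real (2 ^ (d - k)) = t / (real p * 2 ^ k)"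
  proof -
    have "(2::real) ^ d = 2 ^ (d - k) * 2 ^ k" using kd by (simp flip: power_add)
    then show ?thesis by simp
  qed
  finally show "(\<Prod>S\<in>Pow {j\<in>{..<d}. h j \<noteq> 0}. \<gamma> (x + (\<Sum>j\<in>S. h j)) powr (t / real (p * 2 ^ d)))
      ^ 2 ^ (d - card {j\<in>{..<d}. h j \<noteq> 0})
    = face d \<gamma> h x powr (t / (real p * 2 ^ card (support_on d h)))"
    by (simp only: k_def support_on_def)
qed

context
  fixes n d :: nat and \<gamma> :: "int \<Rightarrow> real"
  assumes \<gamma>0: "\<And>x. 0 \<le> \<gamma> x" and \<gamma>n: "\<And>x. x \<notin> {0..<int n} \<Longrightarrow> \<gamma> x = 0"
    and \<gamma>1: "(\<Sum>y\<in>{0..<int n}. \<gamma> y) = 1"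
begin

lemma face_nonneg: "0 \<le> face d \<gamma> h x"
  unfolding face_def using \<gamma>0 by (intro prod_nonneg) auto

lemma face_le_entropy:
  "face d \<gamma> h x \<le> 2 powr (- (2 ^ card (support_on d h) * binomial_entropy (card (support_on d h))))"
proof -
  have "face d \<gamma> h x \<le> (\<Prod>S\<in>Pow (support_on d h). real (card (support_on d h) choose card S) / 2 ^ card (support_on d h))"
    unfolding face_def prod_Pow_flip_signs[OF finite_support_on, where h = h]
    using \<gamma>0 \<gamma>n \<gamma>1 by (intro prod_subset_sums_le[where Y = "{0..<int n}"]) (auto simp: support_on_def)
  then show ?thesis by (simp add: prod_Pow_binomial_weights)
qed

text \<open>The lowest and the highest vertex of a contributing face must lie in the support of
  \<open>\<gamma>\<close>; this limits the total length of its directions to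
  \<open>n - 1\<close>.\<close>

lemma face_eq_0:
  assumes "face d \<gamma> h x \<noteq> 0"
  defines "J \<equiv> support_on d h"
  shows "0 \<le> x + (\<Sum>j\<in>{j\<in>J. h j < 0}. h j)"
    and "x + (\<Sum>j\<in>{j\<in>J. h j < 0}. h j) + (\<Sum>j\<in>J. \<bar>h j\<bar>) < int n"
proof -
  have fJ: "finite J" by (simp add: J_def)
  define y where "y = x + (\<Sum>j\<in>{j\<in>J. h j < 0}. h j)"
  have "face d \<gamma> h x = (\<Prod>S\<in>Pow J. \<gamma> (y + (\<Sum>j\<in>S. \<bar>h j\<bar>)))"
    unfolding face_def J_def[symmetric] y_def by (rule prod_Pow_flip_signs[OF fJ])
  then have "\<forall>S\<in>Pow J. \<gamma> (y + (\<Sum>j\<in>S. \<bar>h j\<bar>)) \<noteq> 0"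
    using assms(1) fJ by (simp add: prod_zero_iff)
  then have "\<gamma> (y + (\<Sum>j\<in>{}. \<bar>h j\<bar>)) \<noteq> 0" "\<gamma> (y + (\<Sum>j\<in>J. \<bar>h j\<bar>)) \<noteq> 0" by blast+
  then have "y \<in> {0..<int n}" "y + (\<Sum>j\<in>J. \<bar>h j\<bar>) \<in> {0..<int n}" using \<gamma>n by force+
  then show "0 \<le> y" "y + (\<Sum>j\<in>J. \<bar>h j\<bar>) < int n" by auto
qed

lemma card_le_sum_abs:
  fixes h :: "nat \<Rightarrow> int"
  shows "int (card (support_on d h)) \<le> (\<Sum>j\<in>support_on d h. \<bar>h j\<bar>)"
proof -
  have "int (card (support_on d h)) = (\<Sum>j\<in>support_on d h. 1)" by simp
  also have "\<dots> \<le> (\<Sum>j\<in>support_on d h. \<bar>h j\<bar>)" by (intro sum_mono) (auto simp: support_on_def)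
  finally show ?thesis .
qed

lemma face_eq_0_card:
  assumes "n \<le> card (support_on d h)"
  shows "face d \<gamma> h x = 0"
  using face_eq_0[of h x] card_le_sum_abs[of h] assms by force

text \<open>With \<open>n - 1\<close> nonzero directions there is no room left: each has length one
  and the lowest vertex is 0, which determines the base point.\<close>

lemma face_top:
  assumes k: "Suc (card (support_on d h)) = n" and nz: "face d \<gamma> h x \<noteq> 0"
  shows "x = - (\<Sum>j\<in>{j\<in>support_on d h. h j < 0}. h j)" and "\<And>j. j < d \<Longrightarrow> \<bar>h j\<bar> \<le> 1"
proof -
  define J where "J = support_on d h"
  have le: "(\<Sum>j\<in>J. \<bar>h j\<bar>) \<le> int (card J)" "0 \<le> x + (\<Sum>j\<in>{j\<in>J. h j < 0}. h j)"
    "x + (\<Sum>j\<in>{j\<in>J. h j < 0}. h j) + (\<Sum>j\<in>J. \<bar>h j\<bar>) < int n" "int (card J) \<le> (\<Sum>j\<in>J. \<bar>h j\<bar>)"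
    using face_eq_0[OF nz] k card_le_sum_abs[of h] by (auto simp: J_def)
  then show "x = - (\<Sum>j\<in>{j\<in>support_on d h. h j < 0}. h j)" using k by (auto simp: J_def)
  fix j assume j: "j < d"
  show "\<bar>h j\<bar> \<le> 1"
  proof (cases "j \<in> J")
    case True
    show ?thesis
    proof (rule ccontr)
      assume "\<not> ?thesis"
      then have "(\<Sum>j\<in>J. 1) < (\<Sum>j\<in>J. \<bar>h j\<bar>)"
        using True by (intro sum_strict_mono_ex1) (auto simp: J_def support_on_def intro!: bexI[of _ j])
      then show False using le(1) by simp
    qed
  next
    case False
    then show ?thesis using j by (simp add: J_def support_on_def)
  qed
qed

text \<open>A nonzero direction \<open>j\<close> pairs the vertices. The two ends of a pair are
  distinct, so one of them is not \<open>z\<close> and has weight at most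
  \<open>1 - \<gamma> z\<close>.\<close>

lemma face_le_concentrated:
  assumes z: "z \<in> {0..<int n}" and h: "support_on d h \<noteq> {}"
  shows "face d \<gamma> h x \<le> (1 - \<gamma> z) ^ 2 ^ (card (support_on d h) - 1)"
proof -
  define J where "J = support_on d h"
  obtain j where j: "j \<in> J" using h by (auto simp: J_def)
  have hj: "h j \<noteq> 0" using j by (simp add: J_def support_on_def)
  define J' where "J' = J - {j}"
  have J': "J = insert j J'" "j \<notin> J'" "finite J'" using j by (auto simp: J'_def J_def)
  have le1: "\<gamma> y \<le> 1" for y
  proof (cases "y \<in> {0..<int n}")
    case True
    then have "\<gamma> y \<le> (\<Sum>y\<in>{0..<int n}. \<gamma> y)" by (intro member_le_sum \<gamma>0) auto
    then show ?thesis using \<gamma>1 by simp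
  qed (simp add: \<gamma>n)
  have le\<delta>: "\<gamma> y \<le> 1 - \<gamma> z" if "y \<noteq> z" for y
  proof (cases "y \<in> {0..<int n}")
    case True
    have "\<gamma> y + \<gamma> z = (\<Sum>w\<in>{y, z}. \<gamma> w)" using that by simp
    also have "\<dots> \<le> (\<Sum>w\<in>{0..<int n}. \<gamma> w)" using True z \<gamma>0 by (intro sum_mono2) auto
    finally show ?thesis using \<gamma>1 by simp
  qed (use le1[of z] \<gamma>n in simp)
  have pair: "\<gamma> y * \<gamma> (y + h j) \<le> 1 - \<gamma> z" for y
  proof (cases "y = z")
    case True
    then have "\<gamma> (y + h j) \<le> 1 - \<gamma> z" using hj by (intro le\<delta>) auto
    then have "\<gamma> y * \<gamma> (y + h j) \<le> 1 * (1 - \<gamma> z)" using le1 \<gamma>0 by (intro mult_mono) auto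
    then show ?thesis by simp
  next
    case False
    then have "\<gamma> y * \<gamma> (y + h j) \<le> (1 - \<gamma> z) * 1" using le1 le\<delta>[OF False] \<gamma>0 le1[of z] by (intro mult_mono) auto
    then show ?thesis by simp
  qed
  have disj: "Pow J' \<inter> insert j ` Pow J' = {}" and inj: "inj_on (insert j) (Pow J')"
    using J'(2) by (auto simp: inj_on_def)
  have "face d \<gamma> h x = (\<Prod>S\<in>Pow J' \<union> insert j ` Pow J'. \<gamma> (x + (\<Sum>j\<in>S. h j)))"
    unfolding face_def J_def[symmetric] J'(1) Pow_insert ..
  also have "\<dots> = (\<Prod>S\<in>Pow J'. \<gamma> (x + (\<Sum>j\<in>S. h j)) * \<gamma> (x + (\<Sum>j\<in>insert j S. h j)))"
    using J'(3) disj inj by (simp add: prod.union_disjoint prod.reindex prod.distrib)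
  also have "\<dots> \<le> (\<Prod>S\<in>Pow J'. 1 - \<gamma> z)"
  proof (intro prod_mono conjI mult_nonneg_nonneg \<gamma>0)
    fix S assume S: "S \<in> Pow J'"
    then have "(\<Sum>j\<in>insert j S. h j) = h j + (\<Sum>j\<in>S. h j)"
      using J' by (subst sum.insert) (auto intro: finite_subset)
    then have e: "x + (\<Sum>j\<in>insert j S. h j) = (x + (\<Sum>j\<in>S. h j)) + h j" by simp
    show "\<gamma> (x + (\<Sum>j\<in>S. h j)) * \<gamma> (x + (\<Sum>j\<in>insert j S. h j)) \<le> 1 - \<gamma> z"
      unfolding e by (rule pair)
  qed
  also have "\<dots> = (1 - \<gamma> z) ^ 2 ^ (card J - 1)"
    using J' by (simp add: card_Pow)
  finally show ?thesis by (simp add: J_def)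
qed

lemma form_term_bound:
  assumes B: "\<And>x. face d \<gamma> h x \<le> B" and r: "r \<ge> 0" and B0: "B \<ge> 0"
  shows "(\<Sum>x\<in>{0..<int n}. face d \<gamma> h x powr r) ^ p \<le> (real n * B powr r) ^ p"
proof (rule power_mono)
  have "(\<Sum>x\<in>{0..<int n}. face d \<gamma> h x powr r) \<le> (\<Sum>x\<in>{0..<int n}. B powr r)"
    using r face_nonneg B by (intro sum_mono powr_mono2) auto
  then show "(\<Sum>x\<in>{0..<int n}. face d \<gamma> h x powr r) \<le> real n * B powr r" by simp
qed (intro sum_nonneg, simp)

text \<open>The cubes are grouped by the number \<open>k\<close> of nonzero directions. Crude counts
  of directions and base points suffice for \<open>k < N\<close>; for \<open>k = N\<close> the
  rigidity of \<open>face_top\<close> gives the exact constant. In the concentrated case the bound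
  for a face yields the same power \<open>t / 2\<close> for every \<open>k\<close>, and crude counts
  do throughout.\<close>

lemma
  assumes p: "p \<ge> 1" and n: "n \<ge> 2" and t: "t > 0"
  defines "N \<equiv> n - 1"
  shows form_le_spread: "interval_form n p d (\<lambda>_ _ x. \<gamma> x powr (t / real (p * 2 ^ d)))
    \<le> (\<Sum>x\<in>{0..<int n}. \<gamma> x powr (t / p)) ^ p
      + (\<Sum>k\<in>{1..<N}. real ((d choose k) * (2 * N) ^ k) * (real n ^ p * 2 powr (- (t * binomial_entropy k))))
      + real ((d choose N) * 2 ^ N) * 2 powr (- (t * binomial_entropy N))" (is ?spread)
    and form_le_concentrated: "z \<in> {0..<int n} \<Longrightarrow> interval_form n p d (\<lambda>_ _ x. \<gamma> x powr (t / real (p * 2 ^ d)))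
    \<le> (\<Sum>x\<in>{0..<int n}. \<gamma> x powr (t / p)) ^ p
      + (\<Sum>k\<in>{1..N}. real ((d choose k) * (2 * N) ^ k) * (real n ^ p * (1 - \<gamma> z) powr (t / 2)))"
proof -
  define D where "D = {..<d} \<rightarrow>\<^sub>E {-int n<..<int n}"
  define A where "A k = {h\<in>D. card (support_on d h) = k}" for k
  define T where "T h = (\<Sum>x\<in>{0..<int n}. face d \<gamma> h x powr (t / (real p * 2 ^ card (support_on d h)))) ^ p" for h
  define E where "E = {-int n<..<int n} - {0}"
  have E: "finite E" "0 \<notin> E" "insert 0 E = {-int n<..<int n}" using n by (auto simp: E_def)
  have cE: "card E = 2 * N"
    using n by (simp add: E_def N_def card_Diff_singleton)
  have finD: "finite D" unfolding D_def by (intro finite_PiE) auto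
  then have finA: "finite (A k)" for k by (simp add: A_def)
  have cA: "card (A k) = (d choose k) * (2 * N) ^ k" for k
    using card_functions_with_support[OF E(1,2), of d k] unfolding E(3) cE A_def D_def .
  have "interval_form n p d (\<lambda>_ _ x. \<gamma> x powr (t / real (p * 2 ^ d))) = (\<Sum>h\<in>D. T h)"
    unfolding interval_form_eq_faces[OF p \<gamma>0] D_def T_def ..
  also have "\<dots> = (\<Sum>h\<in>{h\<in>D. card (support_on d h) \<le> N}. T h)"
  proof (rule sum.mono_neutral_right[OF finD])
    show "\<forall>h\<in>D - {h \<in> D. card (support_on d h) \<le> N}. T h = 0"
    proof
      fix h assume "h \<in> D - {h \<in> D. card (support_on d h) \<le> N}"
      then have "n \<le> card (support_on d h)" by (auto simp: N_def)
      then show "T h = 0" using p by (simp add: T_def face_eq_0_card power_0_left)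
    qed
  qed auto
  also have "\<dots> = (\<Sum>k\<in>{..N}. \<Sum>h\<in>{h\<in>{h\<in>D. card (support_on d h) \<le> N}. card (support_on d h) = k}. T h)"
    using finD by (intro sum.group[symmetric]) auto
  also have "\<dots> = (\<Sum>k\<in>{..N}. \<Sum>h\<in>A k. T h)"
    by (intro sum.cong refl) (auto simp: A_def)
  also have "\<dots> = (\<Sum>h\<in>A 0. T h) + (\<Sum>k\<in>{1..N}. \<Sum>h\<in>A k. T h)"
  proof -
    have "{..N} = insert 0 {1..N}" by auto
    then show ?thesis by simp
  qed
  also have "(\<Sum>h\<in>A 0. T h) = (\<Sum>x\<in>{0..<int n}. \<gamma> x powr (t / p)) ^ p"
  proof -
    have "T h = (\<Sum>x\<in>{0..<int n}. \<gamma> x powr (t / p)) ^ p" if "h \<in> A 0" for h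
    proof -
      have "support_on d h = {}" using that by (simp add: A_def)
      then show ?thesis by (simp add: T_def face_def)
    qed
    moreover have "card (A 0) = 1" using cA[of 0] by simp
    ultimately show ?thesis by simp
  qed
  finally have form: "interval_form n p d (\<lambda>_ _ x. \<gamma> x powr (t / real (p * 2 ^ d)))
    = (\<Sum>x\<in>{0..<int n}. \<gamma> x powr (t / p)) ^ p + (\<Sum>k\<in>{1..N}. \<Sum>h\<in>A k. T h)" .
  have pw: "((2 powr (- (2 ^ k * H))) powr (t / (real p * 2 ^ k))) ^ p = 2 powr (- (t * H))" for k H
  proof -
    have "((2 powr (- (2 ^ k * H))) powr (t / (real p * 2 ^ k))) ^ p
      = ((2 powr (- (2 ^ k * H))) powr (t / (real p * 2 ^ k))) powr real p"
      using p by (intro powr_realpow'[symmetric]) auto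
    also have "\<dots> = 2 powr (- (t * H))" using p by (simp add: powr_powr mult_ac)
    finally show ?thesis .
  qed
  have mid: "(\<Sum>h\<in>A k. T h) \<le> real ((d choose k) * (2 * N) ^ k) * (real n ^ p * 2 powr (- (t * binomial_entropy k)))" for k
  proof -
    have "(\<Sum>h\<in>A k. T h) \<le> (\<Sum>h\<in>A k. real n ^ p * 2 powr (- (t * binomial_entropy k)))"
    proof (rule sum_mono)
      fix h assume "h \<in> A k"
      then have k: "card (support_on d h) = k" by (simp add: A_def)
      have "T h \<le> (real n * (2 powr (- (2 ^ k * binomial_entropy k))) powr (t / (real p * 2 ^ k))) ^ p"
        unfolding T_def k using t face_le_entropy[of h] unfolding k by (intro form_term_bound) auto
      also have "\<dots> = real n ^ p * 2 powr (- (t * binomial_entropy k))"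
        unfolding power_mult_distrib pw ..
      finally show "T h \<le> real n ^ p * 2 powr (- (t * binomial_entropy k))" .
    qed
    then show ?thesis by (simp add: cA)
  qed
  have top: "(\<Sum>h\<in>A N. T h) \<le> real ((d choose N) * 2 ^ N) * 2 powr (- (t * binomial_entropy N))"
  proof -
    define A' where "A' = {h\<in>{..<d} \<rightarrow>\<^sub>E insert 0 {-1, 1}. card (support_on d h) = N}"
    have A': "card A' = (d choose N) * 2 ^ N" "finite A'"
      using card_functions_with_support[of "{-1, 1}" d N]
      by (simp_all add: A'_def numeral_2_eq_2 finite_PiE)
    have "A' \<subseteq> A N"
    proof -
      have "insert 0 {-1, 1} \<subseteq> {-int n<..<int n}" using n by auto
      then show ?thesis unfolding A'_def A_def D_def using PiE_mono by blast
    qed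
    have T0: "T h = 0" if h: "h \<in> A N - A'" for h
    proof -
      have k: "Suc (card (support_on d h)) = n" using h n by (auto simp: A_def N_def)
      have "h \<notin> {..<d} \<rightarrow>\<^sub>E insert 0 {-1, 1}" using h by (auto simp only: A'_def A_def mem_Collect_eq Diff_iff)
      moreover have "h \<in> extensional {..<d}" using h by (simp add: A_def D_def PiE_iff)
      ultimately obtain j where j: "j < d" "h j \<notin> {-1, 0, 1}" by (auto simp: PiE_iff)
      then have "\<not> \<bar>h j\<bar> \<le> 1" by (auto simp: abs_le_iff)
      then have "face d \<gamma> h x = 0" for x using face_top(2)[OF k _ j(1)] by blast
      then show ?thesis using p by (simp add: T_def power_0_left)
    qed
    have T1: "T h \<le> 2 powr (- (t * binomial_entropy N))" if h: "h \<in> A'" for h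
    proof -
      have N: "card (support_on d h) = N" using h by (simp add: A'_def)
      have k: "Suc (card (support_on d h)) = n" using N n by (auto simp: N_def)
      define x0 where "x0 = - (\<Sum>j\<in>{j\<in>support_on d h. h j < 0}. h j)"
      define r where "r = t / (real p * 2 ^ N)"
      \<comment> \<open>Inserting \<open>x0\<close> spares checking that it lies in the interval; by
        \<open>face_top\<close> no other base point contributes.\<close>
      have "(\<Sum>x\<in>{0..<int n}. face d \<gamma> h x powr r) \<le> (\<Sum>x\<in>insert x0 {0..<int n}. face d \<gamma> h x powr r)"
        by (intro sum_mono2) auto
      also have "\<dots> = (\<Sum>x\<in>{x0}. face d \<gamma> h x powr r)"
        using face_top(1)[OF k] by (intro sum.mono_neutral_right) (auto simp: x0_def)
      also have "\<dots> \<le> (2 powr (- (2 ^ N * binomial_entropy N))) powr r"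
        using face_le_entropy[of h x0] face_nonneg t unfolding N by (simp add: powr_mono2 r_def)
      finally have "T h \<le> ((2 powr (- (2 ^ N * binomial_entropy N))) powr r) ^ p"
        unfolding T_def N r_def[symmetric] by (intro power_mono sum_nonneg) auto
      then show ?thesis unfolding r_def pw .
    qed
    have "(\<Sum>h\<in>A N. T h) = (\<Sum>h\<in>A'. T h)"
      using T0 \<open>A' \<subseteq> A N\<close> finA by (intro sum.mono_neutral_right) auto
    also have "\<dots> \<le> (\<Sum>h\<in>A'. 2 powr (- (t * binomial_entropy N)))" by (rule sum_mono) (rule T1)
    finally show ?thesis by (simp add: A')
  qed
  show ?spread
  proof -
    have "{1..N} = insert N {1..<N}" using n by (auto simp: N_def)
    then have "(\<Sum>k\<in>{1..N}. \<Sum>h\<in>A k. T h) = (\<Sum>k\<in>{1..<N}. \<Sum>h\<in>A k. T h) + (\<Sum>h\<in>A N. T h)" by simp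
    also have "\<dots> \<le> (\<Sum>k\<in>{1..<N}. real ((d choose k) * (2 * N) ^ k) * (real n ^ p * 2 powr (- (t * binomial_entropy k))))
      + real ((d choose N) * 2 ^ N) * 2 powr (- (t * binomial_entropy N))"
      by (intro add_mono sum_mono mid top)
    finally show ?thesis unfolding form by simp
  qed
  assume z: "z \<in> {0..<int n}"
  have "\<gamma> z \<le> (\<Sum>y\<in>{0..<int n}. \<gamma> y)" using z by (intro member_le_sum \<gamma>0) auto
  then have \<delta>0: "0 \<le> 1 - \<gamma> z" using \<gamma>1 by simp
  show "interval_form n p d (\<lambda>_ _ x. \<gamma> x powr (t / real (p * 2 ^ d)))
    \<le> (\<Sum>x\<in>{0..<int n}. \<gamma> x powr (t / p)) ^ p
      + (\<Sum>k\<in>{1..N}. real ((d choose k) * (2 * N) ^ k) * (real n ^ p * (1 - \<gamma> z) powr (t / 2)))"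
    unfolding form
  proof (intro add_left_mono sum_mono)
    fix k assume k1: "k \<in> {1..N}"
    have "(\<Sum>h\<in>A k. T h) \<le> (\<Sum>h\<in>A k. real n ^ p * (1 - \<gamma> z) powr (t / 2))"
    proof (rule sum_mono)
      fix h assume "h \<in> A k"
      then have k: "card (support_on d h) = k" by (simp add: A_def)
      have ne: "support_on d h \<noteq> {}" using k k1 by auto
      have "T h \<le> (real n * ((1 - \<gamma> z) ^ 2 ^ (k - 1)) powr (t / (real p * 2 ^ k))) ^ p"
        unfolding T_def k using t \<delta>0 face_le_concentrated[OF z ne] unfolding k by (intro form_term_bound) auto
      also have "\<dots> = real n ^ p * (((1 - \<gamma> z) ^ 2 ^ (k - 1)) powr (t / (real p * 2 ^ k))) ^ p"
        by (rule power_mult_distrib)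
      also have "(((1 - \<gamma> z) ^ 2 ^ (k - 1)) powr (t / (real p * 2 ^ k))) ^ p = (1 - \<gamma> z) powr (t / 2)"
      proof -
        have "(((1 - \<gamma> z) ^ 2 ^ (k - 1)) powr (t / (real p * 2 ^ k))) ^ p
          = (((1 - \<gamma> z) powr real (2 ^ (k - 1))) powr (t / (real p * 2 ^ k))) powr real p"
          using p \<delta>0 by (subst powr_realpow') (auto intro: powr_realpow'[symmetric])
        also have "\<dots> = (1 - \<gamma> z) powr (real (2 ^ (k - 1)) * (t / (real p * 2 ^ k)) * real p)"
          by (simp only: powr_powr mult.assoc)
        also have "real (2 ^ (k - 1)) * (t / (real p * 2 ^ k)) * real p = t / 2"
        proof -
          have "(2::real) ^ k = 2 ^ (k - 1) * 2" using k1 by (cases k) auto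
          then show ?thesis using p by simp
        qed
        finally show ?thesis .
      qed
      finally show "T h \<le> real n ^ p * (1 - \<gamma> z) powr (t / 2)" .
    qed
    then show "(\<Sum>h\<in>A k. T h) \<le> real ((d choose k) * (2 * N) ^ k) * (real n ^ p * (1 - \<gamma> z) powr (t / 2))"
      by (simp add: cA)
  qed
qed

end

section \<open>Asymptotics in the number of directions\<close>

lemma power_times_powr_tendsto_0:
  fixes \<rho> \<alpha> \<beta> :: real
  assumes \<rho>: "\<rho> > 0" and neg: "real k + \<alpha> * ln \<rho> < 0"
  shows "(\<lambda>d. real d ^ k * \<rho> powr (\<alpha> * ln (real d) + \<beta>)) \<longlonglongrightarrow> 0"
proof -
  have "(\<lambda>d. \<rho> powr \<beta> * real d powr (real k + \<alpha> * ln \<rho>)) \<longlonglongrightarrow> \<rho> powr \<beta> * 0"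
    by (intro tendsto_mult tendsto_const tendsto_neg_powr neg filterlim_real_sequentially)
  moreover have "\<forall>\<^sub>F d in sequentially. \<rho> powr \<beta> * real d powr (real k + \<alpha> * ln \<rho>)
    = real d ^ k * \<rho> powr (\<alpha> * ln (real d) + \<beta>)"
    using eventually_ge_at_top[of 1]
  proof eventually_elim
    case (elim d)
    then have "real d ^ k = real d powr real k" by (simp add: powr_realpow)
    moreover have "\<rho> powr (\<alpha> * ln (real d)) = real d powr (\<alpha> * ln \<rho>)"
      using \<rho> elim by (simp add: powr_def mult_ac)
    ultimately show ?case by (simp add: powr_add)
  qed
  ultimately show ?thesis by (simp add: Lim_transform_eventually)
qed

lemma sum_powr_le_max:
  fixes \<gamma> :: "'a \<Rightarrow> real"
  assumes X: "finite X" and \<gamma>: "\<And>y. y \<in> X \<Longrightarrow> 0 \<le> \<gamma> y" "\<And>y. y \<in> X \<Longrightarrow> \<gamma> y \<le> M" and \<tau>: "\<tau> \<ge> 1"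
  shows "(\<Sum>y\<in>X. \<gamma> y powr \<tau>) \<le> M powr (\<tau> - 1) * (\<Sum>y\<in>X. \<gamma> y)"
  unfolding sum_distrib_left
proof (rule sum_mono)
  fix y assume y: "y \<in> X"
  have "\<gamma> y powr \<tau> = \<gamma> y powr (\<tau> - 1) * \<gamma> y"
    using \<gamma>(1)[OF y] by (cases "\<gamma> y = 0") (auto simp: powr_diff)
  also have "\<dots> \<le> M powr (\<tau> - 1) * \<gamma> y"
    using \<gamma> y \<tau> by (intro mult_right_mono powr_mono2) auto
  finally show "\<gamma> y powr \<tau> \<le> M powr (\<tau> - 1) * \<gamma> y" .
qed

text \<open>If all weights are at most \<open>1 - \<delta>0\<close>, the degenerate cubes are
  negligible and \<open>spread\<close> applies. Otherwise they contribute at most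
  \<open>1 - \<delta>\<close>, because \<open>\<tau> \<ge> 2\<close> and
  \<open>\<delta> \<le> 1 / 2\<close>; the others carry \<open>\<delta> powr (t / 2)\<close>, and
  taking out one factor \<open>\<delta>\<close> fits them into the remaining room
  \<open>\<delta>\<close>.\<close>

lemma normalized_form_le_1:
  fixes \<gamma> :: "int \<Rightarrow> real" and t \<delta>0 :: real
  assumes p: "p \<ge> 1" and n: "n \<ge> 2" and t: "t \<ge> 2 * p"
    and \<gamma>: "\<And>x. 0 \<le> \<gamma> x" "\<And>x. x \<notin> {0..<int n} \<Longrightarrow> \<gamma> x = 0" "(\<Sum>y\<in>{0..<int n}. \<gamma> y) = 1"
    and \<delta>0: "0 < \<delta>0" "\<delta>0 \<le> 1 / 2"
  defines "N \<equiv> n - 1"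
  assumes spread: "(1 - \<delta>0) powr (t - p)
      + (\<Sum>k\<in>{1..<N}. real ((d choose k) * (2 * N) ^ k) * (real n ^ p * 2 powr (- (t * binomial_entropy k))))
      + real ((d choose N) * 2 ^ N) * 2 powr (- (t * binomial_entropy N)) \<le> 1"
    and conc: "(\<Sum>k\<in>{1..N}. real ((d choose k) * (2 * N) ^ k) * (real n ^ p * \<delta>0 powr (t / 2 - 1))) \<le> 1"
  shows "interval_form n p d (\<lambda>_ _ x. \<gamma> x powr (t / real (p * 2 ^ d))) \<le> 1"
proof -
  define X where "X = {0..<int n}"
  have fX: "finite X" by (simp add: X_def)
  define \<tau> where "\<tau> = t / p"
  have \<tau>: "\<tau> \<ge> 2" "\<tau> * p = t" using p t by (auto simp: \<tau>_def field_simps)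
  have t0: "t > 0" "t \<ge> 2" using p t by (auto intro: order_trans[of 2 "2 * real p"])
  show ?thesis
  proof (cases "\<forall>y\<in>X. \<gamma> y \<le> 1 - \<delta>0")
    case True
    have "(\<Sum>y\<in>X. \<gamma> y powr \<tau>) \<le> (1 - \<delta>0) powr (\<tau> - 1)"
      using sum_powr_le_max[OF fX, of \<gamma> "1 - \<delta>0" \<tau>] True \<gamma> \<tau> by (simp add: X_def)
    then have "(\<Sum>y\<in>X. \<gamma> y powr \<tau>) ^ p \<le> ((1 - \<delta>0) powr (\<tau> - 1)) ^ p"
      by (intro power_mono sum_nonneg) auto
    also have "\<dots> = ((1 - \<delta>0) powr (\<tau> - 1)) powr real p" using p by (intro powr_realpow'[symmetric]) auto
    also have "\<dots> = (1 - \<delta>0) powr (t - p)" using \<tau> by (simp add: powr_powr left_diff_distrib)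
    finally show ?thesis
      using form_le_spread[OF \<gamma> p n t0(1), of d] spread by (simp add: X_def \<tau>_def N_def)
  next
    case False
    then obtain z where z: "z \<in> X" "1 - \<delta>0 < \<gamma> z" by (auto simp: not_le)
    define \<delta> where "\<delta> = 1 - \<gamma> z"
    have rest: "(\<Sum>y\<in>X - {z}. \<gamma> y) = \<delta>" using \<gamma>(3) z fX by (simp add: \<delta>_def X_def sum_diff1)
    have \<delta>: "0 \<le> \<delta>" "\<delta> < \<delta>0" using rest z \<gamma>(1) sum_nonneg[of "X - {z}" \<gamma>] by (auto simp: \<delta>_def)
    have "(\<Sum>y\<in>X. \<gamma> y powr \<tau>) = \<gamma> z powr \<tau> + (\<Sum>y\<in>X - {z}. \<gamma> y powr \<tau>)"
      using fX z by (simp add: sum.remove)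
    also have "\<dots> \<le> (1 - \<delta>) powr 2 + \<delta> powr 2"
    proof (rule add_mono)
      show "\<gamma> z powr \<tau> \<le> (1 - \<delta>) powr 2"
      proof -
        have "\<gamma> z = 1 - \<delta>" by (simp add: \<delta>_def)
        then show ?thesis using \<tau>(1) \<delta> \<delta>0 by (simp only:) (intro powr_mono', auto)
      qed
      have "(\<Sum>y\<in>X - {z}. \<gamma> y powr \<tau>) \<le> \<delta> powr (\<tau> - 1) * (\<Sum>y\<in>X - {z}. \<gamma> y)"
      proof (rule sum_powr_le_max)
        fix y assume "y \<in> X - {z}"
        then show "\<gamma> y \<le> \<delta>" unfolding rest[symmetric] using fX \<gamma>(1) by (intro member_le_sum) auto
      qed (use fX \<gamma> \<tau> in auto)
      also have "\<dots> \<le> \<delta> powr 1 * \<delta>"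
        unfolding rest using \<tau> \<delta> \<delta>0 by (intro mult_right_mono powr_mono') auto
      also have "\<dots> = \<delta> powr 2" using \<delta> by (simp add: power2_eq_square)
      finally show "(\<Sum>y\<in>X - {z}. \<gamma> y powr \<tau>) \<le> \<delta> powr 2" .
    qed
    also have "\<dots> = 1 - \<delta> - \<delta> * (1 - 2 * \<delta>)"
      using \<delta> \<delta>0 by (simp add: power2_eq_square algebra_simps)
    also have "\<dots> \<le> 1 - \<delta>" using \<delta> \<delta>0 by simp
    finally have "(\<Sum>y\<in>X. \<gamma> y powr \<tau>) ^ p \<le> (1 - \<delta>) ^ p" by (intro power_mono sum_nonneg) auto
    also have "\<dots> \<le> (1 - \<delta>) ^ 1" using p \<delta> \<delta>0 by (intro power_decreasing) auto
    finally have main: "(\<Sum>y\<in>X. \<gamma> y powr \<tau>) ^ p \<le> 1 - \<delta>" by simp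
    have "\<delta> powr (t / 2) \<le> \<delta> * \<delta>0 powr (t / 2 - 1)"
    proof (cases "\<delta> = 0")
      case False
      then have "\<delta> powr (t / 2) = \<delta> * \<delta> powr (t / 2 - 1)" using \<delta> by (simp add: powr_diff)
      also have "\<dots> \<le> \<delta> * \<delta>0 powr (t / 2 - 1)" using \<delta> t0 by (intro mult_left_mono powr_mono2) auto
      finally show ?thesis .
    qed simp
    then have "(\<Sum>k\<in>{1..N}. real ((d choose k) * (2 * N) ^ k) * (real n ^ p * \<delta> powr (t / 2)))
      \<le> (\<Sum>k\<in>{1..N}. real ((d choose k) * (2 * N) ^ k) * (real n ^ p * (\<delta> * \<delta>0 powr (t / 2 - 1))))"
      by (intro sum_mono mult_left_mono) auto
    also have "\<dots> = \<delta> * (\<Sum>k\<in>{1..N}. real ((d choose k) * (2 * N) ^ k) * (real n ^ p * \<delta>0 powr (t / 2 - 1)))"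
      by (simp add: sum_distrib_left mult_ac)
    also have "\<dots> \<le> \<delta> * 1" using conc \<delta> by (intro mult_left_mono)
    finally have "(\<Sum>k\<in>{1..N}. real ((d choose k) * (2 * N) ^ k) * (real n ^ p * \<delta> powr (t / 2))) \<le> \<delta>" by simp
    then show ?thesis
      using form_le_concentrated[OF \<gamma> p n t0(1), of z d] z main by (simp add: X_def \<tau>_def N_def \<delta>_def)
  qed
qed

theorem t_exp_upper_dimension:
  fixes \<epsilon> :: real
  assumes n: "n \<ge> 2" and p: "p \<ge> 1" and \<epsilon>: "\<epsilon> > 0"
  shows "\<forall>\<^sub>F d in sequentially. t_exp d p n \<le>
    (real (n - 1) * log 2 (2 * real d) - log 2 (fact (n - 1))) / binomial_entropy (n - 1) + \<epsilon>"
proof -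
  define N where "N = n - 1"
  have N: "N \<ge> 1" using n by (simp add: N_def)
  define H where "H = binomial_entropy N"
  have H: "H > 0" unfolding H_def using N by (rule binomial_entropy_pos)
  \<comment> \<open>The claimed exponent plus \<open>\<epsilon>\<close>, rewritten as
    \<open>\<alpha> * ln d + \<beta>\<close>, so that a constant raised to it is a power of
    \<open>d\<close> up to a constant.\<close>
  define \<alpha> where "\<alpha> = N / (H * ln 2)"
  define \<beta> where "\<beta> = (N - log 2 (fact N)) / H + \<epsilon>"
  define t where "t d = \<alpha> * ln (real d) + \<beta>" for d
  have \<alpha>: "\<alpha> > 0" using N H by (simp add: \<alpha>_def)
  have t_eq: "t d = (real N * log 2 (2 * real d) - log 2 (fact N)) / H + \<epsilon>" if "d \<ge> 1" for d
    using that H by (simp add: t_def \<alpha>_def \<beta>_def log_mult field_simps) (simp add: log_def field_simps)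
  \<comment> \<open>Chosen so that \<open>\<delta>0 powr (t d / 2)\<close> decays like
    \<open>d\<close> to the power \<open>- N * (2 + 1 / (2 * H))\<close>, faster than every count
    \<open>d ^ k\<close> with \<open>k \<le> N\<close> grows; the summand 1 gives
    \<open>\<delta>0 \<le> 1 / 2\<close>.\<close>
  define \<delta>0 where "\<delta>0 = 2 powr (- (4 * H + 1))"
  have \<delta>0: "0 < \<delta>0" "\<delta>0 \<le> 1 / 2"
  proof -
    have "\<delta>0 \<le> 2 powr (- 1)" unfolding \<delta>0_def using H by (intro powr_mono) auto
    then show "\<delta>0 \<le> 1 / 2" by (simp add: powr_minus)
  qed (simp add: \<delta>0_def)
  define P where "P k d = real d ^ k * ((2 * N) ^ k * real n ^ p)" for k d
  have choose_le: "real ((d choose k) * (2 * N) ^ k) * (real n ^ p * y) \<le> P k d * y" if "y \<ge> 0" for d k y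
  proof -
    have "d choose k \<le> (d choose k) * fact k" by simp
    also have "\<dots> \<le> d ^ k" by (rule binomial_fact_pow)
    finally have "real (d choose k) \<le> real d ^ k" by (metis of_nat_le_iff of_nat_power)
    then have "real (d choose k) * ((2 * N) ^ k * real n ^ p * y) \<le> real d ^ k * ((2 * N) ^ k * real n ^ p * y)"
      using that by (intro mult_right_mono) auto
    then show ?thesis by (simp add: P_def mult_ac)
  qed
  have lim1: "(\<lambda>d. (1 - \<delta>0) powr (t d - p)) \<longlonglongrightarrow> 0"
  proof -
    have "ln (1 - \<delta>0) < 0" using \<delta>0 by simp
    then have "real 0 + \<alpha> * ln (1 - \<delta>0) < 0" using \<alpha> by (simp add: mult_pos_neg)
    then show ?thesis
      using power_times_powr_tendsto_0[of "1 - \<delta>0" 0 \<alpha> "\<beta> - p"] \<delta>0 by (simp add: t_def add_diff_eq)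
  qed
  \<comment> \<open>Up to constants, the cubes with \<open>k\<close> nonzero directions contribute
    \<open>d\<close> to the power \<open>k - N * binomial_entropy k / H\<close>, which is negative
    by \<open>binomial_entropy_ratio\<close>.\<close>
  have lim2: "(\<lambda>d. P k d * 2 powr (- (t d * binomial_entropy k))) \<longlonglongrightarrow> 0" if k: "k \<in> {1..<N}" for k
  proof -
    have "real k * H < real N * binomial_entropy k"
      unfolding H_def using k by (intro binomial_entropy_ratio) auto
    then have "real k + \<alpha> * ln (2 powr (- binomial_entropy k)) < 0"
      using H by (simp add: \<alpha>_def field_simps)
    then have "(\<lambda>d. real d ^ k * (2 powr (- binomial_entropy k)) powr t d) \<longlonglongrightarrow> 0"
      unfolding t_def by (intro power_times_powr_tendsto_0) auto
    then have "(\<lambda>d. ((2 * N) ^ k * real n ^ p) * (real d ^ k * (2 powr (- binomial_entropy k)) powr t d)) \<longlonglongrightarrow> ((2 * N) ^ k * real n ^ p) * 0"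
      by (rule tendsto_mult_left)
    then show ?thesis by (simp add: P_def powr_powr mult_ac)
  qed
  have lim3: "(\<lambda>d. P k d * \<delta>0 powr (t d / 2 - 1)) \<longlonglongrightarrow> 0" if k: "k \<in> {1..N}" for k
  proof -
    have "ln (\<delta>0 powr (1 / 2)) = - ((4 * H + 1) / 2 * ln 2)" by (simp add: \<delta>0_def algebra_simps)
    then have "\<alpha> * ln (\<delta>0 powr (1 / 2)) = \<alpha> * - ((4 * H + 1) / 2 * ln 2)" by (rule arg_cong)
    also have "\<dots> = - (real N * (2 + 1 / (2 * H)))" using H by (simp add: \<alpha>_def field_simps)
    finally have "real k + \<alpha> * ln (\<delta>0 powr (1 / 2)) = real k - real N * (2 + 1 / (2 * H))" by simp
    also have "\<dots> \<le> real N - real N * (2 + 1 / (2 * H))" using k by simp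
    also have "\<dots> = - (real N * (1 + 1 / (2 * H)))" by (simp add: algebra_simps)
    also have "\<dots> < 0" using N H by (simp add: add_pos_pos)
    finally have "(\<lambda>d. real d ^ k * (\<delta>0 powr (1 / 2)) powr (\<alpha> * ln (real d) + (\<beta> - 2))) \<longlonglongrightarrow> 0"
      using \<delta>0 by (intro power_times_powr_tendsto_0) auto
    then have "(\<lambda>d. ((2 * N) ^ k * real n ^ p) * (real d ^ k * (\<delta>0 powr (1 / 2)) powr (\<alpha> * ln (real d) + (\<beta> - 2)))) \<longlonglongrightarrow> ((2 * N) ^ k * real n ^ p) * 0"
      by (rule tendsto_mult_left)
    moreover have "(\<delta>0 powr (1 / 2)) powr (\<alpha> * ln (real d) + (\<beta> - 2)) = \<delta>0 powr (t d / 2 - 1)" for d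
      unfolding powr_powr by (rule arg_cong) (simp add: t_def field_simps)
    ultimately show ?thesis by (simp add: P_def mult_ac)
  qed
  have "(\<lambda>d. (1 - \<delta>0) powr (t d - p) + (\<Sum>k\<in>{1..<N}. P k d * 2 powr (- (t d * binomial_entropy k)))) \<longlonglongrightarrow> 0 + (\<Sum>k\<in>{1..<N}. 0)"
    by (intro tendsto_add tendsto_sum lim1 lim2)
  \<comment> \<open>The cubes with \<open>N\<close> nonzero directions contribute at most this
    constant below 1; the vanishing terms must fit into the gap.\<close>
  moreover have "2 powr (- (\<epsilon> * H)) < 2 powr 0" using \<epsilon> H by (intro powr_less_mono) auto
  ultimately have ev1: "\<forall>\<^sub>F d in sequentially. (1 - \<delta>0) powr (t d - p)
    + (\<Sum>k\<in>{1..<N}. P k d * 2 powr (- (t d * binomial_entropy k))) < 1 - 2 powr (- (\<epsilon> * H))"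
    by (intro order_tendstoD(2)) auto
  have "(\<lambda>d. \<Sum>k\<in>{1..N}. P k d * \<delta>0 powr (t d / 2 - 1)) \<longlonglongrightarrow> (\<Sum>k\<in>{1..N}. 0)"
    by (intro tendsto_sum lim3)
  then have ev2: "\<forall>\<^sub>F d in sequentially. (\<Sum>k\<in>{1..N}. P k d * \<delta>0 powr (t d / 2 - 1)) < 1"
    by (intro order_tendstoD(2)) auto
  have "filterlim (\<lambda>d. ln (real d)) at_top sequentially" by real_asymp
  then have "filterlim (\<lambda>d. \<beta> + \<alpha> * ln (real d)) at_top sequentially"
    by (intro filterlim_tendsto_add_at_top[OF tendsto_const] filterlim_tendsto_pos_mult_at_top[OF tendsto_const \<alpha>])
  then have "\<forall>\<^sub>F d in sequentially. 2 * real p \<le> \<beta> + \<alpha> * ln (real d)"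
    by (simp add: filterlim_at_top)
  then show ?thesis
    using ev1 ev2 eventually_ge_at_top[of 1]
  proof eventually_elim
    case (elim d)
    have td: "2 * real p \<le> t d" using elim(1) by (simp add: t_def)
    then have t0: "t d > 0" using p by (auto intro: less_le_trans[of 0 "2 * real p"])
    have top: "real ((d choose N) * 2 ^ N) * 2 powr (- (t d * H)) \<le> 2 powr (- (\<epsilon> * H))"
    proof -
      have "2 powr (- (t d * H)) = 2 powr (- (real N * log 2 (2 * real d)) + log 2 (fact N) - \<epsilon> * H)"
      proof -
        have "t d * H = (real N * log 2 (2 * real d) - log 2 (fact N)) + \<epsilon> * H"
          using H unfolding t_eq[OF elim(4)] by (simp add: distrib_right)
        then show ?thesis by simp
      qed
      also have "\<dots> = (2 powr (log 2 (2 * real d))) powr (- real N) * 2 powr log 2 (fact N) * 2 powr (- (\<epsilon> * H))"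
        by (simp add: powr_add powr_diff powr_powr powr_minus_divide mult_ac)
      also have "\<dots> = (2 * real d) powr (- real N) * fact N * 2 powr (- (\<epsilon> * H))"
        using elim(4) by simp
      also have "(2 * real d) powr (- real N) = 1 / (2 ^ N * real d ^ N)"
        using elim(4) by (simp add: powr_minus_divide powr_realpow power_mult_distrib)
      finally have "real ((d choose N) * 2 ^ N) * 2 powr (- (t d * H))
        = real ((d choose N) * fact N) / real d ^ N * 2 powr (- (\<epsilon> * H))" by simp
      also have "\<dots> \<le> 1 * 2 powr (- (\<epsilon> * H))"
      proof (rule mult_right_mono)
        have "real ((d choose N) * fact N) \<le> real (d ^ N)" unfolding of_nat_le_iff by (rule binomial_fact_pow)
        then show "real ((d choose N) * fact N) / real d ^ N \<le> 1" using elim(4) by (simp add: divide_le_eq)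
      qed simp
      finally show ?thesis by simp
    qed
    have "interval_ineq d p n (t d)"
    proof (rule interval_ineq_of_normalized[OF t0 p])
      fix \<gamma> :: "int \<Rightarrow> real"
      assume \<gamma>: "\<And>x. 0 \<le> \<gamma> x" "\<And>x. x \<notin> {0..<int n} \<Longrightarrow> \<gamma> x = 0" "(\<Sum>y\<in>{0..<int n}. \<gamma> y) = 1"
      show "interval_form n p d (\<lambda>_ _ x. \<gamma> x powr (t d / real (p * 2 ^ d))) \<le> 1"
      proof (rule normalized_form_le_1[OF p n td \<gamma> \<delta>0])
        have "(\<Sum>k\<in>{1..<N}. real ((d choose k) * (2 * N) ^ k) * (real n ^ p * 2 powr (- (t d * binomial_entropy k))))
          \<le> (\<Sum>k\<in>{1..<N}. P k d * 2 powr (- (t d * binomial_entropy k)))"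
          by (intro sum_mono choose_le) auto
        then show "(1 - \<delta>0) powr (t d - p)
          + (\<Sum>k\<in>{1..<n - 1}. real ((d choose k) * (2 * (n - 1)) ^ k) * (real n ^ p * 2 powr (- (t d * binomial_entropy k))))
          + real ((d choose (n - 1)) * 2 ^ (n - 1)) * 2 powr (- (t d * binomial_entropy (n - 1))) \<le> 1"
          using elim(2) top unfolding N_def[symmetric] H_def by linarith
        have "(\<Sum>k\<in>{1..N}. real ((d choose k) * (2 * N) ^ k) * (real n ^ p * \<delta>0 powr (t d / 2 - 1)))
          \<le> (\<Sum>k\<in>{1..N}. P k d * \<delta>0 powr (t d / 2 - 1))"
          by (intro sum_mono choose_le) auto
        then show "(\<Sum>k\<in>{1..n - 1}. real ((d choose k) * (2 * (n - 1)) ^ k) * (real n ^ p * \<delta>0 powr (t d / 2 - 1))) \<le> 1"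
          using elim(3) unfolding N_def[symmetric] by linarith
      qed
    qed
    then have "t_exp d p n \<le> t d" by (intro t_exp_le t_admissible_of_interval_ineq p t0)
    then show ?case using elim(4) by (simp add: t_eq N_def H_def)
  qed
qed

text \<open>Binomial weights give equality in \<open>prod_subset_sums_le\<close> for faces with
  \<open>N\<close> directions 1 or -1. Keeping only these cubes, each of which contributes at least
  \<open>2 powr (- (t * H))\<close>, gives the bound.\<close>

lemma binomial_test:
  fixes t :: real
  assumes n: "n \<ge> 2" and p: "p \<ge> 1" and d: "d \<ge> 1" and t: "t > 0" and ineq: "interval_ineq d p n t"
  shows "real ((d choose (n - 1)) * 2 ^ (n - 1)) \<le> 2 powr (t * binomial_entropy (n - 1))"
proof -
  define N where "N = n - 1"
  have N: "N \<ge> 1" "n = Suc N" using n by (auto simp: N_def)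
  define H where "H = binomial_entropy N"
  define b where "b y = (if y \<in> {0..<int n} then real (N choose nat y) / 2 ^ N else 0)" for y :: int
  define m where "m = p * 2 ^ d"
  define q where "q = real m / t"
  have q: "q > 0" "1 / q = t / real m" using p t by (auto simp: q_def m_def)
  have b0: "0 \<le> b y" for y by (simp add: b_def)
  have b1: "(\<Sum>y\<in>{0..<int n}. b y) = 1"
  proof -
    have "(\<Sum>y\<in>{0..<int n}. b y) = (\<Sum>j\<le>N. real (N choose j) / 2 ^ N)"
      by (rule sum.reindex_bij_witness[where i = int and j = nat]) (auto simp: b_def N)
    also have "\<dots> = real (\<Sum>j\<le>N. N choose j) / 2 ^ N" by (simp add: sum_divide_distrib)
    finally show ?thesis by (simp only: choose_row_sum) simp
  qed
  define D where "D = {..<d} \<rightarrow>\<^sub>E {-int n<..<int n}"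
  define A where "A = {h\<in>{..<d} \<rightarrow>\<^sub>E insert 0 {-1, 1}. card (support_on d h) = N}"
  have A: "card A = (d choose N) * 2 ^ N" "A \<subseteq> D"
  proof -
    show "card A = (d choose N) * 2 ^ N"
      using card_functions_with_support[of "{-1, 1}" d N] by (simp add: A_def numeral_2_eq_2)
    have "insert 0 {-1, 1} \<subseteq> {-int n<..<int n}" using n by auto
    then show "A \<subseteq> D" unfolding A_def D_def using PiE_mono by blast
  qed
  have term_ge: "2 powr (- (t * H)) \<le> (\<Sum>x\<in>{0..<int n}. face d b h x powr (t / (real p * 2 ^ card (support_on d h)))) ^ p"
    if h: "h \<in> A" for h
  proof -
    define J where "J = support_on d h"
    have J: "finite J" "card J = N" using h by (auto simp: J_def A_def)
    have abs1: "\<bar>h j\<bar> = 1" if "j \<in> J" for j using h that by (auto simp: A_def J_def support_on_def PiE_iff)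
    \<comment> \<open>With this base point the lowest vertex is 0, so the vertex of a flipped subset
      \<open>S\<close> is \<open>card S\<close>.\<close>
    define x0 where "x0 = - (\<Sum>j\<in>{j\<in>J. h j < 0}. h j)"
    have "(\<Sum>j\<in>{j\<in>J. h j < 0}. h j) = (\<Sum>j\<in>{j\<in>J. h j < 0}. - 1)"
      using abs1 by (intro sum.cong) force+
    then have x0: "x0 = int (card {j\<in>J. h j < 0})" by (simp add: x0_def)
    have "card {j\<in>J. h j < 0} \<le> N" unfolding J(2)[symmetric] using J(1) by (intro card_mono) auto
    then have x0in: "x0 \<in> {0..<int n}" by (simp add: x0 N)
    have "face d b h x0 = (\<Prod>S\<in>Pow J. b (x0 + (\<Sum>j\<in>{j\<in>J. h j < 0}. h j) + (\<Sum>j\<in>S. \<bar>h j\<bar>)))"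
      unfolding face_def J_def[symmetric] by (rule prod_Pow_flip_signs[OF J(1)])
    also have "\<dots> = (\<Prod>S\<in>Pow J. real (card J choose card S) / 2 ^ card J)"
    proof (rule prod.cong[OF refl])
      fix S assume S: "S \<in> Pow J"
      have "(\<Sum>j\<in>S. \<bar>h j\<bar>) = (\<Sum>j\<in>S. 1)" using S abs1 by (intro sum.cong) auto
      moreover have "card S \<le> N" unfolding J(2)[symmetric] using J(1) S by (intro card_mono) auto
      ultimately show "b (x0 + (\<Sum>j\<in>{j\<in>J. h j < 0}. h j) + (\<Sum>j\<in>S. \<bar>h j\<bar>)) = real (card J choose card S) / 2 ^ card J"
        by (simp add: x0_def b_def J(2) N)
    qed
    also have "\<dots> = 2 powr (- (2 ^ N * H))"
      unfolding J(2) H_def by (rule prod_Pow_binomial_weights[OF J(1), unfolded J(2)])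
    finally have face: "face d b h x0 = 2 powr (- (2 ^ N * H))" .
    have "2 powr (- (t * H)) = (2 powr (- (t * H / p))) powr real p" using p by (simp add: powr_powr)
    also have "\<dots> = (2 powr (- (t * H / p))) ^ p" using p by (intro powr_realpow') auto
    also have "2 powr (- (t * H / p)) = face d b h x0 powr (t / (real p * 2 ^ N))"
      unfolding face powr_powr by (rule arg_cong) (simp add: field_simps)
    also have "(face d b h x0 powr (t / (real p * 2 ^ N))) ^ p
      \<le> (\<Sum>x\<in>{0..<int n}. face d b h x powr (t / (real p * 2 ^ N))) ^ p"
      using x0in by (intro power_mono member_le_sum) auto
    finally show ?thesis using J(2) by (simp add: J_def)
  qed
  have "real (card A) * 2 powr (- (t * H)) = (\<Sum>h\<in>A. 2 powr (- (t * H)))" by simp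
  also have "\<dots> \<le> (\<Sum>h\<in>A. (\<Sum>x\<in>{0..<int n}. face d b h x powr (t / (real p * 2 ^ card (support_on d h)))) ^ p)"
    by (rule sum_mono) (rule term_ge)
  also have "\<dots> \<le> (\<Sum>h\<in>D. (\<Sum>x\<in>{0..<int n}. face d b h x powr (t / (real p * 2 ^ card (support_on d h)))) ^ p)"
    using A(2) by (intro sum_mono2) (auto simp: D_def intro!: finite_PiE sum_nonneg zero_le_power)
  also have "\<dots> = interval_form n p d (\<lambda>_ _ x. b x powr (t / real (p * 2 ^ d)))"
    unfolding interval_form_eq_faces[OF p b0] D_def ..
  also have "\<dots> \<le> (\<Sum>y\<in>{0..<int n}. (b y powr (t / real (p * 2 ^ d))) powr (real (p * 2 ^ d) / t)) powr t"
  proof -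
    have "\<forall>x. 0 \<le> b x powr (t / real (p * 2 ^ d))" "\<forall>x. x \<notin> {0..<int n} \<longrightarrow> b x powr (t / real (p * 2 ^ d)) = 0"
      by (auto simp: b_def)
    then show ?thesis using ineq[unfolded interval_ineq_def, rule_format, of "\<lambda>x. b x powr (t / real (p * 2 ^ d))"] by simp
  qed
  also have "(\<Sum>y\<in>{0..<int n}. (b y powr (t / real (p * 2 ^ d))) powr (real (p * 2 ^ d) / t)) = (\<Sum>y\<in>{0..<int n}. b y)"
    using p t b0 by (intro sum.cong refl) (simp add: powr_powr)
  finally have "real (card A) * 2 powr (- (t * H)) \<le> 1" by (simp add: b1)
  then have "real (card A) * 2 powr (- (t * H)) * 2 powr (t * H) \<le> 1 * 2 powr (t * H)"
    by (intro mult_right_mono) auto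
  then show ?thesis by (simp add: A(1) H_def N_def mult.assoc flip: powr_add)
qed

theorem t_exp_lower_dimension:
  fixes \<epsilon> :: real
  assumes n: "n \<ge> 2" and p: "p \<ge> 1" and \<epsilon>: "\<epsilon> > 0"
  shows "\<forall>\<^sub>F d in sequentially.
    (real (n - 1) * log 2 (2 * real d) - log 2 (fact (n - 1))) / binomial_entropy (n - 1) - \<epsilon> \<le> t_exp d p n"
proof -
  define N where "N = n - 1"
  have N: "N \<ge> 1" using n by (simp add: N_def)
  define H where "H = binomial_entropy N"
  have H: "H > 0" unfolding H_def using N by (rule binomial_entropy_pos)
  have "(\<lambda>d. log 2 (1 - real N / real d)) \<longlonglongrightarrow> 0" by real_asymp
  then have "(\<lambda>d. real N * log 2 (1 - real N / real d)) \<longlonglongrightarrow> real N * 0" by (rule tendsto_mult_left)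
  then have "\<forall>\<^sub>F d in sequentially. - (\<epsilon> * H) < real N * log 2 (1 - real N / real d)"
    using \<epsilon> H by (intro order_tendstoD(1)) auto
  then show ?thesis
    using eventually_gt_at_top[of "N + 2"]
  proof eventually_elim
    case (elim d)
    have d2: "d \<ge> 2" "N \<le> d" "real N < real d" using elim by auto
    \<comment> \<open>The falling factorial of \<open>d\<close> is at least
      \<open>(d - N) ^ N\<close>, whose logarithm is \<open>N * log 2 d\<close> up to a vanishing
      error.\<close>
    have "(real d - real N) ^ N \<le> real ((d choose N) * fact N)"
    proof -
      have "(real d - real N) ^ N = (\<Prod>i=0..<N. real d - real N)" by simp
      also have "\<dots> \<le> (\<Prod>i=0..<N. real d - real i)" using d2 by (intro prod_mono) auto
      also have "\<dots> = fact N * (real d gchoose N)" by (simp add: gbinomial_prod_rev)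
      also have "\<dots> = real ((d choose N) * fact N)" by (simp add: binomial_gbinomial)
      finally show ?thesis .
    qed
    then have "log 2 ((real d - real N) ^ N) \<le> log 2 (real ((d choose N) * fact N))"
      using d2 by (subst log_le_cancel_iff) (auto simp: )
    moreover have "log 2 ((real d - real N) ^ N) = real N * log 2 (real d) + real N * log 2 (1 - real N / real d)"
    proof -
      have "real d - real N = real d * (1 - real N / real d)" "1 - real N / real d > 0" using d2 by (auto simp: field_simps)
      then have "log 2 (real d - real N) = log 2 (real d) + log 2 (1 - real N / real d)"
        using d2 by (simp add: log_mult)
      then show ?thesis using d2 by (simp add: log_nat_power algebra_simps)
    qed
    moreover have "log 2 (real ((d choose N) * fact N)) = log 2 (real (d choose N)) + log 2 (fact N)"
      using d2 by (simp add: log_mult)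
    ultimately have low: "real N * log 2 (real d) - \<epsilon> * H - log 2 (fact N) \<le> log 2 (real (d choose N))"
      using elim(1) by linarith
    show ?case
    proof (rule le_t_exp)
      show "t_admissible d p n (real d + real p - c_energy / log 2 n)" by (rule t_admissible_upper[OF d2(1) p n])
      fix s assume s: "t_admissible d p n s"
      then have s0: "s > 0" by (simp add: t_admissible_def)
      have "real ((d choose N) * 2 ^ N) \<le> 2 powr (s * H)"
        unfolding N_def H_def using d2 by (intro binomial_test[OF n p _ s0] interval_ineq_of_t_admissible p s) auto
      then have "log 2 (real ((d choose N) * 2 ^ N)) \<le> log 2 (2 powr (s * H))"
        using d2 by (subst log_le_cancel_iff) auto
      then have "log 2 (real (d choose N)) + N \<le> s * H"
        using d2 by (simp add: log_mult log_nat_power)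
      then have "real N * log 2 (2 * real d) - log 2 (fact N) \<le> s * H + \<epsilon> * H"
        using low d2 by (simp add: log_mult algebra_simps)
      then have "(real N * log 2 (2 * real d) - log 2 (fact N)) / H \<le> (s * H + \<epsilon> * H) / H"
        using H by (intro divide_right_mono) auto
      also have "\<dots> = s + \<epsilon>" using H by (simp add: add_divide_distrib)
      finally show "(real (n - 1) * log 2 (2 * real d) - log 2 (fact (n - 1))) / binomial_entropy (n - 1) - \<epsilon> \<le> s"
        by (simp add: N_def H_def)
    qed
  qed
qed

theorem t_exp_dimension_asymp:
  assumes n: "n \<ge> 2" and p: "p \<ge> 1"
  shows "(\<lambda>d. t_exp d p n - (real (n - 1) * log 2 (2 * real d) - log 2 (fact (n - 1)))
    / binomial_entropy (n - 1)) \<longlonglongrightarrow> 0"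
proof (rule LIMSEQ_I)
  fix r :: real assume r: "0 < r"
  have "\<forall>\<^sub>F d in sequentially. norm (t_exp d p n - (real (n - 1) * log 2 (2 * real d) - log 2 (fact (n - 1)))
    / binomial_entropy (n - 1) - 0) < r"
    using t_exp_upper_dimension[OF n p half_gt_zero[OF r]] t_exp_lower_dimension[OF n p half_gt_zero[OF r]]
  proof eventually_elim
    case (elim d)
    have aux: "norm (x - y - 0) < r" if "x \<le> y + r / 2" "y - r / 2 \<le> x" for x y :: real
      using that r by (simp add: abs_less_iff)
    show ?case by (rule aux) (use elim in auto)
  qed
  then show "\<exists>no. \<forall>d\<ge>no. norm (t_exp d p n - (real (n - 1) * log 2 (2 * real d) - log 2 (fact (n - 1)))
    / binomial_entropy (n - 1) - 0) < r"
    by (simp add: eventually_sequentially)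
qed

theorem theorem1p5:
  shows
    "(\<forall>d\<ge>2. \<forall>p\<ge>1.
        t_exp d p 2 = log 2 (2 ^ p + 2 * real d) \<and>
        q_exp d p 2 = 2 ^ d * real p / log 2 (2 ^ p + 2 * real d))
     \<and>
     (\<exists>c>0. \<forall>d\<ge>2. \<forall>p\<ge>1. \<exists>\<epsilon> :: nat \<Rightarrow> real. \<epsilon> \<longlonglongrightarrow> 0 \<and>
        (\<forall>\<^sub>F n in sequentially.
           real d + real p
             - (1 + \<epsilon> n) *
               ((real (d + p) * log 2 (real (d + p)) - real p * log 2 (real p) - 2 * real d)
                  / (2 * log 2 (real n)))
             \<le> t_exp d p n \<and>
           t_exp d p n \<le> real d + real p - c / log 2 (real n)))
     \<and>
     (\<forall>n\<ge>2. \<forall>p\<ge>1.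
        (\<lambda>d. t_exp d p n -
               (real (n - 1) * log 2 (2 * real d) - log 2 (fact (n - 1)))
                 / binomial_entropy (n - 1)) \<longlonglongrightarrow> 0)"
proof (intro conjI)
  show "\<forall>d\<ge>2. \<forall>p\<ge>1. t_exp d p 2 = log 2 (2 ^ p + 2 * real d) \<and>
    q_exp d p 2 = 2 ^ d * real p / log 2 (2 ^ p + 2 * real d)"
    using t_exp_two q_exp_two by blast
  show "\<exists>c>0. \<forall>d\<ge>2. \<forall>p\<ge>1. \<exists>\<epsilon> :: nat \<Rightarrow> real. \<epsilon> \<longlonglongrightarrow> 0 \<and>
        (\<forall>\<^sub>F n in sequentially.
           real d + real p
             - (1 + \<epsilon> n) *
               ((real (d + p) * log 2 (real (d + p)) - real p * log 2 (real p) - 2 * real d)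
                  / (2 * log 2 (real n)))
             \<le> t_exp d p n \<and>
           t_exp d p n \<le> real d + real p - c / log 2 (real n))"
  proof (intro exI[of _ c_energy] conjI allI impI c_energy_bounds(1))
    fix d p :: nat assume dp: "2 \<le> d" "1 \<le> p"
    obtain \<epsilon> :: "nat \<Rightarrow> real" where \<epsilon>: "\<epsilon> \<longlonglongrightarrow> 0" and lower: "\<forall>n\<ge>2. real d + real p - (1 + \<epsilon> n) *
      ((real (d + p) * log 2 (real (d + p)) - real p * log 2 (real p) - 2 * real d) / (2 * log 2 (real n)))
      \<le> t_exp d p n"
      using t_exp_lower_asymp[OF dp] by blast
    have "\<forall>n\<ge>2. t_exp d p n \<le> real d + real p - c_energy / log 2 (real n)"
      using t_exp_le[OF t_admissible_upper[OF dp]] by blast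
    then show "\<exists>\<epsilon> :: nat \<Rightarrow> real. \<epsilon> \<longlonglongrightarrow> 0 \<and>
        (\<forall>\<^sub>F n in sequentially.
           real d + real p
             - (1 + \<epsilon> n) *
               ((real (d + p) * log 2 (real (d + p)) - real p * log 2 (real p) - 2 * real d)
                  / (2 * log 2 (real n)))
             \<le> t_exp d p n \<and>
           t_exp d p n \<le> real d + real p - c_energy / log 2 (real n))"
      using \<epsilon> lower by (intro exI[of _ \<epsilon>] conjI) (auto intro!: eventually_sequentiallyI[of 2])
  qed
  show "\<forall>n\<ge>2. \<forall>p\<ge>1.
        (\<lambda>d. t_exp d p n -
               (real (n - 1) * log 2 (2 * real d) - log 2 (fact (n - 1)))
                 / binomial_entropy (n - 1)) \<longlonglongrightarrow> 0"
    using t_exp_dimension_asymp by blast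
qed

end
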